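(* Let $L\ge 1$ be an integer, let $W>0$, and let $\eta\in\mathbb{R}^+$, $p\in\mathbb{R}$, $q\in\mathbb{R}$. Let $\gamma_1,\gamma_2,\ldots,\gamma_L$ be (possibly correlated, not necessarily identically distributed) random variables with values in $(0,\infty)$ having a joint probability density function on $(0,\infty)^L$. Put $$\gamma_{end}=\eta\left(\frac1L\sum_{\ell=1}^{L}\gamma_\ell^{p}\right)^{q},\qquad \mathcal{C}_{avg}=\mathbb{E}\left[W\log_2(1+\gamma_{end})\right].$$ Let $\mathcal{M}_{\gamma_1^p,\gamma_2^p,\ldots,\gamma_L^p}(s)=\mathbb{E}\left[\exp\left(-s\sum_{\ell=1}^{L}\gamma_\ell^p\right)\right]$ for $s>0$. Then $$\mathcal{C}_{avg}=\frac{W}{\log(2)}\int_0^\infty C_{\eta,q}(s)\left[\frac{\partial}{\partial s}\mathcal{M}_{\gamma_1^p,\gamma_2^p,\ldots,\gamma_L^p}(s)\right]ds,$$ where, for $s>0$, $$C_{\eta,q}(s)=-H_{3,3}^{1,2}\left[\frac{\eta}{L^q s^q}\;\middle|\;\begin{array}{l}(1,1),(1,1),\left(1,\frac{|q|+q}{2}\right)\\ (1,1),(0,1),\left(0,\frac{|q|-q}{2}\right)\end{array}\right]$$ and $H^{m,n}_{p,q}[\cdot]$ denotes Fox's H function.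
   Context: $\log$ is the natural logarithm and $\log_2$ the logarithm to base 2. The variable $\gamma_\ell$ is the instantaneous signal-to-noise ratio (SNR) of the $\ell$th branch/hop, $\gamma_{end}$ is the overall instantaneous SNR, $W$ is the bandwidth, and $\mathcal{C}_{avg}$ is the ergodic capacity. The parameters $\eta,p,q$ specify the diversity-combining or transmission technique. Fox's H function is defined by the Mellin–Barnes integral $$H^{m,n}_{P,Q}\left[z\;\middle|\;\begin{array}{l}(a_1,A_1),\ldots,(a_P,A_P)\\ (b_1,B_1),\ldots,(b_Q,B_Q)\end{array}\right]=\frac{1}{2\pi i}\int_{\mathcal L}\frac{\prod_{j=1}^{m}\Gamma(b_j+B_jt)\prod_{j=1}^{n}\Gamma(1-a_j-A_jt)}{\prod_{j=n+1}^{P}\Gamma(a_j+A_jt)\prod_{j=m+1}^{Q}\Gamma(1-b_j-B_jt)}\,z^{-t}\,dt,$$ where $\mathcal L$ is a suitable contour (as usual in the definition of the H function: a line from $c-i\infty$ to $c+i\infty$, or a loop beginning and ending at $-\infty$ or at $+\infty$, according to convergence) separating the poles of the factors $\Gamma(b_j+B_jt)$, $1\le j\le m$ (to its left), from the poles of the factors $\Gamma(1-a_j-A_jt)$, $1\le j\le n$ (to its right). A parameter pair with second entry $0$ contributes the corresponding constant Gamma factor (here $\Gamma(1)=1$).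
   Formalization: For |q|>2 the formula is proved only when C_{η,q}(s)·∂M/∂s is absolutely integrable on (0,∞); otherwise it can fail (L=p=η=1, q=4, γ_1 exponential: finite capacity, divergent integral). Infinite capacity is expressed as failure of absolute integrability. *)

theory Defs
  imports "HOL-Probability.Probability"
begin

section \<open>Fox's H function\<close>

text \<open>
  The parameter lists hold the pairs \<open>(a\<^sub>j, A\<^sub>j)\<close> and \<open>(b\<^sub>j, B\<^sub>j)\<close> with \<open>A\<^sub>j, B\<^sub>j \<ge> 0\<close>; the
  numbers \<open>P\<close> and \<open>Q\<close> are their lengths. Since \<open>Gamma\<close> is \<open>0\<close> at its poles and \<open>x / 0 = 0\<close>, a
  pole of a Gamma function in the denominator gives the value \<open>0\<close>, as it should.
\<close>

definition fox_H_integrand ::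
  "nat \<Rightarrow> nat \<Rightarrow> (complex \<times> real) list \<Rightarrow> (complex \<times> real) list \<Rightarrow> complex \<Rightarrow> complex \<Rightarrow> complex"
  where "fox_H_integrand m n as bs z t =
    ((\<Prod>(b, B)\<leftarrow>take m bs. Gamma (b + of_real B * t)) *
     (\<Prod>(a, A)\<leftarrow>take n as. Gamma (1 - a - of_real A * t))) /
    ((\<Prod>(a, A)\<leftarrow>drop n as. Gamma (a + of_real A * t)) *
     (\<Prod>(b, B)\<leftarrow>drop m bs. Gamma (1 - b - of_real B * t))) * z powr (- t)"

text \<open>Factors with second entry \<open>0\<close> are constant in \<open>t\<close> and have no poles.\<close>

definition fox_H_left_poles :: "nat \<Rightarrow> (complex \<times> real) list \<Rightarrow> complex set"
  where "fox_H_left_poles m bs =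
    {t. \<exists>(b, B)\<in>set (take m bs). B \<noteq> 0 \<and> b + of_real B * t \<in> \<int>\<^sub>\<le>\<^sub>0}"

definition fox_H_right_poles :: "nat \<Rightarrow> (complex \<times> real) list \<Rightarrow> complex set"
  where "fox_H_right_poles n as =
    {t. \<exists>(a, A)\<in>set (take n as). A \<noteq> 0 \<and> 1 - a - of_real A * t \<in> \<int>\<^sub>\<le>\<^sub>0}"

text \<open>
  Contours are parametrised over the whole real line. The line runs from \<open>c - i\<infinity>\<close> to \<open>c + i\<infinity>\<close>.
  The left (right) loop comes in from \<open>-\<infinity>\<close> (\<open>+\<infinity>\<close>) along \<open>Im t = l\<close> up to \<open>Re t = c\<close>, climbs to
  \<open>Im t = u\<close>, and goes back to \<open>-\<infinity>\<close> (\<open>+\<infinity>\<close>); so the inside of the left loop lies to its left and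
  the inside of the right loop lies to its right.
\<close>

datatype fox_contour =
    Line real
  | Left_Loop real real real
  | Right_Loop real real real

fun contour_path :: "fox_contour \<Rightarrow> real \<Rightarrow> complex" where
  "contour_path (Line c) x = Complex c x"
| "contour_path (Left_Loop c l u) x =
     Complex (c - max 0 (l - x) - max 0 (x - u)) (max l (min u x))"
| "contour_path (Right_Loop c l u) x =
     Complex (c + max 0 (l - x) + max 0 (x - u)) (max l (min u x))"

fun left_side :: "fox_contour \<Rightarrow> complex set" where
  "left_side (Line c) = {t. Re t < c}"
| "left_side (Left_Loop c l u) = {t. Re t < c \<and> l < Im t \<and> Im t < u}"
| "left_side (Right_Loop c l u) = {t. Re t < c \<or> Im t < l \<or> u < Im t}"

fun right_side :: "fox_contour \<Rightarrow> complex set" where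
  "right_side (Line c) = {t. c < Re t}"
| "right_side (Left_Loop c l u) = {t. c < Re t \<or> Im t < l \<or> u < Im t}"
| "right_side (Right_Loop c l u) = {t. c < Re t \<and> l < Im t \<and> Im t < u}"

text \<open>
  The usual choice of the contour according to convergence. With
    \<open>a\<^sup>* = \<Sum>\<^sub>j\<^sub>\<le>\<^sub>n A\<^sub>j - \<Sum>\<^sub>j\<^sub>>\<^sub>n A\<^sub>j + \<Sum>\<^sub>j\<^sub>\<le>\<^sub>m B\<^sub>j - \<Sum>\<^sub>j\<^sub>>\<^sub>m B\<^sub>j\<close>,
    \<open>\<mu> = \<Sum> B\<^sub>j - \<Sum> A\<^sub>j\<close> and \<open>\<beta> = \<Prod> A\<^sub>j powr -A\<^sub>j * \<Prod> B\<^sub>j powr B\<^sub>j\<close> (where \<open>0\<close> to the power \<open>0\<close> is \<open>1\<close>),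
  the integral along the line converges for \<open>a\<^sup>* > 0\<close>, \<open>\<bar>arg z\<bar> < \<pi> a\<^sup>* / 2\<close>, the one along the left
  loop for \<open>\<mu> > 0\<close> and for \<open>\<mu> = 0\<close>, \<open>\<bar>z\<bar> < \<beta>\<close>, and the one along the right loop for \<open>\<mu> < 0\<close> and for
  \<open>\<mu> = 0\<close>, \<open>\<bar>z\<bar> > \<beta>\<close>. Where several of these apply, the integrals agree.
\<close>

definition fox_H_astar ::
  "nat \<Rightarrow> nat \<Rightarrow> (complex \<times> real) list \<Rightarrow> (complex \<times> real) list \<Rightarrow> real"
  where "fox_H_astar m n as bs =
    (\<Sum>(a, A)\<leftarrow>take n as. A) - (\<Sum>(a, A)\<leftarrow>drop n as. A) +
    (\<Sum>(b, B)\<leftarrow>take m bs. B) - (\<Sum>(b, B)\<leftarrow>drop m bs. B)"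

definition fox_H_mu :: "(complex \<times> real) list \<Rightarrow> (complex \<times> real) list \<Rightarrow> real"
  where "fox_H_mu as bs = (\<Sum>(b, B)\<leftarrow>bs. B) - (\<Sum>(a, A)\<leftarrow>as. A)"

definition fox_H_beta :: "(complex \<times> real) list \<Rightarrow> (complex \<times> real) list \<Rightarrow> real"
  where "fox_H_beta as bs =
    (\<Prod>(a, A)\<leftarrow>as. if A = 0 then 1 else A powr (- A)) *
    (\<Prod>(b, B)\<leftarrow>bs. if B = 0 then 1 else B powr B)"

definition fox_H_contours ::
  "nat \<Rightarrow> nat \<Rightarrow> (complex \<times> real) list \<Rightarrow> (complex \<times> real) list \<Rightarrow> complex \<Rightarrow> fox_contour set"
  where "fox_H_contours m n as bs z =
    (if fox_H_astar m n as bs > 0 \<and> \<bar>Arg z\<bar> < pi * fox_H_astar m n as bs / 2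
       then {Line c | c. True}
     else if fox_H_mu as bs > 0 \<or> fox_H_mu as bs = 0 \<and> norm z \<le> fox_H_beta as bs
       then {Left_Loop c l u | c l u. l < u}
     else {Right_Loop c l u | c l u. l < u})"

text \<open>
  The value does not depend on which separating contour of the selected shape is taken. Only
  contours with a straight vertical part are modelled, which is enough as soon as some vertical
  line separates the two families of poles.
\<close>

definition fox_H ::
  "nat \<Rightarrow> nat \<Rightarrow> (complex \<times> real) list \<Rightarrow> (complex \<times> real) list \<Rightarrow> complex \<Rightarrow> complex"
  where "fox_H m n as bs z =
    (THE v. \<exists>K\<in>fox_H_contours m n as bs z.
       fox_H_left_poles m bs \<subseteq> left_side K \<and>
       fox_H_right_poles n as \<subseteq> right_side K \<and>
       integrable lborel (\<lambda>x. fox_H_integrand m n as bs z (contour_path K x) *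
                              vector_derivative (contour_path K) (at x)) \<and>
       v = 1 / (2 * of_real pi * \<i>) *
           (\<integral>x. fox_H_integrand m n as bs z (contour_path K x) *
                vector_derivative (contour_path K) (at x) \<partial>lborel))"


section \<open>Ergodic capacity\<close>

definition gamma_end :: "real \<Rightarrow> real \<Rightarrow> real \<Rightarrow> nat \<Rightarrow> (nat \<Rightarrow> 'a \<Rightarrow> real) \<Rightarrow> 'a \<Rightarrow> real"
  where "gamma_end \<eta> p q L \<gamma> \<omega> = \<eta> * (1 / real L * (\<Sum>l=1..L. \<gamma> l \<omega> powr p)) powr q"

definition ergodic_capacity :: "'a measure \<Rightarrow> real \<Rightarrow> ('a \<Rightarrow> real) \<Rightarrow> real"
  where "ergodic_capacity M W X = (\<integral>\<omega>. W * log 2 (1 + X \<omega>) \<partial>M)"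

definition joint_mgf :: "'a measure \<Rightarrow> real \<Rightarrow> nat \<Rightarrow> (nat \<Rightarrow> 'a \<Rightarrow> real) \<Rightarrow> real \<Rightarrow> real"
  where "joint_mgf M p L \<gamma> s = (\<integral>\<omega>. exp (- s * (\<Sum>l=1..L. \<gamma> l \<omega> powr p)) \<partial>M)"

definition C_aux :: "real \<Rightarrow> real \<Rightarrow> nat \<Rightarrow> real \<Rightarrow> complex"
  where "C_aux \<eta> q L s =
    - fox_H 1 2 [(1, 1), (1, 1), (1, (\<bar>q\<bar> + q) / 2)] [(1, 1), (0, 1), (0, (\<bar>q\<bar> - q) / 2)]
        (of_real (\<eta> / (real L powr q * s powr q)))"

end

theory Submission
  imports Defs "HOL-Complex_Analysis.Complex_Analysis"
begin

text \<open>
  Off the integers, the integrand of the H function is \<open>\<pi> / (t sin \<pi>t) z\<^sup>-\<^sup>t / \<Gamma>(1 + qt)\<close>, whatever the sign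
  of \<open>q\<close>. Write \<open>g(s)\<close> for its contour integral at \<open>z = A s\<^sup>-\<^sup>q\<close>. As the integral of \<open>s\<^sup>q\<^sup>t X exp (-sX)\<close> over
  \<open>s > 0\<close> is \<open>\<Gamma>(1 + qt) X\<^sup>-\<^sup>q\<^sup>t\<close>, integrating \<open>g(s) X exp (-sX)\<close> under the contour integral cancels the
  Gamma factor and leaves the Mellin--Barnes integral of \<open>\<pi> / (t sin \<pi>t) w\<^sup>-\<^sup>t\<close> with \<open>w = A X\<^sup>q\<close>, which is
  \<open>ln (1 + w)\<close>. With \<open>X = \<Sum> \<gamma>\<^sub>l\<^sup>p\<close> and \<open>A = \<eta> / L\<^sup>q\<close> the theorem follows from Tonelli and Fubini, because
  the derivative of the moment generating function is \<open>- E (X exp (-sX))\<close>.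

  For \<open>\<bar>q\<bar> \<le> 2\<close> all this can be done on a vertical line (for \<open>\<bar>q\<bar> = 2\<close> the prescribed loop is first
  opened up to a line); moving the line towards \<open>0\<close> bounds \<open>\<bar>g\<bar>\<close> by a multiple of \<open>1 + ln (1 + z)\<close>, so that
  absolute convergence costs no more than the integrability of the capacity. For \<open>\<bar>q\<bar> > 2\<close> the
  exchange on the loop is only justified for \<open>w\<close> on one side of \<open>1\<close>, that is, for large \<open>X\<close>, and the
  Laplace transform identity is continued analytically to every \<open>X\<close> at which it converges absolutely.
\<close>

subsection \<open>Bounds for the Gamma function on vertical lines\<close>

text \<open>
  By Euler's product \<open>\<bar>\<Gamma>(\<sigma>) / \<Gamma>(\<sigma> + iy)\<bar>\<^sup>2 = \<Prod>\<^sub>k (1 + y\<^sup>2 / (\<sigma> + k)\<^sup>2)\<close>, whose factors are monotone in \<open>\<sigma>\<close>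
  and \<open>\<bar>y\<bar>\<close> and log-convex in \<open>\<sigma>\<close>; the reflection formula gives the values at \<open>\<sigma> = 1/2\<close> and \<open>\<sigma> = 1\<close>. Being
  log-convex, the ratio at \<open>\<sigma> = 3/4\<close> gains the factor \<open>\<bar>y\<bar> powr (-1/4)\<close> that makes the line integral
  converge absolutely in the borderline case \<open>q = 2\<close>.
\<close>

definition gamma_ratio :: "real \<Rightarrow> real \<Rightarrow> real"
  where "gamma_ratio \<sigma> y = Gamma \<sigma> * norm (rGamma (Complex \<sigma> y))"

definition gamma_ratio_prod :: "real \<Rightarrow> real \<Rightarrow> nat \<Rightarrow> real"
  where "gamma_ratio_prod \<sigma> y n = (\<Prod>k\<le>n. 1 + (y / (\<sigma> + real k))^2)"

lemma gamma_ratio_LIMSEQ: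
  assumes "\<sigma> > 0"
  shows "gamma_ratio_prod \<sigma> y \<longlonglongrightarrow> (gamma_ratio \<sigma> y)^2"
proof -
  have nz: "rGamma \<sigma> \<noteq> 0"
    using assms by (simp add: rGamma_eq_zero_iff nonpos_Ints_def)
  have lim: "(\<lambda>n. (norm (rGamma_series (Complex \<sigma> y) n) / norm (rGamma_series \<sigma> n))^2) \<longlonglongrightarrow>
      (norm (rGamma (Complex \<sigma> y)) / norm (rGamma \<sigma>))^2"
    using nz by (intro tendsto_intros) auto
  have "(norm (rGamma_series (Complex \<sigma> y) n) / norm (rGamma_series \<sigma> n))^2 = gamma_ratio_prod \<sigma> y n"
    if "n > 0" for n
  proof -
    have e: "norm (exp (Complex \<sigma> y * of_real (ln (real n)))) = exp (\<sigma> * ln (real n))"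
      by (simp add: norm_exp_eq_Re)
    have pos: "\<sigma> + real k > 0" for k using assms by linarith
    have f: "(norm (Complex \<sigma> y + of_nat k) / \<bar>\<sigma> + real k\<bar>)^2 = 1 + (y / (\<sigma> + real k))^2" for k
      using pos[of k]
      by (simp add: power_divide cmod_power2 add_divide_distrib)
    have "norm (pochhammer (Complex \<sigma> y) (n+1)) = (\<Prod>k\<le>n. norm (Complex \<sigma> y + of_nat k))"
      by (simp add: pochhammer_Suc_prod prod_norm atMost_atLeast0)
    moreover have "norm (pochhammer \<sigma> (n+1)) = (\<Prod>k\<le>n. \<bar>\<sigma> + real k\<bar>)"
      by (simp add: pochhammer_Suc_prod abs_prod atMost_atLeast0)
    ultimately have "norm (rGamma_series (Complex \<sigma> y) n) / norm (rGamma_series \<sigma> n) =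
        (\<Prod>k\<le>n. norm (Complex \<sigma> y + of_nat k) / \<bar>\<sigma> + real k\<bar>)"
      unfolding rGamma_series_def
      by (simp add: norm_divide norm_mult e abs_mult prod_dividef norm_fact del: Suc_eq_plus1)
    thus ?thesis
      by (simp only: gamma_ratio_prod_def prod_power_distrib f)
  qed
  hence "\<forall>\<^sub>F n in sequentially. (norm (rGamma_series (Complex \<sigma> y) n) / norm (rGamma_series \<sigma> n))^2
      = gamma_ratio_prod \<sigma> y n"
    using eventually_gt_at_top[of "0::nat"] by (rule eventually_mono[rotated]) blast
  hence "gamma_ratio_prod \<sigma> y \<longlonglongrightarrow> (norm (rGamma (Complex \<sigma> y)) / norm (rGamma \<sigma>))^2"
    by (rule Lim_transform_eventually[OF lim])
  also have "norm (rGamma (Complex \<sigma> y)) / norm (rGamma \<sigma>) = gamma_ratio \<sigma> y"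
    using Gamma_real_pos[OF assms]
    by (simp add: gamma_ratio_def rGamma_inverse_Gamma field_simps)
  finally show ?thesis .
qed

lemma gamma_ratio_nonneg: "\<sigma> > 0 \<Longrightarrow> gamma_ratio \<sigma> y \<ge> 0"
  by (simp add: gamma_ratio_def)

lemma norm_rGamma_eq_gamma_ratio:
  assumes "\<sigma> > 0"
  shows "norm (rGamma (Complex \<sigma> y)) = gamma_ratio \<sigma> y / Gamma \<sigma>"
  unfolding gamma_ratio_def using Gamma_real_pos[OF assms] by (metis less_irrefl nonzero_mult_div_cancel_left)

lemma gamma_ratio_mono:
  assumes "0 < \<sigma>" "\<sigma> \<le> \<tau>" "\<bar>y\<bar> \<le> \<bar>y'\<bar>"
  shows "gamma_ratio \<tau> y \<le> gamma_ratio \<sigma> y'"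
proof -
  have "gamma_ratio_prod \<tau> y n \<le> gamma_ratio_prod \<sigma> y' n" for n
    unfolding gamma_ratio_prod_def
  proof (intro prod_mono conjI)
    fix k assume "k \<in> {..n}"
    have "\<bar>y / (\<tau> + real k)\<bar> \<le> \<bar>y' / (\<sigma> + real k)\<bar>"
      unfolding abs_divide using assms by (intro frac_le) auto
    hence "(y / (\<tau> + real k))^2 \<le> (y' / (\<sigma> + real k))^2"
      by (rule abs_le_square_iff[THEN iffD1])
    thus "1 + (y / (\<tau> + real k))^2 \<le> 1 + (y' / (\<sigma> + real k))^2"
      by (rule add_left_mono)
  qed auto
  hence "(gamma_ratio \<tau> y)^2 \<le> (gamma_ratio \<sigma> y')^2"
    using assms gamma_ratio_LIMSEQ[of \<tau> y] gamma_ratio_LIMSEQ[of \<sigma> y']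
    by (intro LIMSEQ_le[of "gamma_ratio_prod \<tau> y" _ "gamma_ratio_prod \<sigma> y'"]) auto
  thus ?thesis
    using gamma_ratio_nonneg[OF assms(1)] by (rule power2_le_imp_le)
qed

lemma gamma_ratio_midpoint:
  assumes "0 < a" "0 < b"
  shows "(gamma_ratio ((a + b) / 2) y)^2 \<le> gamma_ratio a y * gamma_ratio b y"
proof -
  have le: "(1 + (y / ((a + b) / 2 + k))^2)^2 \<le> (1 + (y / (a + k))^2) * (1 + (y / (b + k))^2)"
    if k: "k \<ge> 0" for k :: real
  proof -
    define A B m where "A = a + k" and "B = b + k" and "m = (a + b) / 2 + k"
    have pos: "A > 0" "B > 0" "m > 0" unfolding A_def B_def m_def by (intro add_pos_nonneg; use assms k in simp)+
    have m: "m = (A + B) / 2" by (simp add: A_def B_def m_def field_simps)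
    have AB: "A * B \<le> m^2"
      using sum_squares_ge_zero[of "A - B" 0] unfolding m by (simp add: power2_eq_square field_simps)
    have 1: "1 / (m^2) \<le> 1 / (A * B)"
      using AB pos by (intro divide_left_mono) auto
    have "(1 / A - 1 / B)^2 \<ge> 0" by simp
    hence 2: "2 / (A * B) \<le> 1 / A^2 + 1 / B^2"
      by (simp add: power2_diff power_divide)
    have "(1 + (y / m)^2)^2 = 1 + y^2 * (2 * (1 / m^2)) + (y^2)^2 * (1 / m^2)^2"
      by (simp add: power2_sum power_divide)
    also have "\<dots> \<le> 1 + y^2 * (2 * (1 / (A * B))) + (y^2)^2 * (1 / (A * B))^2"
      using 1 pos by (intro add_mono mult_left_mono power_mono order.refl) auto
    also have "\<dots> \<le> 1 + y^2 * (1 / A^2 + 1 / B^2) + (y^2)^2 * (1 / (A * B))^2"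
      using 2 by (intro add_mono mult_left_mono order.refl) auto
    also have "\<dots> = (1 + (y / A)^2) * (1 + (y / B)^2)"
      by (simp add: power_divide algebra_simps add_divide_distrib power2_eq_square)
    finally show ?thesis by (simp add: A_def B_def m_def)
  qed
  have lim1: "(\<lambda>n. (gamma_ratio_prod ((a + b) / 2) y n)^2) \<longlonglongrightarrow> ((gamma_ratio ((a + b) / 2) y)^2)^2"
    using assms by (intro tendsto_intros gamma_ratio_LIMSEQ) auto
  have lim2: "(\<lambda>n. gamma_ratio_prod a y n * gamma_ratio_prod b y n) \<longlonglongrightarrow>
      (gamma_ratio a y)^2 * (gamma_ratio b y)^2"
    using assms by (intro tendsto_intros gamma_ratio_LIMSEQ) auto
  have "((gamma_ratio ((a + b) / 2) y)^2)^2 \<le> (gamma_ratio a y)^2 * (gamma_ratio b y)^2"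
  proof (rule LIMSEQ_le[OF lim1 lim2], intro exI allI impI)
    fix n :: nat
    show "(gamma_ratio_prod ((a + b) / 2) y n)^2 \<le> gamma_ratio_prod a y n * gamma_ratio_prod b y n"
      unfolding gamma_ratio_prod_def prod_power_distrib prod.distrib[symmetric]
      by (intro prod_mono conjI le) auto
  qed
  hence "((gamma_ratio ((a + b) / 2) y)^2)^2 \<le> (gamma_ratio a y * gamma_ratio b y)^2"
    by (simp add: power_mult_distrib)
  thus ?thesis
    by (rule power2_le_imp_le) (use assms in \<open>simp add: gamma_ratio_nonneg\<close>)
qed

lemma gamma_ratio_half_sq: "(gamma_ratio (1/2) y)^2 = cosh (pi * y)"
proof -
  define z where "z = Complex (1/2) y"
  have z: "1 - z = cnj z" by (simp add: z_def complex_eq_iff)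
  have "rGamma z * rGamma (cnj z) = sin (of_real pi * z) / of_real pi"
    unfolding z[symmetric] by (rule rGamma_reflection_complex)
  also have "of_real pi * z = of_real pi / 2 - (- (\<i> * of_real (pi * y)))"
    by (simp add: z_def complex_eq_iff)
  also have "sin \<dots> = cos (\<i> * of_real (pi * y))"
    by (simp add: sin_add)
  also have "\<dots> = of_real (cosh (pi * y))"
    unfolding cos_i_times cosh_field_def exp_of_real by (simp add: exp_minus)
  finally have "of_real ((norm (rGamma z))^2) = complex_of_real (cosh (pi * y) / pi)"
    unfolding complex_norm_square cnj_rGamma by simp
  hence "(norm (rGamma z))^2 = cosh (pi * y) / pi"
    by (simp only: of_real_eq_iff)
  thus ?thesis
    by (simp add: gamma_ratio_def power_mult_distrib Gamma_one_half_real z_def)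
qed

lemma gamma_ratio_1_sq:
  assumes "y \<noteq> 0"
  shows "(gamma_ratio 1 y)^2 = sinh (pi * y) / (pi * y)"
proof -
  define z where "z = \<i> * of_real y"
  have z: "1 - z = cnj (1 + z)" by (simp add: z_def complex_eq_iff)
  have "z * rGamma (1 + z) * rGamma (cnj (1 + z)) = sin (of_real pi * z) / of_real pi"
    using rGamma_reflection_complex[of z] rGamma_plus1[of z] unfolding z by (simp add: add.commute)
  also have "of_real pi * z = \<i> * of_real (pi * y)"
    by (simp add: z_def)
  also have "sin \<dots> = \<i> * of_real (sinh (pi * y))"
    unfolding sin_i_times sinh_field_def exp_of_real by (simp add: exp_minus)
  finally have "\<i> * (of_real y * (rGamma (1 + z) * cnj (rGamma (1 + z)))) = \<i> * (complex_of_real (sinh (pi * y)) / of_real pi)"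
    unfolding cnj_rGamma[symmetric] by (simp add: z_def mult.assoc)
  hence "of_real (y * (norm (rGamma (1 + z)))^2) = complex_of_real (sinh (pi * y) / pi)"
    unfolding of_real_mult complex_norm_square mult_cancel_left by simp
  hence "y * (norm (rGamma (1 + z)))^2 = sinh (pi * y) / pi"
    by (simp only: of_real_eq_iff)
  moreover have "1 + z = Complex 1 y" by (simp add: z_def complex_eq_iff)
  ultimately show ?thesis using assms by (simp add: gamma_ratio_def field_simps)
qed

lemma gamma_ratio_three_quarters_le:
  assumes "y \<ge> 1"
  shows "gamma_ratio (3/4) y \<le> exp (pi * y / 2) * y powr (-1/4)"
proof -
  have "((gamma_ratio (3/4) y)^2)^2 \<le> (gamma_ratio (1/2) y * gamma_ratio 1 y)^2"
    using gamma_ratio_midpoint[of "1/2" 1 y] by (intro power_mono) auto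
  also have "\<dots> = cosh (pi * y) * sinh (pi * y) / (pi * y)"
    using assms by (simp add: power_mult_distrib gamma_ratio_half_sq gamma_ratio_1_sq)
  also have "\<dots> \<le> exp (pi * y) * exp (pi * y) / y"
  proof (rule frac_le)
    have "sinh (pi * y) \<ge> 0" using assms by simp
    moreover have "cosh (pi * y) \<le> exp (pi * y)" "sinh (pi * y) \<le> exp (pi * y)"
      using assms order_trans[of "- exp (- (pi * y))" 0 "exp (pi * y)"]
      by (auto simp: cosh_def sinh_def)
    ultimately show "cosh (pi * y) * sinh (pi * y) \<le> exp (pi * y) * exp (pi * y)"
      by (intro mult_mono) auto
    show "y \<le> pi * y" using assms pi_ge_two by simp
  qed (use assms in auto)
  also have "\<dots> = ((exp (pi * y / 2) * y powr (-1/4))^2)^2"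
  proof -
    have "((y powr (-1/4))^2)^2 = 1 / y"
      using assms powr_power[of y "-1/4" 4] by (simp add: powr_minus_divide)
    moreover have "((exp (pi * y / 2))^2)^2 = exp (pi * y) * exp (pi * y)"
      by (simp flip: exp_double exp_add)
    ultimately show ?thesis unfolding power_mult_distrib by simp
  qed
  finally have "(gamma_ratio (3/4) y)^2 \<le> (exp (pi * y / 2) * y powr (-1/4))^2"
    by (rule power2_le_imp_le) auto
  thus ?thesis by (rule power2_le_imp_le) auto
qed

lemma Gamma_ge_power:
  fixes x B :: real
  assumes "x > 0" "B > 0"
  shows "Gamma x \<ge> B powr x * exp (- B - 1) / (B + 1)"
proof -
  have "((\<lambda>t. if t \<in> {B..B+1} then B powr x * exp (- B - 1) / (B + 1) else 0) has_integral
      (B powr x * exp (- B - 1) / (B + 1))) {0..}"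
    using has_integral_const_real[of "B powr x * exp (- B - 1) / (B + 1)" B "B+1"] assms
    by (subst has_integral_restrict) auto
  moreover have "((\<lambda>t. t powr (x - 1) / exp t) has_integral Gamma x) {0..}"
    by (rule Gamma_integral_real) fact
  ultimately show ?thesis
  proof (rule has_integral_le)
    fix t :: real assume "t \<in> {0..}"
    show "(if t \<in> {B..B+1} then B powr x * exp (- B - 1) / (B + 1) else 0) \<le> t powr (x - 1) / exp t"
    proof (cases "t \<in> {B..B+1}")
      case True
      have "B powr x * exp (- B - 1) / (B + 1) \<le> t powr x * exp (- t) / t"
        using True assms by (intro frac_le mult_mono powr_mono2) auto
      also have "\<dots> = t powr (x - 1) / exp t"
        using True assms by (simp add: powr_diff exp_minus field_simps)
      finally show ?thesis using True by simp
    qed auto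
  qed
qed

subsection \<open>The Mellin--Barnes kernel\<close>

definition mb_kernel :: "real \<Rightarrow> real \<Rightarrow> complex \<Rightarrow> complex"
  where "mb_kernel q z t =
    of_real pi / (t * sin (of_real pi * t)) * rGamma (1 + of_real q * t) * of_real z powr (- t)"

text \<open>
  Every separating contour runs in this domain. As it is starlike, the kernel has one primitive on it,
  and each contour integral is a difference of limits of that primitive.
\<close>

definition mb_dom :: "complex set"
  where "mb_dom = {t. Im t \<noteq> 0 \<or> -1 < Re t \<and> Re t < 0}"

lemma mb_dom_not_Ints:
  assumes "t \<in> mb_dom"
  shows "t \<notin> \<int>"
proof
  assume "t \<in> \<int>"
  then obtain k :: int where k: "t = of_int k" by (elim Ints_cases)
  with assms have "-1 < k" "k < 0" by (auto simp: mb_dom_def)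
  thus False by simp
qed

lemma mb_dom_sin_nonzero:
  assumes "t \<in> mb_dom"
  shows "sin (of_real pi * t) \<noteq> 0"
proof
  assume "sin (of_real pi * t) = 0"
  then obtain k :: int where "of_real pi * t = of_real (of_int k * pi)"
    unfolding sin_eq_0 by blast
  hence "t = of_int k" by simp
  thus False using mb_dom_not_Ints[OF assms] by simp
qed

lemma open_mb_dom: "open mb_dom"
proof -
  have "mb_dom = {t. Im t \<noteq> 0} \<union> {t. -1 < Re t} \<inter> {t. Re t < 0}"
    by (auto simp: mb_dom_def)
  moreover have "open {t. Im t \<noteq> 0}"
    by (intro open_Collect_neq continuous_intros)
  ultimately show ?thesis
    using open_halfspace_Re_gt[of "-1"] open_halfspace_Re_lt[of 0] by (metis open_Int open_Un)
qed

lemma starlike_mb_dom: "starlike mb_dom"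
  unfolding starlike_def
proof (intro bexI[of _ "-1/2"] ballI subsetI)
  fix t s assume t: "t \<in> mb_dom" and s: "s \<in> closed_segment (-1/2) t"
  then obtain r where r: "0 \<le> r" "r \<le> 1" and s: "s = (1 - r) *\<^sub>R (-1/2) + r *\<^sub>R t"
    by (auto simp: closed_segment_def)
  show "s \<in> mb_dom"
  proof (cases "Im t = 0 \<or> r = 0")
    case True
    have "Re s = - (1/2) + r * (Re t + 1/2)" by (simp add: s algebra_simps)
    moreover have "\<bar>r * (Re t + 1/2)\<bar> < 1/2" if "r \<noteq> 0"
    proof -
      have "\<bar>Re t + 1/2\<bar> < 1/2" using True that t by (auto simp: mb_dom_def abs_if)
      moreover have "\<bar>r * (Re t + 1/2)\<bar> \<le> 1 * \<bar>Re t + 1/2\<bar>"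
        unfolding abs_mult using r by (intro mult_right_mono) auto
      ultimately show ?thesis unfolding mult_1 by (rule le_less_trans[rotated])
    qed
    ultimately show ?thesis by (cases "r = 0") (auto simp: mb_dom_def abs_less_iff)
  qed (auto simp: mb_dom_def s)
qed (auto simp: mb_dom_def)

lemma of_real_powr_minus_eq_exp:
  "z > 0 \<Longrightarrow> (of_real z :: complex) powr (- t) = exp (- t * of_real (ln z))"
  by (simp add: powr_def Ln_of_real)

lemma holomorphic_mb_kernel:
  assumes "z > 0"
  shows "mb_kernel q z holomorphic_on mb_dom"
proof -
  have "t \<noteq> 0" if "t \<in> mb_dom" for t using mb_dom_not_Ints[OF that] by auto
  thus ?thesis
    unfolding mb_kernel_def of_real_powr_minus_eq_exp[OF assms]
    using mb_dom_sin_nonzero by (intro holomorphic_intros) auto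
qed

lemma mb_kernel_primitive:
  assumes "z > 0"
  obtains G where "\<And>t. t \<in> mb_dom \<Longrightarrow> (G has_field_derivative mb_kernel q z t) (at t)"
proof -
  have "\<exists>G. \<forall>t\<in>mb_dom. (G has_field_derivative mb_kernel q z t) (at t)"
    using holomorphic_mb_kernel[OF assms, of q] open_mb_dom
    by (intro holomorphic_starlike_primitive[where k = "{}"] starlike_mb_dom)
       (auto simp: holomorphic_on_open field_differentiable_def holomorphic_on_imp_continuous_on)
  thus ?thesis using that by blast
qed

lemma norm_mb_kernel:
  assumes "z > 0"
  shows "norm (mb_kernel q z t) =
    pi / (norm t * norm (sin (of_real pi * t))) * norm (rGamma (1 + of_real q * t)) * z powr (- Re t)"
  using assms
  by (simp add: mb_kernel_def norm_mult norm_divide of_real_powr_minus_eq_exp norm_exp_eq_Re powr_def)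

lemma norm_sin_pi_sq:
  "(norm (sin (of_real pi * t)))^2 = (sinh (pi * Im t))^2 + (sin (pi * Re t))^2"
proof -
  have "cos (2 * (pi * Re t)) = 1 - 2 * (sin (pi * Re t))^2" by (rule cos_double_sin)
  moreover have "(sinh (pi * Im t))^2 = (exp (2 * (pi * Im t)) + inverse (exp (2 * (pi * Im t))) - 2) / 4"
    by (simp add: sinh_field_def power2_eq_square exp_minus[symmetric] algebra_simps flip: exp_add)
  ultimately show ?thesis
    by (simp add: norm_sin_squared)
qed

lemma norm_sin_pi_ge: "norm (sin (of_real pi * t)) \<ge> sinh (pi * \<bar>Im t\<bar>)"
proof (rule power2_le_imp_le)
  have "(sinh (pi * \<bar>Im t\<bar>))^2 = (sinh (pi * Im t))^2"
    by (cases "Im t \<ge> 0") (simp_all add: abs_if)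
  thus "(sinh (pi * \<bar>Im t\<bar>))^2 \<le> (norm (sin (of_real pi * t)))^2"
    by (simp add: norm_sin_pi_sq)
qed auto

lemma norm_mb_kernel_le:
  assumes "z > 0" "Im t \<noteq> 0"
  shows "norm (mb_kernel q z t) \<le>
    pi / (\<bar>Im t\<bar> * sinh (pi * \<bar>Im t\<bar>)) * norm (rGamma (1 + of_real q * t)) * z powr (- Re t)"
  unfolding norm_mb_kernel[OF assms(1)]
proof (intro mult_right_mono divide_left_mono mult_mono mult_pos_pos abs_Im_le_cmod norm_sin_pi_ge)
  have "0 < sinh (pi * \<bar>Im t\<bar>)" using assms(2) by simp
  thus "0 < norm (sin (of_real pi * t))" by (rule less_le_trans[OF _ norm_sin_pi_ge])
qed (use assms(2) in auto)

lemma norm_mb_kernel_le_gamma_ratio: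
  assumes "z > 0" "y \<noteq> 0" "0 < 1 + q * c" "q * c \<le> q * x"
  shows "norm (mb_kernel q z (Complex x y)) \<le>
    pi / (\<bar>y\<bar> * sinh (pi * \<bar>y\<bar>)) * gamma_ratio (1 + q * c) (q * y) * (z powr (- x) / Gamma (1 + q * x))"
proof -
  have pos: "0 < 1 + q * x" using assms by linarith
  have "norm (rGamma (1 + of_real q * Complex x y)) = gamma_ratio (1 + q * x) (q * y) / Gamma (1 + q * x)"
    using norm_rGamma_eq_gamma_ratio[OF pos, of "q * y"]
    by (simp add: complex_eq_iff Complex_eq algebra_simps)
  also have "\<dots> \<le> gamma_ratio (1 + q * c) (q * y) / Gamma (1 + q * x)"
    using assms pos Gamma_real_pos[OF pos] by (intro divide_right_mono gamma_ratio_mono) auto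
  finally have *: "norm (rGamma (1 + of_real q * Complex x y)) \<le> gamma_ratio (1 + q * c) (q * y) / Gamma (1 + q * x)" .
  have "norm (mb_kernel q z (Complex x y)) \<le>
      pi / (\<bar>y\<bar> * sinh (pi * \<bar>y\<bar>)) * norm (rGamma (1 + of_real q * Complex x y)) * z powr (- x)"
    using norm_mb_kernel_le[of z "Complex x y" q] assms by simp
  also have "\<dots> \<le> pi / (\<bar>y\<bar> * sinh (pi * \<bar>y\<bar>)) * (gamma_ratio (1 + q * c) (q * y) / Gamma (1 + q * x)) * z powr (- x)"
    by (intro mult_right_mono mult_left_mono *) auto
  finally show ?thesis by simp
qed

lemma fox_H_integrand_eq_mb_kernel:
  assumes "t \<in> mb_dom"
  shows "fox_H_integrand 1 2 [(1, 1), (1, 1), (1, (\<bar>q\<bar> + q) / 2)] [(1, 1), (0, 1), (0, (\<bar>q\<bar> - q) / 2)]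
    (of_real z) t = mb_kernel q z t"
proof -
  have nI: "- t \<notin> \<int>" "t \<notin> \<int>" using mb_dom_not_Ints[OF assms] by (auto simp: minus_in_Ints_iff)
  hence nI': "- t \<notin> \<int>\<^sub>\<le>\<^sub>0" using nonpos_Ints_subset_Ints by blast
  have nz: "Gamma (- t) \<noteq> 0" "t \<noteq> 0" using nI nI' by (auto simp: Gamma_eq_zero_iff)
  have 1: "Gamma (1 - t) = - t * Gamma (- t)"
    using Gamma_plus1[OF nI'] by (simp add: add.commute)
  have 2: "Gamma (1 + t) * Gamma (- t) = - (of_real pi / sin (of_real pi * t))"
    using Gamma_reflection_complex[of "- t"] by (simp add: mult.commute)
  have 3: "Gamma (1 + of_real ((\<bar>q\<bar> + q) / 2) * t) * Gamma (1 - of_real ((\<bar>q\<bar> - q) / 2) * t) =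
      Gamma (1 + of_real q * t)"
    by (cases "q \<ge> 0") (simp_all add: abs_if)
  have "fox_H_integrand 1 2 [(1, 1), (1, 1), (1, (\<bar>q\<bar> + q) / 2)] [(1, 1), (0, 1), (0, (\<bar>q\<bar> - q) / 2)]
      (of_real z) t =
    (Gamma (1 + t) * Gamma (- t)) * Gamma (- t) / (Gamma (1 - t) *
     (Gamma (1 + of_real ((\<bar>q\<bar> + q) / 2) * t) * Gamma (1 - of_real ((\<bar>q\<bar> - q) / 2) * t))) * of_real z powr (- t)"
    by (simp add: fox_H_integrand_def numeral_2_eq_2 mult_ac)
  also have "\<dots> = mb_kernel q z t"
    unfolding 1 2 3 mb_kernel_def rGamma_inverse_Gamma using nz by (simp add: field_simps)
  finally show ?thesis .
qed

subsection \<open>Contours and primitives\<close>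

lemma has_integral_nonneg_imp_set_integrable:
  fixes f :: "real \<Rightarrow> real"
  assumes "f \<in> borel_measurable borel" "S \<in> sets borel" "\<And>x. x \<in> S \<Longrightarrow> 0 \<le> f x" "(f has_integral I) S"
  shows "set_integrable lborel S f" "(LINT x:S|lborel. f x) = I"
proof -
  have "f absolutely_integrable_on S"
    using assms by (intro nonnegative_absolutely_integrable_1) auto
  thus *: "set_integrable lborel S f"
    using assms unfolding set_integrable_def by (subst (asm) integrable_completion) auto
  show "(LINT x:S|lborel. f x) = I"
    using set_borel_integral_eq_integral(2)[OF *] assms(4) by (simp add: integral_unique)
qed

lemma set_integrable_exp_neg:
  fixes k a :: real
  assumes "k > 0"
  shows "set_integrable lborel {a..} (\<lambda>x. exp (- k * x))"
  by (rule has_integral_nonneg_imp_set_integrable[OF _ _ _ has_integral_exp_minus_to_infinity[OF assms]])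
    auto

definition loop_depth :: "real \<Rightarrow> real \<Rightarrow> real \<Rightarrow> real"
  where "loop_depth l u x = max 0 (l - x) + max 0 (x - u)"

lemma loop_depth_nonneg: "loop_depth l u x \<ge> 0"
  by (simp add: loop_depth_def)

lemma integrable_exp_loop_depth:
  assumes "k > 0" "l \<le> u"
  shows "integrable lborel (\<lambda>x. exp (- k * loop_depth l u x))"
proof -
  have 1: "integrable lborel (\<lambda>x. indicator {0..} x * exp (- k * x))"
    using set_integrable_exp_neg[OF assms(1), of 0] by (simp add: set_integrable_def)
  have 2: "integrable lborel (\<lambda>x. indicator {0..} (- u + 1 * x) * exp (- k * (- u + 1 * x)))"
    by (rule lborel_integrable_real_affine[OF 1]) simp
  have 3: "integrable lborel (\<lambda>x. indicator {0..} (l + (-1) * x) * exp (- k * (l + (-1) * x)))"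
    by (rule lborel_integrable_real_affine[OF 1]) simp
  have 4: "integrable lborel (indicator {l..u} :: real \<Rightarrow> real)"
    using assms by (auto intro!: integrable_real_indicator)
  show ?thesis
  proof (rule Bochner_Integration.integrable_bound[OF Bochner_Integration.integrable_add[OF
        Bochner_Integration.integrable_add[OF 2 3] 4]])
    show "(\<lambda>x. exp (- k * loop_depth l u x)) \<in> borel_measurable lborel"
      unfolding loop_depth_def by measurable
    have "exp (- k * loop_depth l u x) \<le> indicator {0..} (- u + 1 * x) * exp (- k * (- u + 1 * x)) +
        indicator {0..} (l + (-1) * x) * exp (- k * (l + (-1) * x)) + indicator {l..u} x" for x
    proof (cases "x < l \<or> u < x")
      case True
      thus ?thesis using assms(2) by (auto simp: loop_depth_def indicator_def)
    next
      case False
      hence "loop_depth l u x = 0" "indicator {l..u} x = (1::real)" by (auto simp: loop_depth_def)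
      thus ?thesis by simp
    qed
    thus "AE x in lborel. norm (exp (- k * loop_depth l u x)) \<le> norm (indicator {0..} (- u + 1 * x) * exp (- k * (- u + 1 * x)) +
        indicator {0..} (l + (-1) * x) * exp (- k * (l + (-1) * x)) + indicator {l..u} x)"
      unfolding real_norm_def abs_exp_cancel by (intro AE_I2 order_trans[OF _ abs_ge_self]) simp
  qed
qed

definition loop_contour :: "real \<Rightarrow> real \<Rightarrow> real \<Rightarrow> real \<Rightarrow> fox_contour"
  where "loop_contour e c l u = (if e < 0 then Left_Loop c l u else Right_Loop c l u)"

lemma contour_path_loop_contour:
  "\<bar>e\<bar> = 1 \<Longrightarrow> contour_path (loop_contour e c l u) x = Complex (c + e * loop_depth l u x) (max l (min u x))"
  by (auto simp: loop_contour_def loop_depth_def abs_if split: if_splits)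

fun contour_deriv :: "fox_contour \<Rightarrow> real \<Rightarrow> complex" where
  "contour_deriv (Line c) x = \<i>"
| "contour_deriv (Left_Loop c l u) x = (if x < l then 1 else if x < u then \<i> else -1)"
| "contour_deriv (Right_Loop c l u) x = (if x < l then -1 else if x < u then \<i> else 1)"

fun contour_corners :: "fox_contour \<Rightarrow> real set" where
  "contour_corners (Line c) = {}"
| "contour_corners (Left_Loop c l u) = {l, u}"
| "contour_corners (Right_Loop c l u) = {l, u}"

fun mb_contour :: "fox_contour \<Rightarrow> bool" where
  "mb_contour (Line c) \<longleftrightarrow> -1 < c \<and> c < 0"
| "mb_contour (Left_Loop c l u) \<longleftrightarrow> -1 < c \<and> c < 0 \<and> l < 0 \<and> 0 < u"
| "mb_contour (Right_Loop c l u) \<longleftrightarrow> -1 < c \<and> c < 0 \<and> l < 0 \<and> 0 < u"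

lemma mb_contour_loop_contour:
  "mb_contour (loop_contour e c l u) \<longleftrightarrow> -1 < c \<and> c < 0 \<and> l < 0 \<and> 0 < u"
  by (simp add: loop_contour_def)

lemma finite_contour_corners: "finite (contour_corners K)"
  by (cases K) auto

lemma norm_contour_deriv: "norm (contour_deriv K x) = 1"
  by (cases K) auto

lemma measurable_contour_deriv [measurable]: "contour_deriv K \<in> borel_measurable borel"
proof (cases K)
  case (Line c)
  have "contour_deriv K = (\<lambda>x. \<i>)" by (auto simp: Line)
  thus ?thesis by simp
next
  case (Left_Loop c l u)
  have "contour_deriv K = (\<lambda>x. if x < l then 1 else if x < u then \<i> else -1)" by (auto simp: Left_Loop)
  thus ?thesis by simp
next
  case (Right_Loop c l u)
  have "contour_deriv K = (\<lambda>x. if x < l then -1 else if x < u then \<i> else 1)" by (auto simp: Right_Loop)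
  thus ?thesis by simp
qed

lemma loop_contour_cases:
  obtains (line) c where "K = Line c"
    | (loop) e c l u where "\<bar>e\<bar> = 1" "K = loop_contour e c l u"
proof (cases K)
  case (Left_Loop c l u)
  thus ?thesis using loop[of "-1" c l u] by (simp add: loop_contour_def)
next
  case (Right_Loop c l u)
  thus ?thesis using loop[of 1 c l u] by (simp add: loop_contour_def)
qed (rule line)

lemma continuous_contour_path: "continuous_on A (contour_path K)"
proof (cases K rule: loop_contour_cases)
  case (line c)
  have "contour_path K = (\<lambda>x. Complex c x)" by (auto simp: line)
  thus ?thesis by (simp only:) (intro continuous_intros)
next
  case (loop e c l u)
  have "contour_path K = (\<lambda>x. Complex (c + e * loop_depth l u x) (max l (min u x)))"
    using loop by (auto simp: contour_path_loop_contour)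
  thus ?thesis unfolding loop_depth_def by (simp only:) (intro continuous_intros)
qed

lemma measurable_contour_path [measurable]: "contour_path K \<in> borel_measurable borel"
  by (intro borel_measurable_continuous_onI continuous_contour_path)

lemma contour_path_in_mb_dom: "mb_contour K \<Longrightarrow> contour_path K x \<in> mb_dom"
  by (cases K) (auto simp: mb_dom_def max_def min_def split: if_splits)

lemma has_vector_derivative_affine_Complex:
  "((\<lambda>x. Complex (a + b * x) (c + d * x)) has_vector_derivative Complex b d) (at x)"
  unfolding Complex_eq by (auto intro!: derivative_eq_intros simp: has_real_derivative_iff_has_vector_derivative[symmetric])

lemma has_vector_derivative_contour_path:
  assumes "mb_contour K" "x \<notin> contour_corners K"
  shows "(contour_path K has_vector_derivative contour_deriv K x) (at x)"
proof -
  have trans: "(contour_path K has_vector_derivative Complex b d) (at x)"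
    if "open S" "x \<in> S" "\<And>y. y \<in> S \<Longrightarrow> contour_path K y = Complex (a + b * y) (c + d * y)" for S a b c d
    by (rule has_vector_derivative_transform_within_open[OF has_vector_derivative_affine_Complex that(1,2)])
      (simp add: that(3))
  show ?thesis
  proof (cases K rule: loop_contour_cases)
    case (line c)
    thus ?thesis using trans[of UNIV c 0 0 1] by (simp add: imaginary_unit.code complex_eq_iff)
  next
    case (loop e c l u)
    note path = contour_path_loop_contour[OF loop(1), of c l u]
    have deriv: "contour_deriv K x = (if x < l then - of_real e else if x < u then \<i> else of_real e)"
      using loop by (auto simp: loop_contour_def abs_if split: if_splits)
    have "x \<noteq> l" "x \<noteq> u" "l < u" using assms by (auto simp: loop(2) loop_contour_def split: if_splits)
    hence "x < l \<and> l < u \<or> l < x \<and> x < u \<or> l < u \<and> u < x" by linarith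
    then consider "x < l" "l < u" | "l < x" "x < u" | "l < u" "u < x" by blast
    thus ?thesis
    proof cases
      case 1
      hence "contour_deriv K x = Complex (- e) 0" by (simp add: deriv complex_eq_iff)
      thus ?thesis using 1 trans[of "{..<l}" "c + e * l" "- e" l 0]
        by (simp add: loop(2) path loop_depth_def algebra_simps)
    next
      case 2
      hence "contour_deriv K x = Complex 0 1" by (simp add: deriv complex_eq_iff)
      thus ?thesis using 2 trans[of "{l<..<u}" c 0 0 1] by (simp add: loop(2) path loop_depth_def)
    next
      case 3
      hence "contour_deriv K x = Complex e 0" by (simp add: deriv complex_eq_iff)
      thus ?thesis using 3 trans[of "{u<..}" "c - e * u" e u 0]
        by (simp add: loop(2) path loop_depth_def algebra_simps)
    qed
  qed
qed

definition mb_integrable :: "fox_contour \<Rightarrow> (complex \<Rightarrow> complex) \<Rightarrow> bool"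
  where "mb_integrable K F \<longleftrightarrow> integrable lborel (\<lambda>x. F (contour_path K x) * contour_deriv K x)"

definition contour_lint :: "fox_contour \<Rightarrow> (complex \<Rightarrow> complex) \<Rightarrow> complex"
  where "contour_lint K F = (LBINT x. F (contour_path K x) * contour_deriv K x)"

lemma
  fixes f :: "complex \<Rightarrow> complex"
  assumes "mb_contour K"
  shows integrable_vector_derivative_contour_path:
      "integrable lborel (\<lambda>x. f (contour_path K x) * vector_derivative (contour_path K) (at x)) \<longleftrightarrow>
       integrable lborel (\<lambda>x. f (contour_path K x) * contour_deriv K x)"
    and integral_vector_derivative_contour_path:
      "(LBINT x. f (contour_path K x) * vector_derivative (contour_path K) (at x)) =
       (LBINT x. f (contour_path K x) * contour_deriv K x)"
proof -
  note * = has_vector_derivative_contour_path[OF assms, THEN vector_derivative_at]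
  have c: "countable (contour_corners K)" by (simp add: finite_contour_corners countable_finite)
  show "integrable lborel (\<lambda>x. f (contour_path K x) * vector_derivative (contour_path K) (at x)) \<longleftrightarrow>
       integrable lborel (\<lambda>x. f (contour_path K x) * contour_deriv K x)"
    by (rule integrable_discrete_difference[OF c]) (auto simp: *)
  show "(LBINT x. f (contour_path K x) * vector_derivative (contour_path K) (at x)) =
       (LBINT x. f (contour_path K x) * contour_deriv K x)"
    by (rule integral_discrete_difference[OF c]) (auto simp: *)
qed

lemma contour_integral_LIMSEQ:
  fixes f G :: "complex \<Rightarrow> complex"
  assumes G: "\<And>t. t \<in> mb_dom \<Longrightarrow> (G has_field_derivative f t) (at t)"
    and K: "mb_contour K"
    and int: "mb_integrable K f"
  shows "((\<lambda>R. G (contour_path K (b + R)) - G (contour_path K (a - R))) \<longlongrightarrow>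
    contour_lint K f) at_top"
proof -
  define h where "h = (\<lambda>x. f (contour_path K x) * contour_deriv K x)"
  have ftc: "(LINT x:{a'..b'}|lborel. h x) = G (contour_path K b') - G (contour_path K a')" if "a' \<le> b'" for a' b'
  proof -
    have "(h has_integral (G \<circ> contour_path K) b' - (G \<circ> contour_path K) a') {a'..b'}"
    proof (rule fundamental_theorem_of_calculus_interior_strong[OF finite_contour_corners[of K] that])
      fix x assume "x \<in> {a'<..<b'} - contour_corners K"
      hence x: "x \<notin> contour_corners K" by simp
      show "((G \<circ> contour_path K) has_vector_derivative h x) (at x)"
        using field_vector_diff_chain_at[OF has_vector_derivative_contour_path[OF K x] G[OF contour_path_in_mb_dom[OF K]]]
        by (simp only: h_def mult.commute)
    next
      have "continuous_on mb_dom G"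
        by (rule DERIV_continuous_on[OF has_field_derivative_at_within[OF G]])
      thus "continuous_on {a'..b'} (G \<circ> contour_path K)"
        unfolding o_def
        by (rule continuous_on_compose2[OF _ continuous_contour_path]) (use contour_path_in_mb_dom[OF K] in auto)
    qed
    moreover have "set_integrable lborel {a'..b'} h"
      using int unfolding set_integrable_def h_def mb_integrable_def by (intro integrable_mult_indicator) auto
    ultimately show ?thesis
      by (simp add: set_borel_integral_eq_integral(2) integral_unique)
  qed
  have "((\<lambda>R. LBINT x. indicator {a - R..b + R} x *\<^sub>R h x) \<longlongrightarrow> (LBINT x. h x)) at_top"
  proof (rule integral_dominated_convergence_at_top)
    show "integrable lborel (\<lambda>x. norm (h x))" using int by (simp add: h_def mb_integrable_def)
    show "h \<in> borel_measurable lborel" using int by (simp add: h_def mb_integrable_def)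
    thus "\<And>t. (\<lambda>x. indicator {a - t..b + t} x *\<^sub>R h x) \<in> borel_measurable lborel" by measurable
    have "((\<lambda>R. indicator {a - R..b + R} x *\<^sub>R h x) \<longlongrightarrow> h x) at_top" for x
    proof (rule tendsto_eventually)
      show "\<forall>\<^sub>F R in at_top. indicator {a - R..b + R} x *\<^sub>R h x = h x"
        using eventually_ge_at_top[of "max (a - x) (x - b)"] by eventually_elim (auto simp: indicator_def)
    qed
    thus "AE x in lborel. ((\<lambda>R. indicator {a - R..b + R} x *\<^sub>R h x) \<longlongrightarrow> h x) at_top" by simp
  qed (auto simp: indicator_def)
  moreover have "\<forall>\<^sub>F R in at_top. (LBINT x. indicator {a - R..b + R} x *\<^sub>R h x) =
      G (contour_path K (b + R)) - G (contour_path K (a - R))"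
    using eventually_ge_at_top[of "(a - b) / 2"]
  proof eventually_elim
    case (elim R)
    thus ?case using ftc[of "a - R" "b + R"] by (simp add: set_lebesgue_integral_def field_simps)
  qed
  ultimately show ?thesis unfolding h_def contour_lint_def by (rule Lim_transform_eventually)
qed

subsection \<open>Deformation of contours\<close>

text \<open>
  A loop that opens to the right (\<open>e = 1\<close>) or to the left (\<open>e = -1\<close>) has rays \<open>Re t = c + e \<rho>\<close>, \<open>\<rho> \<ge> 0\<close>.
\<close>

definition ray_bound :: "real \<Rightarrow> real \<Rightarrow> real \<Rightarrow> (complex \<Rightarrow> complex) \<Rightarrow> (real \<Rightarrow> real) \<Rightarrow> bool"
  where "ray_bound e c k F b \<longleftrightarrow> k > 0 \<and>
    (\<forall>y \<rho>. y \<noteq> 0 \<longrightarrow> \<rho> \<ge> 0 \<longrightarrow> norm (F (Complex (c + e * \<rho>) y)) \<le> b \<bar>y\<bar> * exp (- k * \<rho>)) \<and>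
    (\<forall>y\<^sub>1 y\<^sub>2. 0 < y\<^sub>1 \<longrightarrow> (\<exists>B. \<forall>y. y\<^sub>1 \<le> y \<longrightarrow> y \<le> y\<^sub>2 \<longrightarrow> b y \<le> B))"

lemma ray_boundD:
  assumes "ray_bound e c k F b" "\<bar>e\<bar> = 1" "y \<noteq> 0" "X \<ge> e * c"
  shows "norm (F (Complex (e * X) y)) \<le> b \<bar>y\<bar> * exp (- k * (X - e * c))"
proof -
  have "e * e = 1" using assms(2) by (metis abs_mult_self_eq mult_1)
  hence "c + e * (X - e * c) = e * X" by (simp add: right_diff_distrib mult.assoc[symmetric])
  thus ?thesis using assms unfolding ray_bound_def
    by (metis diff_ge_0_iff_ge)
qed

lemma Complex_in_mb_dom: "y \<noteq> 0 \<Longrightarrow> Complex x y \<in> mb_dom"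
  by (simp add: mb_dom_def)

lemma closed_segment_Complex_vertical:
  "t \<in> closed_segment (Complex x u) (Complex x v) \<Longrightarrow> Re t = x \<and> Im t \<in> closed_segment u v"
  by (simp add: closed_segment_same_Re)

lemma closed_segment_Complex_horizontal:
  "t \<in> closed_segment (Complex u y) (Complex v y) \<Longrightarrow> Im t = y \<and> Re t \<in> closed_segment u v"
  by (simp add: closed_segment_same_Im)

lemma exp_neg_tendsto_0:
  fixes k a :: real
  assumes "k > 0"
  shows "((\<lambda>X. exp (- k * (X - a))) \<longlongrightarrow> 0) at_top"
proof -
  have "filterlim (\<lambda>X. k * (X - a)) at_top at_top"
    using assms by (intro filterlim_tendsto_pos_mult_at_top[OF tendsto_const _]
       filterlim_at_top_mono[OF filterlim_tendsto_add_at_top[OF tendsto_const filterlim_ident, of "- a"]]) auto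
  thus ?thesis
    by (auto intro!: filterlim_compose[OF exp_at_bot] simp: filterlim_uminus_at_bot)
qed

lemma loop_integrable:
  fixes F :: "complex \<Rightarrow> complex"
  assumes F: "continuous_on mb_dom F"
    and rb: "ray_bound e c k F b" and e: "\<bar>e\<bar> = 1"
    and K: "mb_contour (loop_contour e c l u)"
  obtains B where "\<And>x. norm (F (contour_path (loop_contour e c l u) x)) \<le> B * exp (- k * loop_depth l u x)"
    and "mb_integrable (loop_contour e c l u) F"
proof -
  define p where "p = contour_path (loop_contour e c l u)"
  have k: "k > 0" using rb by (simp add: ray_bound_def)
  have lu: "l < 0" "0 < u" using K by (auto simp: mb_contour_loop_contour)
  have cont: "continuous_on UNIV (\<lambda>x. F (p x))"
    unfolding p_def by (rule continuous_on_compose2[OF F continuous_contour_path]) (use contour_path_in_mb_dom[OF K] in auto)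
  have "compact ((\<lambda>x. F (p x)) ` {l..u})"
    using cont by (intro compact_continuous_image) (auto intro: continuous_on_subset)
  then obtain B0 where B0: "\<And>x. x \<in> {l..u} \<Longrightarrow> norm (F (p x)) \<le> B0"
    by (metis compact_imp_bounded bounded_iff imageI)
  define B where "B = max B0 (max (b \<bar>l\<bar>) (b u))"
  have bnd: "norm (F (p x)) \<le> B * exp (- k * loop_depth l u x)" for x
  proof (cases "x \<in> {l..u}")
    case True
    hence "loop_depth l u x = 0" by (auto simp: loop_depth_def)
    thus ?thesis using B0[OF True] by (simp add: B_def)
  next
    case False
    define y where "y = (if x < l then l else u)"
    have px: "p x = Complex (c + e * loop_depth l u x) y"
      using False lu by (auto simp: p_def contour_path_loop_contour[OF e] y_def)
    have "norm (F (p x)) \<le> b \<bar>y\<bar> * exp (- k * loop_depth l u x)"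
      using rb lu loop_depth_nonneg[of l u x] unfolding ray_bound_def px y_def by auto
    also have "\<dots> \<le> B * exp (- k * loop_depth l u x)"
      using lu by (intro mult_right_mono) (auto simp: B_def y_def)
    finally show ?thesis .
  qed
  have "integrable lborel (\<lambda>x. F (p x) * contour_deriv (loop_contour e c l u) x)"
  proof (rule Bochner_Integration.integrable_bound)
    show "integrable lborel (\<lambda>x. B * exp (- k * loop_depth l u x))"
      using lu by (intro integrable_mult_right integrable_exp_loop_depth k) auto
    show "(\<lambda>x. F (p x) * contour_deriv (loop_contour e c l u) x) \<in> borel_measurable lborel"
      using borel_measurable_continuous_onI[OF cont] by measurable
    show "AE x in lborel. norm (F (p x) * contour_deriv (loop_contour e c l u) x) \<le> norm (B * exp (- k * loop_depth l u x))"
      unfolding norm_mult norm_contour_deriv[of "loop_contour e c l u"] mult_1_right real_norm_def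
      by (intro AE_I2) (metis bnd abs_ge_self abs_mult order_trans)
  qed
  thus ?thesis using that bnd unfolding p_def mb_integrable_def by blast
qed

context
  fixes F G :: "complex \<Rightarrow> complex"
  assumes G: "\<And>t. t \<in> mb_dom \<Longrightarrow> (G has_field_derivative F t) (at t)"
begin

lemma primitive_segment_bound:
  assumes "closed_segment p q \<subseteq> mb_dom"
    and "\<And>t. t \<in> closed_segment p q \<Longrightarrow> norm (F t) \<le> B"
  shows "norm (G p - G q) \<le> B * norm (p - q)"
proof (rule field_differentiable_bound[of "closed_segment p q" G F])
  fix t assume "t \<in> closed_segment p q"
  thus "(G has_field_derivative F t) (at t within closed_segment p q)"
    using assms(1) G by (meson has_field_derivative_at_within subsetD)
qed (use assms in auto)

lemma vertical_difference_tendsto_0: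
  assumes rb: "ray_bound e c k F b" and e: "\<bar>e\<bar> = 1" and "u * v > 0"
  shows "((\<lambda>X. G (Complex (e * X) u) - G (Complex (e * X) v)) \<longlongrightarrow> 0) at_top"
proof -
  define y1 y2 where "y1 = min \<bar>u\<bar> \<bar>v\<bar>" and "y2 = max \<bar>u\<bar> \<bar>v\<bar>"
  have uv: "u \<noteq> 0" "v \<noteq> 0" using assms(3) by auto
  hence "y1 > 0" by (auto simp: y1_def)
  then obtain B where B: "\<And>y. y1 \<le> y \<Longrightarrow> y \<le> y2 \<Longrightarrow> b y \<le> B"
    using rb unfolding ray_bound_def by meson
  have k: "k > 0" using rb by (simp add: ray_bound_def)
  have seg: "y \<noteq> 0 \<and> y1 \<le> \<bar>y\<bar> \<and> \<bar>y\<bar> \<le> y2" if "y \<in> closed_segment u v" for y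
    using that assms(3) unfolding closed_segment_eq_real_ivl y1_def y2_def
    by (auto simp: zero_less_mult_iff split: if_splits)
  have bnd: "norm (G (Complex (e * X) u) - G (Complex (e * X) v)) \<le>
      B * exp (- k * (X - e * c)) * norm (Complex (e * X) u - Complex (e * X) v)" if X: "X \<ge> e * c" for X
  proof (rule primitive_segment_bound)
    show "closed_segment (Complex (e * X) u) (Complex (e * X) v) \<subseteq> mb_dom"
    proof
      fix t assume "t \<in> closed_segment (Complex (e * X) u) (Complex (e * X) v)"
      hence "Im t \<noteq> 0" using closed_segment_Complex_vertical seg by blast
      thus "t \<in> mb_dom" by (simp add: mb_dom_def)
    qed
    fix t assume t: "t \<in> closed_segment (Complex (e * X) u) (Complex (e * X) v)"
    have t': "t = Complex (e * X) (Im t)" "Im t \<in> closed_segment u v"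
      using closed_segment_Complex_vertical[OF t] by (auto simp: complex_eq_iff)
    have "norm (F t) \<le> b \<bar>Im t\<bar> * exp (- k * (X - e * c))"
      using ray_boundD[OF rb e _ X] seg[OF t'(2)] t'(1) by metis
    also have "\<dots> \<le> B * exp (- k * (X - e * c))"
      using B seg[OF t'(2)] by (intro mult_right_mono) auto
    finally show "norm (F t) \<le> B * exp (- k * (X - e * c))" .
  qed
  have "((\<lambda>X. B * exp (- k * (X - e * c)) * \<bar>u - v\<bar>) \<longlongrightarrow> B * 0 * \<bar>u - v\<bar>) at_top"
    by (intro tendsto_intros exp_neg_tendsto_0 k)
  hence lim: "((\<lambda>X. B * exp (- k * (X - e * c)) * \<bar>u - v\<bar>) \<longlongrightarrow> 0) at_top" by simp
  have nrm: "norm (Complex a u - Complex a v) = \<bar>u - v\<bar>" for a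
    by (simp add: complex_diff cmod_def)
  show ?thesis
  proof (rule Lim_null_comparison[OF _ lim])
    show "\<forall>\<^sub>F X in at_top. norm (G (Complex (e * X) u) - G (Complex (e * X) v)) \<le>
        B * exp (- k * (X - e * c)) * \<bar>u - v\<bar>"
      using eventually_ge_at_top[of "e * c"] by eventually_elim (use bnd nrm in metis)
  qed
qed

lemma loop_integral_LIMSEQ:
  assumes e: "\<bar>e\<bar> = 1"
    and K: "mb_contour (loop_contour e c l u)"
    and int: "mb_integrable (loop_contour e c l u) F"
  shows "((\<lambda>X. G (Complex (e * X) u) - G (Complex (e * X) l)) \<longlongrightarrow>
    contour_lint (loop_contour e c l u) F) at_top"
proof (rule Lim_transform_eventually[OF contour_integral_LIMSEQ[OF G K int, of "u - e * c" "l + e * c"]])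
  have lu: "l < u" using K by (auto simp: mb_contour_loop_contour)
  have ee: "e * e = 1" using e by (metis abs_mult_self_eq mult_1)
  have *: "c + e * (X - e * c) = e * X" for X by (simp add: right_diff_distrib mult.assoc[symmetric] ee)
  show "\<forall>\<^sub>F X in at_top. G (contour_path (loop_contour e c l u) (u - e * c + X)) -
      G (contour_path (loop_contour e c l u) (l + e * c - X)) = G (Complex (e * X) u) - G (Complex (e * X) l)"
    using eventually_ge_at_top[of "e * c"]
  proof eventually_elim
    case (elim X)
    have "loop_depth l u (u - e * c + X) = X - e * c" "loop_depth l u (l + e * c - X) = X - e * c"
      using elim lu by (auto simp: loop_depth_def)
    moreover have "max l (min u (u - e * c + X)) = u" "max l (min u (l + e * c - X)) = l"
      using elim lu by auto
    ultimately show ?case by (simp add: contour_path_loop_contour[OF e] *)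
  qed
qed (auto)

lemma loop_integral_unique:
  assumes rb: "ray_bound e c\<^sub>0 k F b" and e: "\<bar>e\<bar> = 1"
    and K: "mb_contour (loop_contour e c l u)" "mb_contour (loop_contour e c' l' u')"
    and int: "mb_integrable (loop_contour e c l u) F"
      "mb_integrable (loop_contour e c' l' u') F"
  shows "contour_lint (loop_contour e c l u) F =
    contour_lint (loop_contour e c' l' u') F"
    (is "?I = ?I'")
proof -
  have *: "u * u' > 0" "l * l' > 0" using K by (auto simp: mb_contour_loop_contour mult_neg_neg)
  have "((\<lambda>X. (G (Complex (e * X) u) - G (Complex (e * X) l))
         - ((G (Complex (e * X) u) - G (Complex (e * X) u')) - (G (Complex (e * X) l) - G (Complex (e * X) l'))))
        \<longlongrightarrow> ?I - (0 - 0)) at_top"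
    by (intro tendsto_diff loop_integral_LIMSEQ[OF e K(1) int(1)] vertical_difference_tendsto_0[OF rb e] *)
  hence "((\<lambda>X. G (Complex (e * X) u') - G (Complex (e * X) l')) \<longlongrightarrow> ?I) at_top"
    by simp
  moreover have "((\<lambda>X. G (Complex (e * X) u') - G (Complex (e * X) l')) \<longlongrightarrow> ?I') at_top"
    by (rule loop_integral_LIMSEQ[OF e K(2) int(2)])
  ultimately show ?thesis by (rule tendsto_unique[rotated]) simp
qed

lemma horizontal_ray_difference:
  assumes rb: "ray_bound e c k F b" and e: "\<bar>e\<bar> = 1" and y: "y \<noteq> 0" and "\<rho> \<ge> 0"
  shows "norm (G (Complex (c + e * \<rho>) y) - G (Complex c y)) \<le> b \<bar>y\<bar> / k"
proof -
  have k: "k > 0" using rb by (simp add: ray_bound_def)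
  have bn: "norm (F (Complex (c + e * x) y)) \<le> b \<bar>y\<bar> * exp (- k * x)" if "x \<ge> 0" for x
    using rb that y by (auto simp: ray_bound_def)
  have b0: "b \<bar>y\<bar> \<ge> 0" using order_trans[OF norm_ge_zero bn[of 0]] by simp
  show ?thesis
  proof (cases "\<rho> = 0")
    case True
    thus ?thesis using b0 k by simp
  next
    case False
    hence \<rho>: "0 < \<rho>" using assms by simp
    define \<phi> where "\<phi> = (\<lambda>x. - (b \<bar>y\<bar> / k) * exp (- k * x))"
    have d: "((\<lambda>x. G (Complex (c + e * x) y)) has_vector_derivative (of_real e * F (Complex (c + e * x) y))) (at x)" for x
    proof -
      have "((\<lambda>x. Complex (c + e * x) y) has_vector_derivative of_real e) (at x)"
        using has_vector_derivative_affine_Complex[of c e y 0 x] by (simp add: complex_of_real_def)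
      from field_vector_diff_chain_at[OF this G[OF Complex_in_mb_dom[OF y]]]
      show ?thesis by (simp add: o_def)
    qed
    have d2: "(\<phi> has_vector_derivative b \<bar>y\<bar> * exp (- k * x)) (at x)" for x
      unfolding \<phi>_def has_real_derivative_iff_has_vector_derivative[symmetric]
      using k by (auto intro!: derivative_eq_intros)
    have "norm (G (Complex (c + e * \<rho>) y) - G (Complex (c + e * 0) y)) \<le> \<phi> \<rho> - \<phi> 0"
    proof (rule differentiable_bound_general[OF \<rho>])
      show "continuous_on {0..\<rho>} (\<lambda>x. G (Complex (c + e * x) y))"
        by (intro continuous_at_imp_continuous_on ballI has_vector_derivative_continuous[OF d])
      show "continuous_on {0..\<rho>} \<phi>"
        by (intro continuous_at_imp_continuous_on ballI has_vector_derivative_continuous[OF d2])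
      show "norm (of_real e * F (Complex (c + e * x) y)) \<le> b \<bar>y\<bar> * exp (- k * x)" if "0 < x" for x
        using bn[of x] that e by (simp add: norm_mult)
    qed (rule d d2)+
    also have "\<phi> \<rho> - \<phi> 0 \<le> b \<bar>y\<bar> / k"
      using b0 k by (simp add: \<phi>_def)
    finally show ?thesis by simp
  qed
qed

lemma loop_integral_eq_line_integral:
  assumes rb: "ray_bound e c k F b" and e: "\<bar>e\<bar> = 1" and b: "(b \<longlongrightarrow> 0) at_top"
    and K: "mb_contour (loop_contour e c' l u)" and c: "mb_contour (Line c)"
    and int: "mb_integrable (loop_contour e c' l u) F"
      "mb_integrable (Line c) F"
  shows "contour_lint (loop_contour e c' l u) F =
    contour_lint (Line c) F" (is "?V = ?I")
proof -
  have lu: "l < 0" "0 < u" using K by (auto simp: mb_contour_loop_contour)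
  have k: "k > 0" using rb by (simp add: ray_bound_def)
  have ee: "e * e = 1" using e by (metis abs_mult_self_eq mult_1)
  have *: "c + e * (X - e * c) = e * X" for X by (simp add: right_diff_distrib mult.assoc[symmetric] ee)
  have bound: "norm (?V - (G (Complex c R) - G (Complex c (- R)))) \<le> 2 * b R / k" if R: "R > 0" for R
  proof -
    have "((\<lambda>X. (G (Complex (e * X) u) - G (Complex (e * X) l))
           - ((G (Complex (e * X) u) - G (Complex (e * X) R)) - (G (Complex (e * X) l) - G (Complex (e * X) (- R)))))
          \<longlongrightarrow> ?V - (0 - 0)) at_top"
      by (intro tendsto_diff loop_integral_LIMSEQ[OF e K int(1)] vertical_difference_tendsto_0[OF rb e])
        (use lu R in \<open>auto simp: mult_less_0_iff\<close>)
    hence lim: "((\<lambda>X. (G (Complex (e * X) R) - G (Complex (e * X) (- R))) - (G (Complex c R) - G (Complex c (- R))))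
        \<longlongrightarrow> ?V - (G (Complex c R) - G (Complex c (- R)))) at_top"
      by (intro tendsto_diff tendsto_const) simp
    show ?thesis
    proof (rule tendsto_upperbound[OF tendsto_norm[OF lim]])
      show "\<forall>\<^sub>F X in at_top. norm ((G (Complex (e * X) R) - G (Complex (e * X) (- R))) -
          (G (Complex c R) - G (Complex c (- R)))) \<le> 2 * b R / k"
        using eventually_ge_at_top[of "e * c"]
      proof eventually_elim
        case (elim X)
        have "norm (G (Complex (e * X) R) - G (Complex c R)) \<le> b R / k"
          using horizontal_ray_difference[OF rb e, of R "X - e * c"] elim R unfolding * by simp
        moreover have "norm (G (Complex (e * X) (- R)) - G (Complex c (- R))) \<le> b R / k"
          using horizontal_ray_difference[OF rb e, of "- R" "X - e * c"] elim R unfolding * by simp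
        ultimately have "norm ((G (Complex (e * X) R) - G (Complex c R)) - (G (Complex (e * X) (- R)) - G (Complex c (- R))))
            \<le> b R / k + b R / k" by (blast intro: order_trans[OF norm_triangle_ineq4] add_mono)
        thus ?case by (simp add: algebra_simps)
      qed
    qed simp
  qed
  have "((\<lambda>R. 2 * b R / k) \<longlongrightarrow> 2 * 0 / k) at_top" using k by (intro tendsto_intros b) auto
  hence lim: "((\<lambda>R. 2 * b R / k) \<longlongrightarrow> 0) at_top" by simp
  have "\<forall>\<^sub>F R in at_top. norm (?V - (G (Complex c R) - G (Complex c (- R)))) \<le> 2 * b R / k"
    using eventually_gt_at_top[of 0] by eventually_elim (rule bound)
  hence "((\<lambda>R. ?V - (G (Complex c R) - G (Complex c (- R)))) \<longlongrightarrow> 0) at_top"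
    by (rule Lim_null_comparison[OF _ lim])
  moreover have "((\<lambda>R. ?V - (G (Complex c R) - G (Complex c (- R)))) \<longlongrightarrow> ?V - ?I) at_top"
    using contour_integral_LIMSEQ[OF G c int(2), of 0 0] by (intro tendsto_diff tendsto_const) simp
  ultimately have "0 = ?V - ?I" by (rule tendsto_unique[rotated]) simp
  thus ?thesis by simp
qed

lemma line_integral_unique:
  assumes b: "(b \<longlongrightarrow> 0) at_top"
    and F: "\<And>x y. -1 < x \<Longrightarrow> x < 0 \<Longrightarrow> \<bar>y\<bar> \<ge> 1 \<Longrightarrow> norm (F (Complex x y)) \<le> b \<bar>y\<bar>"
    and c: "mb_contour (Line c)" "mb_contour (Line c')"
    and int: "mb_integrable (Line c) F"
      "mb_integrable (Line c') F"
  shows "contour_lint (Line c) F =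
    contour_lint (Line c') F" (is "?I = ?I'")
proof -
  have diff: "norm (G (Complex c y) - G (Complex c' y)) \<le> b \<bar>y\<bar> * \<bar>c - c'\<bar>" if y: "\<bar>y\<bar> \<ge> 1" for y
  proof -
    have "norm (G (Complex c y) - G (Complex c' y)) \<le> b \<bar>y\<bar> * norm (Complex c y - Complex c' y)"
    proof (rule primitive_segment_bound)
      fix t assume "t \<in> closed_segment (Complex c y) (Complex c' y)"
      from closed_segment_Complex_horizontal[OF this] have t: "t = Complex (Re t) y" "Re t \<in> closed_segment c c'"
        by (auto simp: complex_eq_iff)
      have "-1 < Re t" "Re t < 0"
        using t(2) c by (auto simp: closed_segment_eq_real_ivl split: if_splits)
      thus "norm (F t) \<le> b \<bar>y\<bar>" using F y t(1) by metis
    next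
      show "closed_segment (Complex c y) (Complex c' y) \<subseteq> mb_dom"
        using closed_segment_Complex_horizontal y by (force simp: mb_dom_def)
    qed
    also have "norm (Complex c y - Complex c' y) = \<bar>c - c'\<bar>"
      by (simp add: complex_diff cmod_def)
    finally show ?thesis .
  qed
  have lim: "((\<lambda>R. b R * \<bar>c - c'\<bar>) \<longlongrightarrow> 0) at_top"
    using tendsto_mult_right[OF b, of "\<bar>c - c'\<bar>"] by simp
  have ev: "\<forall>\<^sub>F R in at_top. norm (G (Complex c R) - G (Complex c' R)) \<le> b R * \<bar>c - c'\<bar> \<and>
      norm (G (Complex c (- R)) - G (Complex c' (- R))) \<le> b R * \<bar>c - c'\<bar>"
    using eventually_ge_at_top[of 1]
  proof eventually_elim
    case (elim R)
    thus ?case using diff[of R] diff[of "- R"] by simp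
  qed
  note ev = ev[THEN eventually_conj_iff[THEN iffD1], THEN conjunct1] ev[THEN eventually_conj_iff[THEN iffD1], THEN conjunct2]
  have "((\<lambda>R. (G (Complex c R) - G (Complex c (- R))) - ((G (Complex c R) - G (Complex c' R))
       - (G (Complex c (- R)) - G (Complex c' (- R))))) \<longlongrightarrow> ?I - (0 - 0)) at_top"
    using contour_integral_LIMSEQ[OF G c(1) int(1), of 0 0]
    by (intro tendsto_diff Lim_null_comparison[OF ev(1) lim] Lim_null_comparison[OF ev(2) lim]) simp
  hence "((\<lambda>R. G (Complex c' R) - G (Complex c' (- R))) \<longlongrightarrow> ?I) at_top" by simp
  moreover have "((\<lambda>R. G (Complex c' R) - G (Complex c' (- R))) \<longlongrightarrow> ?I') at_top"
    using contour_integral_LIMSEQ[OF G c(2) int(2), of 0 0] by simp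
  ultimately show ?thesis by (rule tendsto_unique[rotated]) simp
qed

end

abbreviation (input) "fox_as q \<equiv> [(1, 1), (1, 1), (1, (\<bar>q\<bar> + q) / 2)]"
abbreviation (input) "fox_bs q \<equiv> [(1, 1), (0, 1), (0, (\<bar>q\<bar> - q) / 2)]"
abbreviation (input) "cap_contours q z \<equiv> fox_H_contours 1 2 (fox_as q) (fox_bs q) (complex_of_real z)"
abbreviation (input) "cap_H q z \<equiv> fox_H 1 2 (fox_as q) (fox_bs q) (complex_of_real z)"

lemma fox_contours:
  assumes "z > 0"
  shows "cap_contours q z =
    (if \<bar>q\<bar> < 2 then range Line else {loop_contour (sgn q) c l u | c l u. l < u})"
proof -
  have "fox_H_astar 1 2 (fox_as q) (fox_bs q) = 2 - \<bar>q\<bar>"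
    by (simp add: fox_H_astar_def numeral_2_eq_2 field_simps)
  moreover have "fox_H_mu (fox_as q) (fox_bs q) = - q"
    by (simp add: fox_H_mu_def field_simps)
  moreover have "Arg (of_real z) = 0" using assms by (simp add: Arg_of_real)
  ultimately have *: "cap_contours q z =
      (if \<bar>q\<bar> < 2 then {Line c | c. True}
       else if - q > 0 \<or> - q = 0 \<and> norm (of_real z :: complex) \<le> fox_H_beta (fox_as q) (fox_bs q)
       then {Left_Loop c l u | c l u. l < u} else {Right_Loop c l u | c l u. l < u})"
    unfolding fox_H_contours_def by simp
  show ?thesis
  proof (cases "\<bar>q\<bar> < 2")
    case True
    thus ?thesis unfolding * by auto
  next
    case False
    then consider "q > 0" "\<not> \<bar>q\<bar> < 2" | "q < 0" "\<not> \<bar>q\<bar> < 2" by linarith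
    thus ?thesis unfolding * by cases (simp_all add: loop_contour_def)
  qed
qed

lemma separating_iff_mb_contour:
  "fox_H_left_poles 1 (fox_bs q) \<subseteq> left_side K \<and> fox_H_right_poles 2 (fox_as q) \<subseteq> right_side K \<longleftrightarrow> mb_contour K"
proof -
  have L: "fox_H_left_poles 1 (fox_bs q) = {t. 1 + t \<in> \<int>\<^sub>\<le>\<^sub>0}"
    by (simp add: fox_H_left_poles_def)
  have R: "fox_H_right_poles 2 (fox_as q) = {t. - t \<in> \<int>\<^sub>\<le>\<^sub>0}"
    by (simp add: fox_H_right_poles_def numeral_2_eq_2)
  have l: "t \<in> fox_H_left_poles 1 (fox_bs q) \<longleftrightarrow> (\<exists>n. t = - 1 - of_nat n)" for t
  proof -
    have "1 + t = - of_nat n \<longleftrightarrow> t = - 1 - of_nat n" for n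
      unfolding complex_eq_iff by auto
    thus ?thesis unfolding L mem_Collect_eq by (auto elim!: nonpos_Ints_cases')
  qed
  have r: "t \<in> fox_H_right_poles 2 (fox_as q) \<longleftrightarrow> (\<exists>n. t = of_nat n)" for t
    unfolding R mem_Collect_eq by (auto elim!: nonpos_Ints_cases' simp: minus_equation_iff[of t])
  have "-1 \<in> fox_H_left_poles 1 (fox_bs q)" unfolding l by (intro exI[of _ 0]) simp
  moreover have "0 \<in> fox_H_right_poles 2 (fox_as q)" unfolding r by (intro exI[of _ 0]) simp
  ultimately have "mb_contour K" if "fox_H_left_poles 1 (fox_bs q) \<subseteq> left_side K" "fox_H_right_poles 2 (fox_as q) \<subseteq> right_side K"
    using that by (cases K) force+
  moreover have "fox_H_left_poles 1 (fox_bs q) \<subseteq> left_side K" if "mb_contour K"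
    using that by (cases K) (auto simp: subset_iff l simp del: One_nat_def)
  moreover have "fox_H_right_poles 2 (fox_as q) \<subseteq> right_side K" if "mb_contour K"
    using that by (cases K) (auto simp: subset_iff r simp del: One_nat_def)
  ultimately show ?thesis by blast
qed

definition mb_integral :: "fox_contour \<Rightarrow> (complex \<Rightarrow> complex) \<Rightarrow> complex"
  where "mb_integral K F = 1 / (2 * of_real pi * \<i>) * contour_lint K F"

lemma fox_H_eq_mb_integral:
  assumes z: "z > 0" and K: "K \<in> cap_contours q z" "mb_contour K"
    "mb_integrable K (mb_kernel q z)"
    and unique: "\<And>K'. K' \<in> cap_contours q z \<Longrightarrow> mb_contour K' \<Longrightarrow>
      mb_integrable K' (mb_kernel q z) \<Longrightarrow> mb_integral K' (mb_kernel q z) = mb_integral K (mb_kernel q z)"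
  shows "cap_H q z = mb_integral K (mb_kernel q z)"
proof -
  let ?F = "fox_H_integrand 1 2 (fox_as q) (fox_bs q) (of_real z)"
  have eq: "?F (contour_path K' x) = mb_kernel q z (contour_path K' x)" if "mb_contour K'" for K' x
    by (rule fox_H_integrand_eq_mb_kernel[OF contour_path_in_mb_dom[OF that]])
  define P where "P K' \<longleftrightarrow> fox_H_left_poles 1 (fox_bs q) \<subseteq> left_side K' \<and> fox_H_right_poles 2 (fox_as q) \<subseteq> right_side K' \<and>
       integrable lborel (\<lambda>x. ?F (contour_path K' x) * vector_derivative (contour_path K') (at x))" for K'
  define I where "I K' = 1 / (2 * of_real pi * \<i>) *
           (LBINT x. ?F (contour_path K' x) * vector_derivative (contour_path K') (at x))" for K'
  have P: "P K' \<longleftrightarrow> mb_contour K' \<and> mb_integrable K' (mb_kernel q z)" for K'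
    unfolding P_def conj_assoc[symmetric] separating_iff_mb_contour mb_integrable_def
    by (auto simp: eq integrable_vector_derivative_contour_path simp del: One_nat_def)
  have I: "I K' = mb_integral K' (mb_kernel q z)" if "mb_contour K'" for K'
    unfolding I_def mb_integral_def contour_lint_def using that
    by (simp add: eq integral_vector_derivative_contour_path del: One_nat_def)
  have "cap_H q z =
      (THE v. \<exists>K'\<in>cap_contours q z. P K' \<and> v = I K')"
    unfolding fox_H_def P_def I_def conj_assoc ..
  also have "\<dots> = mb_integral K (mb_kernel q z)"
  proof (rule the_equality)
    have "P K \<and> mb_integral K (mb_kernel q z) = I K" unfolding P using K I by metis
    thus "\<exists>K'\<in>cap_contours q z. P K' \<and> mb_integral K (mb_kernel q z) = I K'"
      using K(1) by (rule bexI)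
  next
    fix v assume "\<exists>K'\<in>cap_contours q z. P K' \<and> v = I K'"
    then obtain K' where K': "K' \<in> cap_contours q z" "P K'" "v = I K'"
      by (rule bexE) blast
    show "v = mb_integral K (mb_kernel q z)"
      using K' unique[OF K'(1)] I unfolding P by metis
  qed
  finally show ?thesis .
qed

subsection \<open>Convergence of the contour integrals\<close>

lemma sinh_real_ge_self: "x \<ge> 0 \<Longrightarrow> x \<le> sinh x" for x :: real
  using real_le_x_sinh[of x] by (simp add: sinh_field_def exp_minus)

lemma sin_ge_half_self:
  fixes x :: real
  assumes "0 \<le> x" "x \<le> pi / 3"
  shows "x / 2 \<le> sin x"
proof -
  have "sin 0 - 0 / 2 \<le> sin x - x / 2"
  proof (rule DERIV_nonneg_imp_nondecreasing[OF assms(1)])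
    fix y :: real assume y: "0 \<le> y" "y \<le> x"
    have "cos (pi / 3) \<le> cos y" using y assms by (intro cos_monotone_0_pi_le) auto
    thus "\<exists>d. ((\<lambda>x. sin x - x / 2) has_real_derivative d) (at y) \<and> d \<ge> 0"
      by (intro exI[of _ "cos y - 1 / 2"]) (auto intro!: derivative_eq_intros simp: cos_60)
  qed
  thus ?thesis by simp
qed

lemma sinh_pi_ge:
  fixes y :: real
  assumes "y \<ge> 1"
  shows "sinh (pi * y) \<ge> exp (pi * y) / 4"
proof -
  have "pi * 1 \<le> pi * y" using assms by (intro mult_left_mono) auto
  hence "1 \<le> pi * y" using pi_ge_two by linarith
  hence "exp (- (pi * y)) \<le> exp (-1)" by simp
  also have "\<dots> \<le> (1/2 :: real)" using exp_ge_add_one_self[of "1::real"] by (simp add: exp_minus field_simps)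
  finally have "exp (- (pi * y)) \<le> 1/2" .
  moreover have "exp (pi * y) \<ge> 1" using assms by simp
  ultimately have "exp (- (pi * y)) * 2 \<le> exp (pi * y)" by linarith
  thus ?thesis by (simp add: sinh_def)
qed

lemma inverse_Gamma_le:
  fixes x :: real
  assumes "x > 0"
  shows "inverse (Gamma x) \<le> 2 * exp 2"
proof -
  have "Gamma x \<ge> exp (-2) / 2" using Gamma_ge_power[OF assms, of 1] by simp
  hence "inverse (Gamma x) \<le> inverse (exp (-2) / 2)" by (intro le_imp_inverse_le) auto
  also have "inverse (exp (-2) / 2) = 2 * exp (2 :: real)"
    by (rule inverse_unique) (simp flip: exp_add)
  finally show ?thesis .
qed

lemma gamma_ratio_three_quarters_le_exp:
  assumes "y \<ge> 0"
  shows "gamma_ratio (3/4) y \<le> max 1 (gamma_ratio (3/4) 1) * exp (pi * y / 2)"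
proof (cases "y \<ge> 1")
  case True
  have "gamma_ratio (3/4) y \<le> exp (pi * y / 2) * y powr (-1/4)"
    by (rule gamma_ratio_three_quarters_le[OF True])
  also have "\<dots> \<le> exp (pi * y / 2) * 1"
    using True powr_mono[of "-1/4" 0 y] by (intro mult_left_mono) auto
  also have "\<dots> \<le> max 1 (gamma_ratio (3/4) 1) * exp (pi * y / 2)"
    by (simp add: mult_left_mono)
  finally show ?thesis .
next
  case False
  have "gamma_ratio (3/4) y \<le> gamma_ratio (3/4) 1" using False assms by (intro gamma_ratio_mono) auto
  also have "\<dots> \<le> max 1 (gamma_ratio (3/4) 1) * 1" by simp
  also have "\<dots> \<le> max 1 (gamma_ratio (3/4) 1) * exp (pi * y / 2)"
    using assms by (intro mult_left_mono) auto
  finally show ?thesis .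
qed

definition ray_decay :: "real \<Rightarrow> real \<Rightarrow> real \<Rightarrow> real \<Rightarrow> real \<Rightarrow> real \<Rightarrow> bool"
  where "ray_decay q z e c k K \<longleftrightarrow> k > 0 \<and> K \<ge> 0 \<and>
    (\<forall>\<rho>\<ge>0. z powr (- (c + e * \<rho>)) / Gamma (1 + q * (c + e * \<rho>)) \<le> K * exp (- k * \<rho>))"

definition ray_majorant :: "real \<Rightarrow> real \<Rightarrow> real \<Rightarrow> real \<Rightarrow> real"
  where "ray_majorant q c K y = pi / (y * sinh (pi * y)) * gamma_ratio (1 + q * c) (q * y) * K"

lemma ray_decay_Gamma:
  assumes "z > 0" "q \<noteq> 0" "0 < 1 + q * c"
  obtains K where "ray_decay q z (sgn q) c 1 K"
proof -
  define e where "e = sgn q"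
  have qe: "q * e = \<bar>q\<bar>" "\<bar>e\<bar> = 1" using assms(2) by (auto simp: e_def sgn_if)
  define \<sigma> where "\<sigma> = 1 + q * c"
  define B where "B = exp ((1 - e * ln z) / \<bar>q\<bar>)"
  define C where "C = exp (- B - 1) / (B + 1)"
  have B: "B > 0" by (simp add: B_def)
  have C: "C > 0" using B by (simp add: C_def)
  define K where "K = z powr (- c) * B powr (- \<sigma>) / C"
  have "z powr (- (c + e * \<rho>)) / Gamma (1 + q * (c + e * \<rho>)) \<le> K * exp (- 1 * \<rho>)" if "\<rho> \<ge> 0" for \<rho>
  proof -
    have x: "1 + q * (c + e * \<rho>) = \<sigma> + \<bar>q\<bar> * \<rho>"
      by (simp add: \<sigma>_def algebra_simps flip: qe(1))
    have pos: "\<sigma> + \<bar>q\<bar> * \<rho> > 0" using assms that by (simp add: \<sigma>_def add_pos_nonneg)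
    have G: "Gamma (\<sigma> + \<bar>q\<bar> * \<rho>) \<ge> B powr (\<sigma> + \<bar>q\<bar> * \<rho>) * C"
      using Gamma_ge_power[OF pos B] by (simp add: C_def)
    have "z powr (- (c + e * \<rho>)) / Gamma (\<sigma> + \<bar>q\<bar> * \<rho>) \<le> z powr (- (c + e * \<rho>)) / (B powr (\<sigma> + \<bar>q\<bar> * \<rho>) * C)"
      using G B C by (intro divide_left_mono) (auto intro!: mult_pos_pos less_le_trans[OF _ G])
    also have "\<dots> = z powr (- c) * exp (- (e * \<rho> * ln z)) / (B powr \<sigma> * exp ((1 - e * ln z) * \<rho>) * C)"
    proof -
      have "z powr (- (c + e * \<rho>)) = z powr (- c) * exp (- (e * \<rho> * ln z))"
        using assms(1) by (simp add: powr_def algebra_simps flip: exp_add)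
      moreover have "B powr (\<bar>q\<bar> * \<rho>) = exp ((1 - e * ln z) * \<rho>)"
        using assms(2) by (simp add: B_def powr_def field_simps)
      ultimately show ?thesis by (simp add: powr_add)
    qed
    also have "\<dots> = K * (exp (- (e * \<rho> * ln z)) / exp ((1 - e * ln z) * \<rho>))"
      using B by (simp add: K_def powr_minus field_simps)
    also have "exp (- (e * \<rho> * ln z)) / exp ((1 - e * ln z) * \<rho>) = exp (- 1 * \<rho>)"
      unfolding exp_diff[symmetric] by (simp add: algebra_simps)
    finally show ?thesis unfolding x .
  qed
  moreover have "K \<ge> 0" using C by (simp add: K_def)
  ultimately have "ray_decay q z e c 1 K" by (simp add: ray_decay_def)
  thus ?thesis using that by (simp add: e_def)
qed

lemma ray_decay_0:
  assumes "z > 0" "e * ln z > 0"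
  shows "ray_decay 0 z e c (e * ln z) (z powr (- c))"
  using assms by (auto simp: ray_decay_def powr_def algebra_simps simp flip: exp_add)

lemma ray_bound_mb_kernel:
  assumes "z > 0" "\<bar>e\<bar> = 1" "q * e = \<bar>q\<bar>" "0 < 1 + q * c" "ray_decay q z e c k K"
  shows "ray_bound e c k (mb_kernel q z) (ray_majorant q c K)"
  unfolding ray_bound_def
proof (intro conjI allI impI)
  show "k > 0" using assms by (simp add: ray_decay_def)
next
  fix y \<rho> :: real assume y: "y \<noteq> 0" and \<rho>: "\<rho> \<ge> 0"
  have "q * c \<le> q * c + q * e * \<rho>" using assms(3) \<rho> by simp
  hence *: "q * c \<le> q * (c + e * \<rho>)" by (simp add: algebra_simps)
  hence pos: "0 < 1 + q * (c + e * \<rho>)" using assms(4) by linarith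
  from * have "norm (mb_kernel q z (Complex (c + e * \<rho>) y)) \<le>
     pi / (\<bar>y\<bar> * sinh (pi * \<bar>y\<bar>)) * gamma_ratio (1 + q * c) (q * y) * (z powr (- (c + e * \<rho>)) / Gamma (1 + q * (c + e * \<rho>)))"
    by (rule norm_mb_kernel_le_gamma_ratio[OF assms(1) y assms(4)])
  also have "\<dots> \<le> pi / (\<bar>y\<bar> * sinh (pi * \<bar>y\<bar>)) * gamma_ratio (1 + q * c) (q * \<bar>y\<bar>) * (K * exp (- k * \<rho>))"
    using assms(4,5) \<rho> by (intro mult_mono gamma_ratio_mono mult_nonneg_nonneg gamma_ratio_nonneg)
      (auto simp: ray_decay_def abs_mult intro!: divide_nonneg_nonneg less_imp_le[OF Gamma_real_pos] pos)
  finally show "norm (mb_kernel q z (Complex (c + e * \<rho>) y)) \<le> ray_majorant q c K \<bar>y\<bar> * exp (- k * \<rho>)"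
    by (simp add: ray_majorant_def mult_ac)
next
  fix y1 y2 :: real assume y1: "0 < y1"
  have "ray_majorant q c K y \<le> pi / (y1 * sinh (pi * y1)) * gamma_ratio (1 + q * c) (q * y2) * K"
    if "y1 \<le> y" "y \<le> y2" for y
  proof -
    have "sinh (pi * y1) \<le> sinh (pi * y)" using that by simp
    hence "y1 * sinh (pi * y1) \<le> y * sinh (pi * y)" using y1 that by (intro mult_mono) auto
    moreover have "0 < y1 * sinh (pi * y1)" using y1 by simp
    ultimately have "pi / (y * sinh (pi * y)) \<le> pi / (y1 * sinh (pi * y1))"
      by (intro divide_left_mono mult_pos_pos[of "y * _"]) auto
    thus ?thesis unfolding ray_majorant_def
      using assms(4,5) that y1
      by (intro mult_mono gamma_ratio_mono mult_nonneg_nonneg gamma_ratio_nonneg)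
         (auto simp: ray_decay_def abs_mult intro!: mult_left_mono)
  qed
  thus "\<exists>B. \<forall>y\<ge>y1. y \<le> y2 \<longrightarrow> ray_majorant q c K y \<le> B" by blast
qed

lemma ray_majorant_tendsto_0:
  assumes "\<bar>q\<bar> \<le> 2" "1 + q * c \<ge> 3/4" "K \<ge> 0"
  shows "(ray_majorant q c K \<longlongrightarrow> 0) at_top"
proof -
  define D where "D = max 1 (gamma_ratio (3/4) 1)"
  have D: "D \<ge> 1" by (simp add: D_def)
  have lim: "((\<lambda>y. 4 * pi * D * K * inverse y) \<longlongrightarrow> 0) at_top"
    using tendsto_mult_right_zero[OF tendsto_inverse_0_at_top[OF filterlim_ident], of "4 * pi * D * K"] by simp
  show ?thesis
  proof (rule Lim_null_comparison[OF _ lim])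
    show "\<forall>\<^sub>F y in at_top. norm (ray_majorant q c K y) \<le> 4 * pi * D * K * inverse y"
      using eventually_ge_at_top[of 1]
    proof eventually_elim
      case (elim y)
      have "gamma_ratio (1 + q * c) (q * y) \<le> gamma_ratio (3/4) (2 * y)"
        using assms elim by (intro gamma_ratio_mono) (auto simp: abs_mult intro!: mult_mono)
      also have "\<dots> \<le> D * exp (pi * y)"
        using gamma_ratio_three_quarters_le_exp[of "2 * y"] elim by (simp add: D_def)
      finally have g: "gamma_ratio (1 + q * c) (q * y) \<le> D * exp (pi * y)" .
      have s: "0 < y * (exp (pi * y) / 4)" "y * (exp (pi * y) / 4) \<le> y * sinh (pi * y)"
        using sinh_pi_ge[OF elim] elim by auto
      hence "pi / (y * sinh (pi * y)) \<le> pi / (y * (exp (pi * y) / 4))"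
        by (intro divide_left_mono mult_pos_pos[of "y * _"]) auto
      hence "ray_majorant q c K y \<le> pi / (y * (exp (pi * y) / 4)) * (D * exp (pi * y)) * K"
        unfolding ray_majorant_def using g assms elim s D
        by (intro mult_mono mult_nonneg_nonneg gamma_ratio_nonneg) auto
      also have "\<dots> = 4 * pi * D * K * inverse y" using elim by (simp add: field_simps)
      finally have "ray_majorant q c K y \<le> 4 * pi * D * K * inverse y" .
      moreover have "ray_majorant q c K y \<ge> 0"
        unfolding ray_majorant_def using assms elim by (intro mult_nonneg_nonneg gamma_ratio_nonneg divide_nonneg_nonneg) auto
      ultimately show ?case by simp
    qed
  qed
qed

definition line_majorant :: "real \<Rightarrow> real \<Rightarrow> real"
  where "line_majorant c y = inverse (c^2 + y^2) + (if \<bar>y\<bar> \<ge> 1 then \<bar>y\<bar> powr (-5/4) else 0)"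

lemma integrable_line_majorant:
  obtains A where "\<And>c. c \<noteq> 0 \<Longrightarrow> integrable lborel (line_majorant c)"
    and "\<And>c. c \<noteq> 0 \<Longrightarrow> (LBINT y. line_majorant c y) = pi / \<bar>c\<bar> + A"
proof -
  have base: "integrable lborel (\<lambda>x::real. inverse (1 + x^2))" "(LBINT x. inverse (1 + (x::real)^2)) = pi"
    using integrable_inverse_1_plus_square LBINT_inverse_1_plus_square
    by (simp_all add: set_integrable_def interval_lebesgue_integral_def set_lebesgue_integral_def einterval_def
       zero_ereal_def)
  have c1: "integrable lborel (\<lambda>y. inverse (c^2 + y^2))" "(LBINT y. inverse (c^2 + y^2)) = pi / \<bar>c\<bar>"
    if c: "c \<noteq> 0" for c :: real
  proof -
    have eq: "inverse (c^2 + y^2) = inverse (c^2) * inverse (1 + (0 + (1 / c) * y)^2)" for y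
      using c by (simp add: field_simps power2_eq_square)
    show "integrable lborel (\<lambda>y. inverse (c^2 + y^2))"
      unfolding eq using c by (intro integrable_mult_right lborel_integrable_real_affine[OF base(1)]) auto
    define I where "I = (LBINT y. inverse (1 + (0 + (1 / c) * y)^2))"
    have "pi = \<bar>1 / c\<bar> * I"
      using lborel_integral_real_affine[of "1 / c" "\<lambda>x. inverse (1 + x^2)" 0] base(2) c by (simp add: I_def)
    hence "I = \<bar>c\<bar> * pi" using c by (simp add: field_simps)
    moreover have "(LBINT y. inverse (c^2 + y^2)) = inverse (c^2) * I"
      unfolding eq I_def by (rule integral_mult_right_zero)
    moreover have "inverse (c^2) * (\<bar>c\<bar> * pi) = pi / \<bar>c\<bar>"
      using c by (cases "c > 0") (auto simp: power2_eq_square field_simps)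
    ultimately show "(LBINT y. inverse (c^2 + y^2)) = pi / \<bar>c\<bar>"
      by (simp only:)
  qed
  define m where "m = (\<lambda>y::real. if \<bar>y\<bar> \<ge> 1 then \<bar>y\<bar> powr (-5/4) else 0)"
  have "set_integrable lborel {1..} (\<lambda>y::real. y powr (-5/4))"
    by (rule has_integral_nonneg_imp_set_integrable[OF _ _ _ has_integral_powr_to_inf]) auto
  hence i1: "integrable lborel (\<lambda>y::real. indicator {1..} y * y powr (-5/4))"
    by (simp add: set_integrable_def)
  hence i2: "integrable lborel (\<lambda>y::real. indicator {1..} (0 + (-1) * y) * (0 + (-1) * y) powr (-5/4))"
    by (rule lborel_integrable_real_affine) simp
  have "m = (\<lambda>y. indicator {1..} y * y powr (-5/4) + indicator {1..} (0 + (-1) * y) * (0 + (-1) * y) powr (-5/4))"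
    by (auto simp: m_def fun_eq_iff indicator_def)
  hence m: "integrable lborel m" using Bochner_Integration.integrable_add[OF i1 i2] by simp
  have lm: "line_majorant c = (\<lambda>y. inverse (c^2 + y^2) + m y)" for c
    by (simp add: line_majorant_def m_def fun_eq_iff)
  show ?thesis
    by (rule that[of "\<integral>y. m y \<partial>lborel"])
      (simp_all add: lm c1 m Bochner_Integration.integrable_add Bochner_Integration.integral_add)
qed

lemma norm_mb_kernel_line_le:
  obtains K where "K > 0"
    and "\<And>q z c y. \<bar>q\<bar> \<le> 2 \<Longrightarrow> z > 0 \<Longrightarrow> -1/8 \<le> c \<Longrightarrow> c < 0 \<Longrightarrow>
      norm (mb_kernel q z (Complex c y)) \<le> K * z powr (- c) * line_majorant c y"
proof -
  define D where "D = max 1 (gamma_ratio (3/4) 2)"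
  have D: "D \<ge> 1" by (simp add: D_def)
  define K where "K = pi * (4 * D) * (2 * exp 2)"
  have K: "K > 0" using D by (simp add: K_def)
  have "norm (mb_kernel q z (Complex c y)) \<le> K * z powr (- c) * line_majorant c y"
    if q: "\<bar>q\<bar> \<le> 2" and z: "z > 0" and c: "-1/8 \<le> c" "c < 0" for q z c y
  proof -
    define t where "t = Complex c y"
    let ?S = "norm (sin (of_real pi * t))"
    let ?Q = "pi / (norm t * ?S)"
    define \<sigma> where "\<sigma> = 1 + q * c"
    have "\<bar>q * c\<bar> \<le> 2 * (1/8)" unfolding abs_mult using q c by (intro mult_mono) auto
    hence \<sigma>: "\<sigma> \<ge> 3/4" by (simp add: \<sigma>_def abs_le_iff)
    have "1 + of_real q * t = Complex \<sigma> (q * y)" by (simp add: t_def \<sigma>_def complex_eq_iff)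
    hence "norm (rGamma (1 + of_real q * t)) = gamma_ratio \<sigma> (q * y) * inverse (Gamma \<sigma>)"
      using \<sigma> norm_rGamma_eq_gamma_ratio[of \<sigma> "q * y"] by (simp add: field_simps)
    also have "\<dots> \<le> gamma_ratio (3/4) (2 * y) * (2 * exp 2)"
      using \<sigma> q by (intro mult_mono inverse_Gamma_le gamma_ratio_mono gamma_ratio_nonneg)
        (auto simp: abs_mult intro!: mult_mono less_imp_le[OF Gamma_real_pos])
    finally have rG: "norm (rGamma (1 + of_real q * t)) \<le> gamma_ratio (3/4) (2 * y) * (2 * exp 2)" .
    have *: "?Q * gamma_ratio (3/4) (2 * y) \<le> pi * (4 * D) * line_majorant c y"
    proof (cases "\<bar>y\<bar> \<ge> 1")
      case False
      have "gamma_ratio (3/4) (2 * y) \<le> gamma_ratio (3/4) 2" using False by (intro gamma_ratio_mono) auto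
      hence g: "gamma_ratio (3/4) (2 * y) \<le> 4 * D" using D by (simp add: D_def)
      have tn: "(norm t)^2 = c^2 + y^2" by (simp add: t_def cmod_power2)
      have "(norm t)^2 \<le> (?S)^2"
      proof -
        have "\<bar>y\<bar> \<le> pi * \<bar>y\<bar>" using pi_ge_two by (intro mult_le_cancel_right1[THEN iffD2]) auto
        also have "\<dots> \<le> sinh (pi * \<bar>y\<bar>)" by (intro sinh_real_ge_self) auto
        also have "\<dots> = \<bar>sinh (pi * y)\<bar>" using sinh_real_abs[of "pi * y"] by (simp add: abs_mult)
        finally have 1: "y^2 \<le> (sinh (pi * y))^2" by (simp only: abs_le_square_iff)
        have "\<bar>c\<bar> \<le> (pi / 2) * \<bar>c\<bar>" using pi_ge_two by (intro mult_le_cancel_right1[THEN iffD2]) auto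
        also have "\<dots> = (pi * \<bar>c\<bar>) / 2" by simp
        also have "\<dots> \<le> sin (pi * \<bar>c\<bar>)"
        proof (rule sin_ge_half_self)
          have "pi * \<bar>c\<bar> \<le> pi * (1/3)" using c by (intro mult_left_mono) auto
          thus "pi * \<bar>c\<bar> \<le> pi / 3" by simp
        qed auto
        also have "\<dots> \<le> \<bar>sin (pi * c)\<bar>" using c by simp
        finally have 2: "c^2 \<le> (sin (pi * c))^2" by (simp only: abs_le_square_iff)
        show ?thesis using 1 2 unfolding norm_sin_pi_sq tn by (simp add: t_def)
      qed
      hence "norm t \<le> ?S" by (rule power2_le_imp_le) simp
      hence "norm t * norm t \<le> norm t * ?S" by (intro mult_left_mono) auto
      hence "c^2 + y^2 \<le> norm t * ?S" unfolding tn[symmetric] power2_eq_square[of "norm t"] .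
      moreover have "c^2 + y^2 > 0" using c by (simp add: add_pos_nonneg)
      ultimately have "?Q \<le> pi / (c^2 + y^2)"
        by (intro divide_left_mono mult_pos_pos[of "_ * _"]) auto
      hence "?Q * gamma_ratio (3/4) (2 * y) \<le> pi / (c^2 + y^2) * (4 * D)"
        using g by (intro mult_mono gamma_ratio_nonneg) auto
      thus ?thesis using False by (simp add: line_majorant_def field_simps)
    next
      case True
      have "gamma_ratio (3/4) (2 * y) \<le> gamma_ratio (3/4) (2 * \<bar>y\<bar>)" by (intro gamma_ratio_mono) auto
      also have "\<dots> \<le> exp (pi * (2 * \<bar>y\<bar>) / 2) * (2 * \<bar>y\<bar>) powr (-1/4)"
        using True by (intro gamma_ratio_three_quarters_le) auto
      also have "\<dots> \<le> exp (pi * \<bar>y\<bar>) * \<bar>y\<bar> powr (-1/4)"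
        using True by (intro mult_mono powr_mono2') auto
      finally have g: "gamma_ratio (3/4) (2 * y) \<le> exp (pi * \<bar>y\<bar>) * \<bar>y\<bar> powr (-1/4)" .
      have s: "\<bar>y\<bar> * (exp (pi * \<bar>y\<bar>) / 4) \<le> norm t * ?S"
        using order_trans[OF sinh_pi_ge[OF True] norm_sin_pi_ge[of t, simplified t_def complex.sel]] abs_Im_le_cmod[of t]
        by (intro mult_mono) (auto simp: t_def)
      moreover have "0 < \<bar>y\<bar> * (exp (pi * \<bar>y\<bar>) / 4)" using True by auto
      ultimately have "?Q \<le> pi / (\<bar>y\<bar> * (exp (pi * \<bar>y\<bar>) / 4))"
        by (intro divide_left_mono mult_pos_pos[of "_ * _"]) auto
      hence "?Q * gamma_ratio (3/4) (2 * y) \<le>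
          pi / (\<bar>y\<bar> * (exp (pi * \<bar>y\<bar>) / 4)) * (exp (pi * \<bar>y\<bar>) * \<bar>y\<bar> powr (-1/4))"
        using g by (intro mult_mono gamma_ratio_nonneg) auto
      also have "\<dots> = pi * 4 * (\<bar>y\<bar> powr (-1/4) / \<bar>y\<bar> powr 1)"
        using True by (simp add: field_simps)
      also have "\<bar>y\<bar> powr (-1/4) / \<bar>y\<bar> powr 1 = \<bar>y\<bar> powr (-5/4)"
        unfolding powr_diff[symmetric] by simp
      also have "pi * 4 * \<bar>y\<bar> powr (-5/4) \<le> pi * (4 * D) * line_majorant c y"
        using True D by (intro mult_mono) (auto simp: line_majorant_def)
      finally show ?thesis .
    qed
    have "norm (mb_kernel q z t) = ?Q * norm (rGamma (1 + of_real q * t)) * z powr (- c)"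
      by (simp add: norm_mb_kernel[OF z] t_def)
    also have "\<dots> \<le> ?Q * (gamma_ratio (3/4) (2 * y) * (2 * exp 2)) * z powr (- c)"
      by (intro mult_right_mono mult_left_mono rG) auto
    also have "\<dots> = (?Q * gamma_ratio (3/4) (2 * y)) * ((2 * exp 2) * z powr (- c))"
      by (simp only: mult_ac)
    also have "\<dots> \<le> (pi * (4 * D) * line_majorant c y) * ((2 * exp 2) * z powr (- c))"
      by (intro mult_right_mono *) auto
    also have "\<dots> = K * z powr (- c) * line_majorant c y" by (simp add: K_def mult_ac)
    finally show ?thesis by (simp add: t_def)
  qed
  thus ?thesis using that K by blast
qed

lemma mb_kernel_strip_bound:
  assumes "\<bar>q\<bar> < 2" "z > 0"
  obtains b where "(b \<longlongrightarrow> 0) at_top"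
    and "\<And>x y. -1 < x \<Longrightarrow> x < 0 \<Longrightarrow> \<bar>y\<bar> \<ge> 1 \<Longrightarrow> norm (mb_kernel q z (Complex x y)) \<le> b \<bar>y\<bar>"
proof -
  define D where "D = max 1 (gamma_ratio (3/4) 1)"
  define \<delta> where "\<delta> = pi * (1 - \<bar>q\<bar> / 2)"
  define A where "A = pi * 4 * (30 * D * (2 * exp 2)) * max 1 z"
  define b where "b = (\<lambda>y. A * (2 / \<delta>) * exp (- (\<delta> / 2) * (y - 0)))"
  have D: "D \<ge> 1" by (simp add: D_def)
  have \<delta>: "\<delta> > 0" using assms by (simp add: \<delta>_def)
  have A: "A \<ge> 0" using D by (simp add: A_def)
  have lim: "(b \<longlongrightarrow> 0) at_top"
    unfolding b_def using \<delta> by (intro tendsto_mult_right_zero exp_neg_tendsto_0) auto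
  have "norm (mb_kernel q z (Complex x y)) \<le> b \<bar>y\<bar>" if x: "-1 < x" "x < 0" and y: "\<bar>y\<bar> \<ge> 1" for x y
  proof -
    define t s where "t = Complex x y" and "s = 1 + of_real q * t"
    have "norm t \<le> \<bar>x\<bar> + \<bar>y\<bar>" using cmod_le[of t] by (simp add: t_def)
    hence "norm t \<le> 2 * \<bar>y\<bar>" using x y by linarith
    hence "\<bar>q\<bar> * norm t \<le> 2 * (2 * \<bar>y\<bar>)" using assms by (intro mult_mono) auto
    hence ns: "norm s \<le> 5 * \<bar>y\<bar>" "norm (s + 1) \<le> 6 * \<bar>y\<bar>"
      using norm_triangle_ineq[of 1 "of_real q * t"] norm_triangle_ineq[of s 1] y
      by (auto simp: s_def norm_mult)
    have "\<bar>q * x\<bar> < 2 * 1" unfolding abs_mult using assms x by (intro mult_strict_mono) auto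
    hence \<sigma>: "3 + q * x > 1" by (simp add: abs_less_iff)
    have s2: "s + 1 + 1 = Complex (3 + q * x) (q * y)" by (simp add: s_def t_def complex_eq_iff)
    have "norm (rGamma (s + 1 + 1)) = gamma_ratio (3 + q * x) (q * y) * inverse (Gamma (3 + q * x))"
      unfolding s2 using \<sigma> by (subst norm_rGamma_eq_gamma_ratio) (auto simp: field_simps)
    also have "\<dots> \<le> gamma_ratio (3/4) (\<bar>q\<bar> * \<bar>y\<bar>) * (2 * exp 2)"
      using \<sigma> by (intro mult_mono inverse_Gamma_le gamma_ratio_mono gamma_ratio_nonneg)
        (auto simp: abs_mult intro!: less_imp_le[OF Gamma_real_pos])
    also have "\<dots> \<le> (D * exp (pi * (\<bar>q\<bar> * \<bar>y\<bar>) / 2)) * (2 * exp 2)"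
      unfolding D_def by (intro mult_right_mono gamma_ratio_three_quarters_le_exp) auto
    finally have rG2: "norm (rGamma (s + 1 + 1)) \<le> D * exp (pi * (\<bar>q\<bar> * \<bar>y\<bar>) / 2) * (2 * exp 2)" .
    have "norm (rGamma s) = norm s * norm (s + 1) * norm (rGamma (s + 1 + 1))"
      by (metis rGamma_plus1 norm_mult mult.assoc)
    also have "\<dots> \<le> (5 * \<bar>y\<bar>) * (6 * \<bar>y\<bar>) * (D * exp (pi * (\<bar>q\<bar> * \<bar>y\<bar>) / 2) * (2 * exp 2))"
      by (intro mult_mono ns rG2) auto
    finally have rG: "norm (rGamma s) \<le> (5 * \<bar>y\<bar>) * (6 * \<bar>y\<bar>) * (D * exp (pi * (\<bar>q\<bar> * \<bar>y\<bar>) / 2) * (2 * exp 2))" .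
    have zx: "z powr (- x) \<le> max 1 z"
    proof (cases "z \<ge> 1")
      case True
      hence "z powr (- x) \<le> z powr 1" using x by (intro powr_mono) auto
      thus ?thesis using True by simp
    next
      case False
      hence "z powr (- x) \<le> 1" using assms x by (intro powr_le1) auto
      thus ?thesis by simp
    qed
    have pos: "0 < \<bar>y\<bar> * (exp (pi * \<bar>y\<bar>) / 4)" using y by auto
    have le: "\<bar>y\<bar> * (exp (pi * \<bar>y\<bar>) / 4) \<le> \<bar>y\<bar> * sinh (pi * \<bar>y\<bar>)"
      by (intro mult_left_mono sinh_pi_ge y) auto
    have kf: "pi / (\<bar>y\<bar> * sinh (pi * \<bar>y\<bar>)) \<le> pi / (\<bar>y\<bar> * (exp (pi * \<bar>y\<bar>) / 4))"
      using pos le by (intro divide_left_mono mult_pos_pos[of "\<bar>y\<bar> * _"]) auto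
    have "norm (mb_kernel q z t) \<le> pi / (\<bar>y\<bar> * sinh (pi * \<bar>y\<bar>)) * norm (rGamma s) * z powr (- x)"
      using norm_mb_kernel_le[OF assms(2), of t q] y by (simp add: t_def s_def)
    also have "\<dots> \<le> pi / (\<bar>y\<bar> * (exp (pi * \<bar>y\<bar>) / 4)) *
        ((5 * \<bar>y\<bar>) * (6 * \<bar>y\<bar>) * (D * exp (pi * (\<bar>q\<bar> * \<bar>y\<bar>) / 2) * (2 * exp 2))) * max 1 z"
    proof -
      have nn: "0 \<le> (5 * \<bar>y\<bar>) * (6 * \<bar>y\<bar>) * (D * exp (pi * (\<bar>q\<bar> * \<bar>y\<bar>) / 2) * (2 * exp 2))"
        using D by (intro mult_nonneg_nonneg) auto
      have "0 \<le> pi / (\<bar>y\<bar> * (exp (pi * \<bar>y\<bar>) / 4))" using pos by (intro divide_nonneg_nonneg) auto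
      from mult_nonneg_nonneg[OF this nn] this show ?thesis
        by (intro mult_mono[OF mult_mono[OF kf rG] zx] norm_ge_zero powr_ge_zero)
    qed
    also have "\<dots> = A * (\<bar>y\<bar> * (exp (pi * (\<bar>q\<bar> * \<bar>y\<bar>) / 2) / exp (pi * \<bar>y\<bar>)))"
    proof -
      have "pi / (Y * (E / 4)) * ((5 * Y) * (6 * Y) * (D * E' * (2 * exp 2))) * max 1 z = A * (Y * (E' / E))"
        if "Y > 0" "E > 0" for Y E E' :: real
        using that by (simp add: A_def field_simps)
      from this[of "\<bar>y\<bar>"] show ?thesis using y by (simp only: exp_gt_zero)
    qed
    also have "exp (pi * (\<bar>q\<bar> * \<bar>y\<bar>) / 2) / exp (pi * \<bar>y\<bar>) = exp (- (\<delta> * \<bar>y\<bar>))"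
      unfolding exp_diff[symmetric] by (simp add: \<delta>_def algebra_simps)
    also have "A * (\<bar>y\<bar> * exp (- (\<delta> * \<bar>y\<bar>))) \<le> A * (2 / \<delta> * exp (- (\<delta> / 2) * \<bar>y\<bar>))"
    proof (intro mult_left_mono A)
      have "\<delta> * \<bar>y\<bar> / 2 \<le> exp (\<delta> * \<bar>y\<bar> / 2)" using exp_ge_add_one_self[of "\<delta> * \<bar>y\<bar> / 2"] by linarith
      hence "\<bar>y\<bar> \<le> 2 / \<delta> * exp (\<delta> * \<bar>y\<bar> / 2)" using \<delta> by (simp add: field_simps)
      hence "\<bar>y\<bar> * exp (- (\<delta> * \<bar>y\<bar>)) \<le> 2 / \<delta> * exp (\<delta> * \<bar>y\<bar> / 2) * exp (- (\<delta> * \<bar>y\<bar>))"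
        by (intro mult_right_mono) auto
      also have "\<dots> = 2 / \<delta> * exp (- (\<delta> / 2) * \<bar>y\<bar>)"
        by (simp add: mult.assoc flip: exp_add)
      finally show "\<bar>y\<bar> * exp (- (\<delta> * \<bar>y\<bar>)) \<le> 2 / \<delta> * exp (- (\<delta> / 2) * \<bar>y\<bar>)" .
    qed
    finally show ?thesis by (simp add: b_def t_def mult_ac)
  qed
  thus ?thesis using that lim by blast
qed

lemma borel_measurable_mb_kernel_contour:
  assumes "mb_contour K" "z > 0"
  shows "(\<lambda>x. mb_kernel q z (contour_path K x)) \<in> borel_measurable borel"
  by (intro borel_measurable_continuous_onI
      continuous_on_compose2[OF holomorphic_on_imp_continuous_on[OF holomorphic_mb_kernel[OF assms(2)]] continuous_contour_path])
    (use contour_path_in_mb_dom[OF assms(1)] in auto)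

lemma mb_integrable_line:
  assumes "\<bar>q\<bar> \<le> 2" "z > 0" "-1/8 \<le> c" "c < 0"
  shows "mb_integrable (Line c) (mb_kernel q z)"
proof -
  obtain K where K: "norm (mb_kernel q z (Complex c y)) \<le> K * z powr (- c) * line_majorant c y" for y
    using norm_mb_kernel_line_le assms by metis
  obtain A where "integrable lborel (line_majorant c)" using integrable_line_majorant assms(4) by force
  hence int: "integrable lborel (\<lambda>y. K * z powr (- c) * line_majorant c y)" by simp
  have meas: "(\<lambda>x. mb_kernel q z (contour_path (Line c) x) * contour_deriv (Line c) x) \<in> borel_measurable lborel"
    using borel_measurable_mb_kernel_contour[of "Line c" z q] assms by simp
  have "AE x in lborel. norm (mb_kernel q z (contour_path (Line c) x) * contour_deriv (Line c) x) \<le>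
      norm (K * z powr (- c) * line_majorant c x)"
    using order_trans[OF K abs_ge_self] by (intro AE_I2) (simp add: norm_mult)
  thus ?thesis unfolding mb_integrable_def by (rule Bochner_Integration.integrable_bound[OF int meas])
qed

lemma mb_integral_line_unique:
  assumes "\<bar>q\<bar> < 2" "z > 0" "mb_contour (Line c)" "mb_contour (Line c')"
    and "mb_integrable (Line c) (mb_kernel q z)" "mb_integrable (Line c') (mb_kernel q z)"
  shows "mb_integral (Line c) (mb_kernel q z) = mb_integral (Line c') (mb_kernel q z)"
proof -
  obtain G where G: "\<And>t. t \<in> mb_dom \<Longrightarrow> (G has_field_derivative mb_kernel q z t) (at t)"
    using mb_kernel_primitive[OF assms(2)] by metis
  obtain b where b: "(b \<longlongrightarrow> 0) at_top"
    "\<And>x y. -1 < x \<Longrightarrow> x < 0 \<Longrightarrow> \<bar>y\<bar> \<ge> 1 \<Longrightarrow> norm (mb_kernel q z (Complex x y)) \<le> b \<bar>y\<bar>"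
    using mb_kernel_strip_bound[OF assms(1,2)] by metis
  show ?thesis
    using line_integral_unique[OF G b(1) b(2) assms(3,4)] assms(5,6)
    by (simp only: mb_integral_def)
qed

lemma mb_integrable_loop:
  assumes "z > 0" "\<bar>e\<bar> = 1" "q * e = \<bar>q\<bar>" "0 < 1 + q * c" "ray_decay q z e c k K"
    and "mb_contour (loop_contour e c l u)"
  obtains B where "\<And>x. norm (mb_kernel q z (contour_path (loop_contour e c l u) x)) \<le> B * exp (- k * loop_depth l u x)"
    and "mb_integrable (loop_contour e c l u) (mb_kernel q z)"
  using loop_integrable[OF holomorphic_on_imp_continuous_on[OF holomorphic_mb_kernel[OF assms(1)]]
     ray_bound_mb_kernel[OF assms(1-5)] assms(2,6)] by metis

lemma mb_integral_loop_eq_line: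
  assumes "z > 0" "\<bar>e\<bar> = 1" "q * e = \<bar>q\<bar>" "\<bar>q\<bar> \<le> 2" "-1/8 \<le> c" "c < 0" "ray_decay q z e c k K"
    and "mb_contour (loop_contour e c' l u)" "mb_integrable (loop_contour e c' l u) (mb_kernel q z)"
  shows "mb_integral (loop_contour e c' l u) (mb_kernel q z) = mb_integral (Line c) (mb_kernel q z)"
proof -
  have "\<bar>q * c\<bar> \<le> 2 * (1/8)" unfolding abs_mult using assms by (intro mult_mono) auto
  hence \<sigma>: "1 + q * c \<ge> 3/4" by (simp add: abs_le_iff)
  hence \<sigma>': "0 < 1 + q * c" by linarith
  obtain G where G: "\<And>t. t \<in> mb_dom \<Longrightarrow> (G has_field_derivative mb_kernel q z t) (at t)"
    using mb_kernel_primitive[OF assms(1)] by metis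
  have "K \<ge> 0" using assms(7) by (simp add: ray_decay_def)
  note lim = ray_majorant_tendsto_0[OF assms(4) \<sigma> this]
  have c: "mb_contour (Line c)" using assms by simp
  show ?thesis
    using loop_integral_eq_line_integral[OF G ray_bound_mb_kernel[OF assms(1-3) \<sigma>' assms(7)] assms(2) lim assms(8) c]
      assms(9) mb_integrable_line[OF assms(4,1,5,6)]
    by (simp only: mb_integral_def)
qed

lemma fox_H_eq_loop:
  assumes "\<bar>q\<bar> \<ge> 2" "z > 0" "-1 < c" "c < 0" "0 < 1 + q * c"
  shows "cap_H q z = mb_integral (loop_contour (sgn q) c (-1) 1) (mb_kernel q z)"
proof -
  define e where "e = sgn q"
  have e: "\<bar>e\<bar> = 1" "q * e = \<bar>q\<bar>" "q \<noteq> 0" using assms by (auto simp: e_def sgn_if)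
  obtain K where K: "ray_decay q z e c 1 K" unfolding e_def using ray_decay_Gamma[OF assms(2) e(3) assms(5)] by metis
  have mc: "mb_contour (loop_contour e c (-1) 1)" using assms by (simp add: mb_contour_loop_contour)
  obtain B where int: "mb_integrable (loop_contour e c (-1) 1) (mb_kernel q z)"
    using mb_integrable_loop[OF assms(2) e(1,2) assms(5) K mc] by metis
  obtain G where G: "\<And>t. t \<in> mb_dom \<Longrightarrow> (G has_field_derivative mb_kernel q z t) (at t)"
    using mb_kernel_primitive[OF assms(2)] by metis
  show ?thesis unfolding e_def[symmetric]
  proof (rule fox_H_eq_mb_integral[OF assms(2) _ mc int])
    show "loop_contour e c (-1) 1 \<in> cap_contours q z"
      unfolding fox_contours[OF assms(2)] using assms by (simp add: e_def) (rule exI[of _ c], rule exI[of _ "-1"], rule exI[of _ 1], simp)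
    fix K' assume K': "K' \<in> cap_contours q z" "mb_contour K'" "mb_integrable K' (mb_kernel q z)"
    then obtain c' l' u' where eq: "K' = loop_contour e c' l' u'"
      unfolding fox_contours[OF assms(2)] using assms by (auto simp: e_def)
    show "mb_integral K' (mb_kernel q z) = mb_integral (loop_contour e c (-1) 1) (mb_kernel q z)"
      using loop_integral_unique[OF G ray_bound_mb_kernel[OF assms(2) e(1,2) assms(5) K] e(1), of c' l' u' c "-1" 1] K' mc int
      unfolding eq by (simp only: mb_integral_def)
  qed
qed

lemma fox_H_eq_line:
  assumes "\<bar>q\<bar> \<le> 2" "z > 0" "-1/8 \<le> c" "c < 0"
  shows "cap_H q z = mb_integral (Line c) (mb_kernel q z)"
proof (cases "\<bar>q\<bar> < 2")
  case True
  have c: "mb_contour (Line c)" using assms by simp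
  note int = mb_integrable_line[OF assms]
  show ?thesis
  proof (rule fox_H_eq_mb_integral[OF assms(2) _ c int])
    show "Line c \<in> cap_contours q z"
      unfolding fox_contours[OF assms(2)] using True by simp
    fix K' assume K': "K' \<in> cap_contours q z" "mb_contour K'" "mb_integrable K' (mb_kernel q z)"
    then obtain c' where "K' = Line c'" unfolding fox_contours[OF assms(2)] using True by auto
    thus "mb_integral K' (mb_kernel q z) = mb_integral (Line c) (mb_kernel q z)"
      using mb_integral_line_unique[OF True assms(2)] K' c int by metis
  qed
next
  case False
  define e where "e = sgn q"
  have e: "\<bar>e\<bar> = 1" "q * e = \<bar>q\<bar>" "q \<noteq> 0" using False by (auto simp: e_def sgn_if)
  have "\<bar>q * c\<bar> \<le> 2 * (1/8)" unfolding abs_mult using assms by (intro mult_mono) auto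
  hence \<sigma>: "0 < 1 + q * c" by (simp add: abs_le_iff)
  obtain K where K: "ray_decay q z e c 1 K" unfolding e_def using ray_decay_Gamma[OF assms(2) e(3) \<sigma>] by metis
  have mc: "mb_contour (loop_contour e c (-1) 1)" using assms by (simp add: mb_contour_loop_contour)
  obtain B where int: "mb_integrable (loop_contour e c (-1) 1) (mb_kernel q z)"
    using mb_integrable_loop[OF assms(2) e(1,2) \<sigma> K mc] by metis
  note eq = mb_integral_loop_eq_line[OF assms(2) e(1,2) assms(1,3,4) K]
  have "cap_H q z = mb_integral (loop_contour e c (-1) 1) (mb_kernel q z)"
    unfolding e_def using False assms \<sigma> by (intro fox_H_eq_loop) auto
  also have "\<dots> = mb_integral (Line c) (mb_kernel q z)" by (rule eq[OF mc int])
  finally show ?thesis .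
qed

subsection \<open>The logarithm as a Mellin--Barnes integral\<close>

lemma Fubini_lborel:
  fixes f :: "real \<Rightarrow> real \<Rightarrow> complex"
  assumes f: "case_prod f \<in> borel_measurable (lborel \<Otimes>\<^sub>M lborel)"
    and i1: "\<And>x. integrable lborel (f x)"
    and i2: "integrable lborel (\<lambda>x. LBINT y. norm (f x y))"
  shows "integrable lborel (\<lambda>y. LBINT x. f x y)"
    and "(LBINT y. LBINT x. f x y) = (LBINT x. LBINT y. f x y)"
proof -
  have *: "integrable (lborel \<Otimes>\<^sub>M lborel) (case_prod f)"
    by (rule lborel_pair.Fubini_integrable[OF f]) (use i1 i2 in auto)
  show "integrable lborel (\<lambda>y. LBINT x. f x y)"
    by (rule lborel_pair.integrable_snd[OF *])
  show "(LBINT y. LBINT x. f x y) = (LBINT x. LBINT y. f x y)"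
    by (rule lborel_pair.Fubini_integral[OF *])
qed

lemma of_real_powr_eq_exp: "s > 0 \<Longrightarrow> (of_real s :: complex) powr a = exp (a * of_real (ln s))"
  by (simp add: powr_def Ln_of_real)

lemma
  assumes a: "Re a > 0" and X: "X > 0"
  shows set_integrable_Gamma_Laplace:
      "set_integrable lborel {0<..} (\<lambda>s. exp ((a - 1) * of_real (ln s)) * of_real (exp (- s * X)))"
    and LINT_Gamma_Laplace:
      "(LINT s:{0<..}|lborel. exp ((a - 1) * of_real (ln s)) * of_real (exp (- s * X))) =
       Gamma a * exp (- a * of_real (ln X))"
proof -
  define f where "f = (\<lambda>X s. indicator {0<..} s *\<^sub>R (exp ((a - 1) * of_real (ln s)) * complex_of_real (exp (- s * X))))"
  have eq: "exp ((a - 1) * of_real (ln s)) * complex_of_real (exp (- s * X)) =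
      of_real s powr (a - 1) / of_real (exp (X * s))" if "s > 0" for s X
    using that by (simp add: of_real_powr_eq_exp exp_minus field_simps mult.commute)
  have int: "integrable lborel (f X)" if "X > 0" for X
  proof -
    have "(\<lambda>s. complex_of_real s powr (a - 1) / of_real (exp (X * s))) absolutely_integrable_on {0<..}"
      by (rule absolutely_integrable_Gamma_integral[OF a that])
    moreover have "indicator {0<..} s *\<^sub>R (of_real s powr (a - 1) / complex_of_real (exp (X * s))) = f X s" for s
      by (cases "s > 0") (simp only: f_def eq, simp add: f_def)
    ultimately have "integrable lebesgue (f X)"
      by (simp only: set_integrable_def)
    moreover have "f X \<in> borel_measurable lborel" unfolding f_def by measurable
    ultimately show ?thesis by (simp add: integrable_completion)
  qed
  show "set_integrable lborel {0<..} (\<lambda>s. exp ((a - 1) * of_real (ln s)) * of_real (exp (- s * X)))"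
    using int[OF X] by (simp add: set_integrable_def f_def)
  have 1: "integral\<^sup>L lborel (f 1) = Gamma a"
  proof -
    have "((\<lambda>s. exp ((a - 1) * of_real (ln s)) * complex_of_real (exp (- s * 1))) has_integral Gamma a) {0<..}"
      by (rule has_integral_eq[OF _ Gamma_integral_complex'[OF a]]) (use eq[of _ 1] in simp)
    thus ?thesis
      using set_borel_integral_eq_integral(2)[of "{0<..}" "\<lambda>s. exp ((a - 1) * of_real (ln s)) * complex_of_real (exp (- s * 1))"]
        int[of 1] by (simp add: set_integrable_def set_lebesgue_integral_def f_def integral_unique)
  qed
  have 2: "f 1 (0 + X * s) = exp ((a - 1) * of_real (ln X)) * f X s" for s
  proof (cases "s > 0")
    case True
    hence "ln (X * s) = ln X + ln s" using X by (simp add: ln_mult)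
    hence "exp ((a - 1) * of_real (ln (X * s))) = exp ((a - 1) * of_real (ln X)) * exp ((a - 1) * complex_of_real (ln s))"
      by (simp only: of_real_add distrib_left exp_add)
    thus ?thesis using True X by (simp add: f_def mult_ac)
  next
    case False
    thus ?thesis using X by (simp add: f_def zero_less_mult_iff)
  qed
  have "Gamma a = of_real X * (exp ((a - 1) * of_real (ln X)) * integral\<^sup>L lborel (f X))"
    using lborel_integral_real_affine[of X "f 1" 0] X unfolding 1 2 by (simp add: scaleR_conv_of_real)
  also have "of_real X = exp (of_real (ln X) :: complex)" using X by (simp add: exp_of_real)
  also have "exp (of_real (ln X)) * (exp ((a - 1) * of_real (ln X)) * integral\<^sup>L lborel (f X)) =
      exp (a * of_real (ln X)) * integral\<^sup>L lborel (f X)"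
    by (simp add: mult.assoc[symmetric] exp_add[symmetric] algebra_simps)
  finally have "integral\<^sup>L lborel (f X) = Gamma a * exp (- a * of_real (ln X))"
    by (simp add: exp_minus)
  thus "(LINT s:{0<..}|lborel. exp ((a - 1) * of_real (ln s)) * of_real (exp (- s * X))) =
       Gamma a * exp (- a * of_real (ln X))"
    by (simp add: set_lebesgue_integral_def f_def)
qed

lemma
  fixes x X :: real
  assumes x: "x > 0" and X: "X > 0"
  shows set_integrable_Gamma_Laplace_real:
      "set_integrable lborel {0<..} (\<lambda>s. exp ((x - 1) * ln s) * exp (- s * X))"
    and LINT_Gamma_Laplace_real:
      "(LINT s:{0<..}|lborel. exp ((x - 1) * ln s) * exp (- s * X)) = Gamma x * exp (- x * ln X)"
proof -
  have eq: "exp ((of_real x - 1) * of_real (ln s)) * of_real (exp (- s * X)) =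
      complex_of_real (exp ((x - 1) * ln s) * exp (- s * X))" for s
    by (simp flip: exp_of_real)
  have "set_integrable lborel {0<..} (\<lambda>s. complex_of_real (exp ((x - 1) * ln s) * exp (- s * X)))"
    using set_integrable_Gamma_Laplace[of "of_real x" X] assms unfolding eq by simp
  thus "set_integrable lborel {0<..} (\<lambda>s. exp ((x - 1) * ln s) * exp (- s * X))"
    unfolding set_integrable_def by (simp only: scaleR_conv_of_real of_real_mult[symmetric] complex_of_real_integrable_eq) simp
  have "complex_of_real (LINT s:{0<..}|lborel. exp ((x - 1) * ln s) * exp (- s * X)) =
      Gamma (of_real x) * exp (- of_real x * of_real (ln X))"
    using LINT_Gamma_Laplace[of "of_real x" X] assms unfolding eq set_integral_complex_of_real by simp
  also have "\<dots> = complex_of_real (Gamma x * exp (- x * ln X))"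
    by (simp add: Gamma_complex_of_real flip: exp_of_real)
  finally show "(LINT s:{0<..}|lborel. exp ((x - 1) * ln s) * exp (- s * X)) = Gamma x * exp (- x * ln X)"
    by (simp only: of_real_eq_iff)
qed

lemma LINT_exp_neg:
  fixes a :: real
  assumes "a > 0"
  shows "set_integrable lborel {0<..} (\<lambda>v. exp (- v * a))" "(LINT v:{0<..}|lborel. exp (- v * a)) = 1 / a"
  using set_integrable_Gamma_Laplace_real[of 1 a] LINT_Gamma_Laplace_real[of 1 a] assms
  by (simp_all add: exp_minus field_simps)

lemma
  assumes a: "0 < Re a" "Re a < 1"
  shows set_integrable_Beta_half_line:
      "set_integrable lborel {0<..} (\<lambda>u. exp ((a - 1) * of_real (ln u)) / of_real (1 + u))"
    and LINT_Beta_half_line: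
      "(LINT u:{0<..}|lborel. exp ((a - 1) * of_real (ln u)) / of_real (1 + u)) = Gamma a * Gamma (1 - a)"
proof -
  define f where "f = (\<lambda>v u. indicator {0<..} v *\<^sub>R (indicator {0<..} u *\<^sub>R
    (exp ((a - 1) * of_real (ln u)) * complex_of_real (exp (- v * (1 + u))))))"
  have meas: "case_prod f \<in> borel_measurable (lborel \<Otimes>\<^sub>M lborel)" unfolding f_def by measurable
  have fe: "f v u = (indicator {0<..} v * exp (- v)) *\<^sub>R (indicator {0<..} u *\<^sub>R
    (exp ((a - 1) * of_real (ln u)) * complex_of_real (exp (- u * v))))" for v u
    by (simp add: f_def indicator_def scaleR_conv_of_real algebra_simps flip: exp_add of_real_mult)
  have i1: "integrable lborel (f v)" for v
  proof (cases "v > 0")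
    case True
    show ?thesis using set_integrable_Gamma_Laplace[OF a(1) True] unfolding fe set_integrable_def
      by (intro integrable_scaleR_right)
  qed (simp add: f_def)
  have nf: "norm (f v u) = (indicator {0<..} v * exp (- v)) * (indicator {0<..} u *\<^sub>R
    (exp ((Re a - 1) * ln u) * exp (- u * v)))" for v u
    by (simp add: fe norm_mult abs_mult norm_exp_eq_Re indicator_def)
  have n: "(LBINT u. norm (f v u)) = Gamma (Re a) * (indicator {0<..} v *\<^sub>R (exp ((1 - Re a - 1) * ln v) * exp (- v * 1)))" for v
  proof (cases "v > 0")
    case True
    thus ?thesis unfolding nf
      using LINT_Gamma_Laplace_real[OF a(1) True] by (simp add: set_lebesgue_integral_def)
  qed (simp add: nf)
  have i2: "integrable lborel (\<lambda>v. LBINT u. norm (f v u))"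
    unfolding n using set_integrable_Gamma_Laplace_real[of "1 - Re a" 1] a
    by (intro integrable_mult_right) (simp add: set_integrable_def)
  have inner: "(LBINT v. f v u) = indicator {0<..} u *\<^sub>R (exp ((a - 1) * of_real (ln u)) / of_real (1 + u))" for u
  proof (cases "u > 0")
    case True
    have "(LBINT v. f v u) = (LBINT v. exp ((a - 1) * of_real (ln u)) * of_real (indicator {0<..} v * exp (- v * (1 + u))))"
      using True by (intro Bochner_Integration.integral_cong) (auto simp: f_def indicator_def)
    also have "\<dots> = exp ((a - 1) * of_real (ln u)) * of_real (LBINT v. indicator {0<..} v * exp (- v * (1 + u)))"
      by (simp only: integral_mult_right_zero integral_complex_of_real)
    also have "(LBINT v. indicator {0<..} v * exp (- v * (1 + u))) = 1 / (1 + u)"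
      using LINT_exp_neg(2)[of "1 + u"] True by (simp add: set_lebesgue_integral_def)
    finally show ?thesis using True by simp
  qed (simp add: f_def)
  have outer: "(LBINT u. f v u) = Gamma a * (indicator {0<..} v *\<^sub>R (exp ((1 - a - 1) * of_real (ln v)) * of_real (exp (- v * 1))))" for v
  proof (cases "v > 0")
    case True
    thus ?thesis unfolding fe
      using LINT_Gamma_Laplace[OF a(1) True] by (simp add: set_lebesgue_integral_def scaleR_conv_of_real)
  qed (simp add: f_def)
  note F = Fubini_lborel[OF meas i1 i2]
  show "set_integrable lborel {0<..} (\<lambda>u. exp ((a - 1) * of_real (ln u)) / of_real (1 + u))"
    using F(1) unfolding inner set_integrable_def .
  show "(LINT u:{0<..}|lborel. exp ((a - 1) * of_real (ln u)) / of_real (1 + u)) = Gamma a * Gamma (1 - a)"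
    using F(2) LINT_Gamma_Laplace[of "1 - a" 1] a
    unfolding inner outer integral_mult_right_zero set_lebesgue_integral_def by simp
qed

lemma borel_measurable_cosh [measurable]: "(cosh :: real \<Rightarrow> real) \<in> borel_measurable borel"
  by (intro borel_measurable_continuous_onI continuous_intros)

lemma integrable_sech: "integrable lborel (\<lambda>y::real. 1 / cosh (pi * y))"
proof (rule Bochner_Integration.integrable_bound)
  show "integrable lborel (\<lambda>y::real. 2 * exp (- pi * loop_depth 0 0 y))"
    by (intro integrable_mult_right integrable_exp_loop_depth) auto
  have "1 / cosh (pi * y) \<le> 2 * exp (- pi * loop_depth 0 0 y)" for y :: real
  proof -
    have "exp (pi * loop_depth 0 0 y) \<le> 2 * cosh (pi * y)"
      by (auto simp: loop_depth_def cosh_def max_def)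
    hence "1 / (2 * cosh (pi * y)) \<le> 1 / exp (pi * loop_depth 0 0 y)"
      by (intro divide_left_mono) auto
    thus ?thesis by (simp add: exp_minus field_simps)
  qed
  thus "AE y in lborel. norm (1 / cosh (pi * y)) \<le> norm (2 * exp (- pi * loop_depth 0 0 y))"
    by (intro AE_I2) simp
qed simp

lemma integrable_sech_bound:
  fixes g :: "real \<Rightarrow> complex"
  assumes "g \<in> borel_measurable borel" "\<And>y. norm (g y) \<le> C / cosh (pi * y)"
  shows "integrable lborel g"
proof (rule Bochner_Integration.integrable_bound)
  show "integrable lborel (\<lambda>y. C * (1 / cosh (pi * y)))" by (intro integrable_mult_right integrable_sech)
  show "AE y in lborel. norm (g y) \<le> norm (C * (1 / cosh (pi * y)))"
    using order_trans[OF assms(2) abs_ge_self] by (intro AE_I2) (simp only: real_norm_def times_divide_eq_right mult_1_right)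
qed (use assms in simp)

text \<open>
  The substitution \<open>u = exp (2 \<pi> y)\<close> turns the Beta integral into the Fourier transform of \<open>1 / cosh (\<pi> y)\<close>.
  That function is its own transform, so no Mellin inversion theorem is needed.
\<close>

lemma sech_Fourier:
  fixes r :: real
  shows "(LBINT y. of_real (pi / cosh (pi * y)) * exp (- \<i> * of_real (y * r))) = of_real (pi / cosh (r / 2))"
proof -
  define a where "a = 1/2 - \<i> * of_real (r / (2 * pi))"
  have a: "0 < Re a" "Re a < 1" by (auto simp: a_def)
  define f where "f = (\<lambda>u. exp ((a - 1) * of_real (ln u)) / complex_of_real (1 + u))"
  have sub: "(2 * pi * exp (2 * pi * y)) *\<^sub>R f (exp (2 * pi * y)) =
      of_real (pi / cosh (pi * y)) * exp (- \<i> * of_real (y * r))" for y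
  proof -
    have c: "pi / cosh (pi * y) = 2 * pi * exp (pi * y) / (1 + exp (2 * pi * y))"
    proof -
      have "exp (2 * pi * y) = exp (pi * y) * exp (pi * y)" by (simp flip: exp_add)
      moreover have "1 + exp (pi * y) * exp (pi * y) \<noteq> 0" by (intro pos_add_strict less_imp_neq[symmetric]) auto
      ultimately show ?thesis by (simp add: cosh_def exp_minus field_simps)
    qed
    have e: "complex_of_real (exp (2 * pi * y)) * exp ((a - 1) * of_real (2 * pi * y)) =
        of_real (exp (pi * y)) * exp (- \<i> * of_real (y * r))"
      unfolding exp_of_real[symmetric] exp_add[symmetric] by (rule arg_cong[where f = exp]) (simp add: a_def field_simps)
    have "(2 * pi * exp (2 * pi * y)) *\<^sub>R f (exp (2 * pi * y)) =
        of_real (2 * pi) * (complex_of_real (exp (2 * pi * y)) * exp ((a - 1) * of_real (2 * pi * y))) / of_real (1 + exp (2 * pi * y))"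
      by (simp add: f_def scaleR_conv_of_real)
    also have "\<dots> = of_real (2 * pi * exp (pi * y) / (1 + exp (2 * pi * y))) * exp (- \<i> * of_real (y * r))"
      unfolding e by simp
    finally show ?thesis unfolding c .
  qed
  have "(LBINT u=0..\<infinity>. f u) = (LBINT y=-\<infinity>..\<infinity>. (2 * pi * exp (2 * pi * y)) *\<^sub>R f (exp (2 * pi * y)))"
  proof (rule interval_integral_substitution_integrable)
    show "set_integrable lborel (einterval (-\<infinity>) \<infinity>) (\<lambda>y. (2 * pi * exp (2 * pi * y)) *\<^sub>R f (exp (2 * pi * y)))"
      unfolding sub set_integrable_def
      by (simp add: einterval_def, rule integrable_sech_bound[where C = pi]) (auto simp: norm_mult norm_divide)
    show "set_integrable lborel (einterval 0 \<infinity>) f"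
      using set_integrable_Beta_half_line[OF a] by (simp add: f_def einterval_def greaterThan_def zero_ereal_def)
    show "((ereal \<circ> (\<lambda>y. exp (2 * pi * y)) \<circ> real_of_ereal) \<longlongrightarrow> 0) (at_right (- \<infinity>))"
      unfolding zero_ereal_def
      by (auto simp: ereal_tendsto_simps intro!: filterlim_compose[OF exp_at_bot] filterlim_tendsto_pos_mult_at_bot[OF tendsto_const] filterlim_ident)
    show "((ereal \<circ> (\<lambda>y. exp (2 * pi * y)) \<circ> real_of_ereal) \<longlongrightarrow> \<infinity>) (at_left \<infinity>)"
      by (auto simp: ereal_tendsto_simps intro!: filterlim_compose[OF exp_at_top] filterlim_tendsto_pos_mult_at_top[OF tendsto_const] filterlim_ident)
    fix y :: real
    show "((\<lambda>y. exp (2 * pi * y)) has_real_derivative 2 * pi * exp (2 * pi * y)) (at y)"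
      by (auto intro!: derivative_eq_intros)
    have "1 + exp (2 * pi * y) \<noteq> 0" by (intro pos_add_strict less_imp_neq[symmetric]) auto
    hence nz: "complex_of_real (1 + exp (2 * pi * y)) \<noteq> 0" by (simp only: of_real_eq_0_iff not_False_eq_True)
    show "isCont f (exp (2 * pi * y))" unfolding f_def
      by (intro continuous_intros nz) simp
  qed (auto intro!: continuous_intros)
  hence "(LINT u:{0<..}|lborel. f u) = (LBINT y. of_real (pi / cosh (pi * y)) * exp (- \<i> * of_real (y * r)))"
    unfolding sub by (simp add: interval_lebesgue_integral_def einterval_def greaterThan_def zero_ereal_def set_lebesgue_integral_def)
  hence "(LBINT y. of_real (pi / cosh (pi * y)) * exp (- \<i> * of_real (y * r))) = Gamma a * Gamma (1 - a)"
    using LINT_Beta_half_line[OF a] by (simp add: f_def)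
  also have "\<dots> = of_real pi / sin (of_real pi * a)" by (rule Gamma_reflection_complex)
  also have "of_real pi * a = of_real pi / 2 - \<i> * of_real (r / 2)" by (simp add: a_def field_simps)
  also have "sin (of_real pi / 2 - \<i> * of_real (r / 2)) = cos (\<i> * of_real (r / 2))" by (simp add: sin_diff)
  also have "\<dots> = of_real (cosh (r / 2))"
    unfolding cos_i_times cosh_field_def exp_of_real by (simp add: exp_minus)
  finally show ?thesis by simp
qed

lemma mb_kernel_0_line:
  "mb_kernel 0 w (Complex (-1/2) y) =
    of_real (pi / cosh (pi * y)) * exp ((1/2 - \<i> * of_real y) * of_real (ln w)) / (1/2 - \<i> * of_real y)"
  if "w > 0"
proof -
  define t where "t = Complex (-1/2) y"
  have t: "t = - (1/2 - \<i> * of_real y)" by (simp add: t_def complex_eq_iff)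
  have "of_real pi * t = - (of_real pi / 2 - \<i> * of_real (pi * y))" by (simp add: t algebra_simps)
  hence "sin (of_real pi * t) = - sin (of_real pi / 2 - \<i> * of_real (pi * y))" by (simp only: sin_minus)
  also have "\<dots> = - cos (\<i> * of_real (pi * y))" by (simp add: sin_diff)
  also have "\<dots> = - of_real (cosh (pi * y))"
    unfolding cos_i_times cosh_field_def exp_of_real by (simp add: exp_minus)
  finally have s: "sin (of_real pi * t) = - of_real (cosh (pi * y))" .
  have "mb_kernel 0 w t = of_real pi / (t * sin (of_real pi * t)) * exp (- t * of_real (ln w))"
    using that by (simp add: mb_kernel_def of_real_powr_minus_eq_exp)
  also have "t * sin (of_real pi * t) = (1/2 - \<i> * of_real y) * of_real (cosh (pi * y))"
    unfolding s by (subst t) (simp only: minus_mult_minus)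
  also have "- t = 1/2 - \<i> * of_real y" by (simp add: t)
  finally show ?thesis by (simp add: t_def field_simps)
qed

lemma
  assumes w: "w > 0"
  shows mb_integrable_half_line: "mb_integrable (Line (-1/2)) (mb_kernel 0 w)"
    and mb_integral_half_line: "mb_integral (Line (-1/2)) (mb_kernel 0 w) = of_real (ln (1 + w))"
proof -
  let ?\<alpha> = "\<lambda>y. 1/2 - \<i> * complex_of_real y"
  define g where "g = (\<lambda>y x. exp (- (1/2 + \<i> * complex_of_real y) * of_real (ln x)))"
  define P where "P = (\<lambda>y x. exp (?\<alpha> y * of_real (ln x)) / (1/2 - \<i> * of_real y))"
  have nz: "?\<alpha> y \<noteq> 0" for y by (simp add: complex_eq_iff)
  have nz2: "norm (?\<alpha> y) \<ge> 1/2" for y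
    using abs_Re_le_cmod[of "?\<alpha> y"] by simp
  have np: "norm (?\<alpha> y) > 0" for y
    using nz2[of y] by linarith
  have real_int: "((\<lambda>x. exp (- (1/2) * ln x)) has_integral 2 * sqrt w - 2 * sqrt 0) {0..w}"
  proof (rule fundamental_theorem_of_calculus_interior)
    fix x :: real assume x: "x \<in> {0<..<w}"
    have "exp (- (1/2) * ln x) = 1 / sqrt x"
      using x by (simp add: exp_minus ln_sqrt[symmetric] field_simps)
    thus "((\<lambda>x. 2 * sqrt x) has_vector_derivative exp (- (1/2) * ln x)) (at x)"
      unfolding has_real_derivative_iff_has_vector_derivative[symmetric]
      using x by (auto intro!: derivative_eq_intros simp: field_simps)
  qed (use w in \<open>auto intro!: continuous_intros\<close>)
  have real_set: "set_integrable lborel {0..w} (\<lambda>x. exp (- (1/2) * ln x))"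
      "(LINT x:{0..w}|lborel. exp (- (1/2) * ln x)) = 2 * sqrt w"
    using has_integral_nonneg_imp_set_integrable[OF _ _ _ real_int] by simp_all
  have ng: "norm (g y x) = exp (- (1/2) * ln x)" for y x by (simp add: g_def norm_exp_eq_Re)
  have g_set: "set_integrable lborel {0..w} (g y)" for y
    by (rule set_integrable_bound[OF real_set(1)]) (auto simp: ng, simp add: set_borel_measurable_def g_def)
  have g_int: "(LINT x:{0..w}|lborel. g y x) = P y w" for y
  proof -
    define F where "F = (\<lambda>x. complex_of_real x powr ?\<alpha> y / ?\<alpha> y)"
    have FP: "F x = P y x" if "x > 0" for x
      using that by (simp add: F_def P_def of_real_powr_eq_exp)
    have F0: "F 0 = 0" by (simp add: F_def)
    have "(g y has_integral F w - F 0) {0..w}"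
    proof (rule fundamental_theorem_of_calculus_interior)
      show "continuous_on {0..w} F"
        unfolding F_def using nz by (intro continuous_intros) auto
      fix x assume x: "x \<in> {0<..<w}"
      have "(P y has_vector_derivative g y x) (at x)"
      proof -
        have d: "((\<lambda>x. ?\<alpha> y * of_real (ln x)) has_vector_derivative
            ?\<alpha> y * of_real (1 / x)) (at x)"
          using x by (intro has_vector_derivative_mult_right has_vector_derivative_of_real)
            (auto simp: has_real_derivative_iff_has_vector_derivative[symmetric] intro!: derivative_eq_intros)
        have "((\<lambda>x. exp (?\<alpha> y * of_real (ln x))) has_vector_derivative
            (?\<alpha> y * of_real (1 / x)) * exp (?\<alpha> y * of_real (ln x))) (at x)"
          using field_vector_diff_chain_at[OF d DERIV_exp] by (simp add: o_def)
        from has_vector_derivative_divide[OF this, of "?\<alpha> y"]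
        have "(P y has_vector_derivative (of_real (1 / x) * exp (?\<alpha> y * of_real (ln x)))) (at x)"
          using nz[of y] by (simp add: P_def)
        also have "complex_of_real (1 / x) = exp (- of_real (ln x))"
          using x by (simp add: exp_minus exp_of_real inverse_eq_divide)
        also have "exp (- of_real (ln x)) * exp (?\<alpha> y * of_real (ln x)) = g y x"
          unfolding g_def exp_add[symmetric] by (rule arg_cong[where f = exp]) (simp add: algebra_simps)
        finally show ?thesis .
      qed
      thus "(F has_vector_derivative g y x) (at x)"
        by (rule has_vector_derivative_transform_within_open[of _ _ _ "{0<..}"]) (use x FP in auto)
    qed (use w in simp)
    thus ?thesis
      using FP[OF w] F0 set_borel_integral_eq_integral(2)[OF g_set[of y]] by (simp add: integral_unique)
  qed
  define f where "f = (\<lambda>y x. indicator {0..w} x *\<^sub>R (of_real (pi / cosh (pi * y)) * g y x))"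
  have meas: "case_prod f \<in> borel_measurable (lborel \<Otimes>\<^sub>M lborel)" unfolding f_def g_def by measurable
  have fe: "f y x = of_real (pi / cosh (pi * y)) * (indicator {0..w} x *\<^sub>R g y x)" for y x
    by (simp add: f_def)
  have i1: "integrable lborel (f y)" for y
    using g_set[of y] unfolding fe set_integrable_def by (intro integrable_mult_right)
  have "norm (f y x) = pi / cosh (pi * y) * (indicator {0..w} x *\<^sub>R exp (- (1/2) * ln x))" for y x
    by (simp add: fe norm_mult norm_divide ng indicator_def)
  hence n: "(LBINT x. norm (f y x)) = pi * (2 * sqrt w) * (1 / cosh (pi * y))" for y
    using real_set(2) by (simp only: integral_mult_right_zero set_lebesgue_integral_def) simp
  have i2: "integrable lborel (\<lambda>y. LBINT x. norm (f y x))"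
    unfolding n by (intro integrable_mult_right integrable_sech)
  have outer: "(LBINT x. f y x) = mb_kernel 0 w (Complex (-1/2) y)" for y
    using g_int[of y] unfolding fe integral_mult_right_zero set_lebesgue_integral_def mb_kernel_0_line[OF w]
    by (simp add: P_def)
  have inner: "(LBINT y. f y x) = indicator {0<..w} x *\<^sub>R of_real (2 * pi * (1 / (1 + x)))" if "x \<noteq> 0" for x
  proof (cases "x \<in> {0<..w}")
    case True
    have "f y x = exp (- (1/2) * of_real (ln x)) * (of_real (pi / cosh (pi * y)) * exp (- \<i> * of_real (y * ln x)))" for y
    proof -
      have "g y x = exp (- (1/2) * of_real (ln x)) * exp (- \<i> * of_real (y * ln x))"
        unfolding g_def exp_add[symmetric] by (rule arg_cong[where f = exp]) (simp add: algebra_simps)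
      thus ?thesis using True by (simp add: f_def mult_ac)
    qed
    hence "(LBINT y. f y x) = exp (- (1/2) * of_real (ln x)) * of_real (pi / cosh (ln x / 2))"
      by (simp only: integral_mult_right_zero sech_Fourier)
    also have "\<dots> = of_real (exp (- (ln x / 2)) * (pi / cosh (ln x / 2)))" by (simp flip: exp_of_real)
    also have "exp (- (ln x / 2)) * (pi / cosh (ln x / 2)) = 2 * pi * (1 / (1 + x))"
    proof -
      define r where "r = exp (ln x / 2)"
      have r: "r > 0" "r * r = x" using True by (simp_all add: r_def flip: exp_add)
      have "1 + r * r \<noteq> 0" using r True by auto
      hence "inverse r * (pi / ((r + inverse r) / 2)) = 2 * pi * (1 / (1 + r * r))"
        using r(1) by (simp add: field_simps)
      thus ?thesis by (simp add: cosh_field_def exp_minus r(2) flip: r_def)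
    qed
    finally show ?thesis using True by simp
  qed (use that in \<open>auto simp: f_def indicator_def\<close>)
  note F = Fubini_lborel[OF meas i1 i2]
  have "((\<lambda>x. 2 * pi * (1 / (1 + x))) has_integral 2 * pi * ln (1 + w) - 2 * pi * ln (1 + 0)) {0..w}"
    by (rule fundamental_theorem_of_calculus)
      (use w in \<open>auto intro!: derivative_eq_intros simp: has_real_derivative_iff_has_vector_derivative[symmetric]\<close>)
  hence "(LINT x:{0..w}|lborel. 2 * pi * (1 / (1 + x))) = 2 * pi * ln (1 + w) - 2 * pi * ln (1 + 0)"
    by (intro has_integral_nonneg_imp_set_integrable(2)) auto
  moreover have "(LBINT x. LBINT y. f y x) = (LBINT x. of_real (indicator {0..w} x * (2 * pi * (1 / (1 + x)))))"
    by (rule integral_discrete_difference[of "{0}"]) (use inner in \<open>auto simp: indicator_def\<close>)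
  ultimately have "(LBINT x. LBINT y. f y x) = of_real (2 * pi * ln (1 + w))"
    unfolding integral_complex_of_real set_lebesgue_integral_def real_scaleR_def by (simp only: of_real_eq_iff) simp
  with F(2) have val: "(LBINT y. mb_kernel 0 w (Complex (-1/2) y)) = of_real (2 * pi * ln (1 + w))"
    unfolding outer by simp
  show "mb_integral (Line (-1/2)) (mb_kernel 0 w) = of_real (ln (1 + w))"
    unfolding mb_integral_def contour_lint_def contour_path.simps contour_deriv.simps integral_mult_left_zero val by simp
  have "integrable lborel (\<lambda>y. mb_kernel 0 w (Complex (-1/2) y))"
  proof (rule integrable_sech_bound[where C = "2 * pi * sqrt w"])
    show "(\<lambda>y. mb_kernel 0 w (Complex (-1/2) y)) \<in> borel_measurable borel"
      unfolding mb_kernel_0_line[OF w] by measurable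
    fix y
    have "norm (mb_kernel 0 w (Complex (-1/2) y)) = pi / cosh (pi * y) * sqrt w / norm (?\<alpha> y)"
      unfolding mb_kernel_0_line[OF w] using w by (simp add: norm_mult norm_divide norm_exp_eq_Re ln_sqrt[symmetric])
    also have "\<dots> \<le> pi / cosh (pi * y) * sqrt w / (1/2)"
      using w by (intro divide_left_mono nz2 mult_pos_pos np) auto
    finally show "norm (mb_kernel 0 w (Complex (-1/2) y)) \<le> 2 * pi * sqrt w / cosh (pi * y)" by (simp add: mult_ac)
  qed
  thus "mb_integrable (Line (-1/2)) (mb_kernel 0 w)"
    unfolding mb_integrable_def contour_path.simps contour_deriv.simps by (intro integrable_mult_left)
qed

lemma mb_integral_line_ln:
  assumes "w > 0" "-1/8 \<le> c" "c < 0"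
  shows "mb_integral (Line c) (mb_kernel 0 w) = of_real (ln (1 + w))"
  using mb_integral_line_unique[of 0 w c "-1/2"] mb_integrable_line[of 0 w c] mb_integrable_half_line[of w]
    mb_integral_half_line[of w] assms by simp

lemma mb_integral_loop_ln:
  assumes "w > 0" "\<bar>e\<bar> = 1" "e * ln w > 0" "-1/8 \<le> c" "c < 0"
  shows "mb_integral (loop_contour e c (-1) 1) (mb_kernel 0 w) = of_real (ln (1 + w))"
    and "mb_integrable (loop_contour e c (-1) 1) (mb_kernel 0 w)"
proof -
  note rd = ray_decay_0[OF assms(1,3), of c]
  have mc: "mb_contour (loop_contour e c (-1) 1)" using assms by (simp add: mb_contour_loop_contour)
  show int: "mb_integrable (loop_contour e c (-1) 1) (mb_kernel 0 w)"
    using mb_integrable_loop[OF assms(1,2) _ _ rd mc] by (metis abs_zero add.right_neutral mult_zero_left zero_less_one)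
  show "mb_integral (loop_contour e c (-1) 1) (mb_kernel 0 w) = of_real (ln (1 + w))"
    using mb_integral_loop_eq_line[OF assms(1,2) _ _ assms(4,5) rd mc int] mb_integral_line_ln[OF assms(1,4,5)] by simp
qed

subsection \<open>Laplace transforms of contour integrals\<close>

lemma mb_kernel_conv_1: "z > 0 \<Longrightarrow> mb_kernel q z t = mb_kernel q 1 t * exp (- t * of_real (ln z))"
  by (simp add: mb_kernel_def of_real_powr_minus_eq_exp)

lemma mb_kernel_conv_0: "mb_kernel q z t = mb_kernel 0 z t * rGamma (1 + of_real q * t)"
  by (simp add: mb_kernel_def)

abbreviation (input) "Laplace_term K q A X s \<equiv>
  mb_integral K (mb_kernel q (A * s powr - q)) * complex_of_real (X * exp (- s * X))"

lemma
  assumes K: "mb_contour K" and A: "A > 0" and X: "X > 0"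
    and pos: "\<And>x. 0 < 1 + q * Re (contour_path K x)"
    and int: "integrable lborel (\<lambda>x. norm (mb_kernel q (A * X powr q) (contour_path K x)) * Gamma (1 + q * Re (contour_path K x)))"
  shows set_integrable_contour_Laplace:
      "set_integrable lborel {0<..} (\<lambda>s. Laplace_term K q A X s)"
    and LINT_contour_Laplace:
      "(LINT s:{0<..}|lborel. Laplace_term K q A X s) =
       mb_integral K (mb_kernel 0 (A * X powr q))"
proof -
  define p d where "p = contour_path K" and "d = contour_deriv K"
  define w where "w = A * X powr q"
  have w: "w > 0" "ln w = ln A + q * ln X" using A X by (simp_all add: w_def ln_mult ln_powr)
  have [measurable]: "(\<lambda>x. mb_kernel q 1 (p x)) \<in> borel_measurable borel"
    unfolding p_def by (rule borel_measurable_mb_kernel_contour[OF K]) simp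
  have [measurable]: "p \<in> borel_measurable borel" "d \<in> borel_measurable borel"
    unfolding p_def d_def by measurable
  define f where "f = (\<lambda>x s. indicator {0<..} s *\<^sub>R (mb_kernel q 1 (p x) * d x *
      exp (- p x * of_real (ln A - q * ln s)) * of_real (X * exp (- s * X))))"
  have meas: "case_prod f \<in> borel_measurable (lborel \<Otimes>\<^sub>M lborel)" unfolding f_def by measurable
  define a where "a = (\<lambda>x. 1 + of_real q * p x)"
  have Re_a: "Re (a x) = 1 + q * Re (p x)" for x by (simp add: a_def)
  have Re_pos: "Re (a x) > 0" for x using pos[of x] unfolding Re_a by (simp add: p_def)
  define \<phi> where "\<phi> = (\<lambda>x. mb_kernel q 1 (p x) * d x * exp (- p x * of_real (ln A)) * of_real X)"
  have fe: "f x s = \<phi> x * (indicator {0<..} s *\<^sub>R (exp ((a x - 1) * of_real (ln s)) * of_real (exp (- s * X))))" for x s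
  proof -
    have "exp (- p x * of_real (ln A - q * ln s)) = exp (- p x * of_real (ln A)) * exp ((a x - 1) * of_real (ln s))"
      unfolding exp_add[symmetric] by (rule arg_cong[where f = exp]) (simp add: a_def algebra_simps)
    thus ?thesis by (simp add: f_def \<phi>_def mult_ac)
  qed
  have i1: "integrable lborel (f x)" for x
    using set_integrable_Gamma_Laplace[OF Re_pos X, of x] unfolding fe set_integrable_def by (intro integrable_mult_right)
  have "norm (f x s) = norm (\<phi> x) * (indicator {0<..} s *\<^sub>R (exp ((Re (a x) - 1) * ln s) * exp (- s * X)))" for x s
    by (simp add: fe norm_mult norm_exp_eq_Re indicator_def)
  hence "(LBINT s. norm (f x s)) = norm (\<phi> x) * (Gamma (Re (a x)) * exp (- Re (a x) * ln X))" for x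
    using LINT_Gamma_Laplace_real[OF Re_pos X, of x] by (simp only: integral_mult_right_zero set_lebesgue_integral_def)
  also have "norm (\<phi> x) * (Gamma (Re (a x)) * exp (- Re (a x) * ln X)) =
      norm (mb_kernel q w (p x)) * Gamma (1 + q * Re (p x))" for x
  proof -
    have "norm (\<phi> x) = norm (mb_kernel q 1 (p x)) * exp (- Re (p x) * ln A) * X"
      using X by (simp add: \<phi>_def norm_mult norm_exp_eq_Re d_def norm_contour_deriv)
    moreover have "exp (- Re (p x) * ln A) * X * exp (- Re (a x) * ln X) = exp (- Re (p x) * ln w)"
    proof -
      have "exp (- Re (p x) * ln A) * exp (ln X) * exp (- Re (a x) * ln X) = exp (- Re (p x) * ln w)"
        unfolding exp_add[symmetric] by (rule arg_cong[where f = exp]) (simp add: Re_a w algebra_simps)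
      thus ?thesis using X by simp
    qed
    moreover have "norm (mb_kernel q w (p x)) = norm (mb_kernel q 1 (p x)) * exp (- Re (p x) * ln w)"
      unfolding mb_kernel_conv_1[OF w(1)] by (simp add: norm_mult norm_exp_eq_Re)
    ultimately show ?thesis by (simp add: Re_a mult_ac)
  qed
  finally have i2: "integrable lborel (\<lambda>x. LBINT s. norm (f x s))"
    using int by (simp add: w_def p_def)
  have outer: "(LBINT s. f x s) = mb_kernel 0 w (p x) * d x" for x
  proof -
    have "(LBINT s. f x s) = \<phi> x * (Gamma (a x) * exp (- a x * of_real (ln X)))"
      using LINT_Gamma_Laplace[OF Re_pos X, of x] unfolding fe integral_mult_right_zero set_lebesgue_integral_def by simp
    also have "\<dots> = mb_kernel 0 1 (p x) * (rGamma (a x) * Gamma (a x)) *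
        (exp (- p x * of_real (ln A)) * exp (of_real (ln X)) * exp (- a x * of_real (ln X))) * d x"
      using X by (simp add: \<phi>_def mb_kernel_conv_0[of q 1] a_def exp_of_real)
    also have "rGamma (a x) * Gamma (a x) = 1"
    proof -
      have "a x \<notin> \<int>\<^sub>\<le>\<^sub>0" using Re_pos[of x] by (auto elim!: nonpos_Ints_cases)
      thus ?thesis by (simp add: rGamma_inverse_Gamma Gamma_eq_zero_iff)
    qed
    also have "exp (- p x * of_real (ln A)) * exp (of_real (ln X)) * exp (- a x * of_real (ln X)) = exp (- p x * of_real (ln w))"
      unfolding exp_add[symmetric] by (rule arg_cong[where f = exp]) (simp add: a_def w algebra_simps)
    also have "mb_kernel 0 1 (p x) * 1 * exp (- p x * of_real (ln w)) = mb_kernel 0 w (p x)"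
      unfolding mb_kernel_conv_1[OF w(1)] by simp
    finally show ?thesis .
  qed
  have inner: "(LBINT x. f x s) = (2 * of_real pi * \<i>) *
      (indicator {0<..} s *\<^sub>R (Laplace_term K q A X s))" for s
  proof (cases "s > 0")
    case True
    have z: "A * s powr - q > 0" "ln (A * s powr - q) = ln A - q * ln s"
      using True A by (simp_all add: ln_mult ln_powr)
    have "f x s = mb_kernel q (A * s powr - q) (p x) * d x * of_real (X * exp (- s * X))" for x
      using True unfolding f_def mb_kernel_conv_1[OF z(1)] z(2) by (simp add: mult_ac)
    hence "(LBINT x. f x s) = (LBINT x. mb_kernel q (A * s powr - q) (p x) * d x) * of_real (X * exp (- s * X))"
      by (simp only: integral_mult_left_zero)
    thus ?thesis using True by (simp add: mb_integral_def contour_lint_def p_def d_def)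
  qed (simp add: f_def)
  note F = Fubini_lborel[OF meas i1 i2]
  have "integrable lborel (\<lambda>s. indicator {0<..} s *\<^sub>R (Laplace_term K q A X s))"
    using integrable_mult_right[OF F(1)[unfolded inner], of "1 / (2 * of_real pi * \<i>)"] by (simp add: mult.assoc[symmetric])
  thus "set_integrable lborel {0<..} (\<lambda>s. Laplace_term K q A X s)"
    by (simp add: set_integrable_def)
  have "(2 * of_real pi * \<i>) * (LINT s:{0<..}|lborel. Laplace_term K q A X s) =
      (2 * of_real pi * \<i>) * mb_integral K (mb_kernel 0 w)"
    using F(2) unfolding inner outer integral_mult_right_zero set_lebesgue_integral_def
    by (simp add: mb_integral_def contour_lint_def p_def d_def)
  thus "(LINT s:{0<..}|lborel. Laplace_term K q A X s) =
       mb_integral K (mb_kernel 0 (A * X powr q))"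
    by (simp add: w_def)
qed

lemma
  assumes q: "\<bar>q\<bar> \<le> 2" and c: "-1/8 \<le> c" "c < 0" and A: "A > 0" and X: "X > 0"
  shows set_integrable_line_Laplace:
      "set_integrable lborel {0<..} (\<lambda>s. Laplace_term (Line c) q A X s)"
    and LINT_line_Laplace:
      "(LINT s:{0<..}|lborel. Laplace_term (Line c) q A X s) =
       of_real (ln (1 + A * X powr q))"
proof -
  have w: "A * X powr q > 0" using A X by simp
  have K: "mb_contour (Line c)" using c by simp
  have "\<bar>q * c\<bar> \<le> 2 * (1/8)" unfolding abs_mult using q c by (intro mult_mono) auto
  hence pos: "0 < 1 + q * Re (contour_path (Line c) x)" for x by (simp add: abs_le_iff)
  have "integrable lborel (\<lambda>x. norm (mb_kernel q (A * X powr q) (contour_path (Line c) x) * contour_deriv (Line c) x))"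
    using mb_integrable_line[OF q w c] unfolding mb_integrable_def by (rule integrable_norm)
  hence int: "integrable lborel (\<lambda>x. norm (mb_kernel q (A * X powr q) (contour_path (Line c) x)) * Gamma (1 + q * Re (contour_path (Line c) x)))"
    by (simp add: norm_mult)
  show "set_integrable lborel {0<..} (\<lambda>s. Laplace_term (Line c) q A X s)"
    by (rule set_integrable_contour_Laplace[OF K A X pos int])
  show "(LINT s:{0<..}|lborel. Laplace_term (Line c) q A X s) =
       of_real (ln (1 + A * X powr q))"
    unfolding LINT_contour_Laplace[OF K A X pos int] by (rule mb_integral_line_ln[OF w c])
qed

lemma
  assumes e: "\<bar>e\<bar> = 1" "q * e = \<bar>q\<bar>" and c: "-1/8 \<le> c" "c < 0" "0 < 1 + q * c"
    and A: "A > 0" and X: "X > 0" and ew: "e * ln (A * X powr q) > 0"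
  defines "K \<equiv> loop_contour e c (-1) 1"
  shows set_integrable_loop_Laplace:
      "set_integrable lborel {0<..} (\<lambda>s. Laplace_term K q A X s)"
    and LINT_loop_Laplace:
      "(LINT s:{0<..}|lborel. Laplace_term K q A X s) =
       of_real (ln (1 + A * X powr q))"
proof -
  let ?w = "A * X powr q" and ?p = "contour_path K"
  have w: "?w > 0" using A X by simp
  have K: "mb_contour K" using c by (simp add: K_def mb_contour_loop_contour)
  have Re: "Re (?p x) = c + e * loop_depth (-1) 1 x" for x
    by (simp add: K_def contour_path_loop_contour[OF e(1)])
  have Im: "\<bar>Im (?p x)\<bar> \<le> 1" for x
    by (simp add: K_def contour_path_loop_contour[OF e(1)] abs_if)
  have mono: "1 + q * c \<le> 1 + q * Re (?p x)" for x
  proof -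
    have "0 \<le> (q * e) * loop_depth (-1) 1 x" using e(2) loop_depth_nonneg by simp
    thus ?thesis unfolding Re by (simp add: algebra_simps)
  qed
  have pos: "0 < 1 + q * Re (?p x)" for x using mono[of x] c by linarith
  have int: "integrable lborel (\<lambda>x. norm (mb_kernel q ?w (?p x)) * Gamma (1 + q * Re (?p x)))"
  proof (rule Bochner_Integration.integrable_bound)
    have "integrable lborel (\<lambda>x. norm (mb_kernel 0 ?w (?p x) * contour_deriv K x))"
      using mb_integral_loop_ln(2)[OF w e(1) ew c(1,2)] unfolding mb_integrable_def K_def by (rule integrable_norm)
    thus "integrable lborel (\<lambda>x. gamma_ratio (1 + q * c) q * norm (mb_kernel 0 ?w (?p x)))"
      by (intro integrable_mult_right) (simp add: norm_mult norm_contour_deriv)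
    have [measurable]: "(\<lambda>x. mb_kernel q ?w (?p x)) \<in> borel_measurable borel"
      by (rule borel_measurable_mb_kernel_contour[OF K w])
    have "continuous_on UNIV (\<lambda>x. Gamma (1 + q * Re (?p x)))"
    proof (rule continuous_on_compose2[of "{0<..}" Gamma])
      show "continuous_on {0<..} (Gamma :: real \<Rightarrow> real)"
        by (intro continuous_at_imp_continuous_on ballI isCont_Gamma continuous_ident) (auto dest: nonpos_Ints_nonpos)
      show "continuous_on UNIV (\<lambda>x. 1 + q * Re (?p x))"
        by (intro continuous_intros continuous_contour_path)
    qed (use pos in auto)
    hence [measurable]: "(\<lambda>x. Gamma (1 + q * Re (?p x))) \<in> borel_measurable borel"
      by (rule borel_measurable_continuous_onI)
    show "(\<lambda>x. norm (mb_kernel q ?w (?p x)) * Gamma (1 + q * Re (?p x))) \<in> borel_measurable lborel"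
      by measurable
    have "norm (mb_kernel q ?w (?p x)) * Gamma (1 + q * Re (?p x)) \<le>
        gamma_ratio (1 + q * c) q * norm (mb_kernel 0 ?w (?p x))" for x
    proof -
      define t where "t = ?p x"
      have "1 + of_real q * t = Complex (1 + q * Re t) (q * Im t)" by (simp add: complex_eq_iff)
      hence "norm (rGamma (1 + of_real q * t)) * Gamma (1 + q * Re t) = gamma_ratio (1 + q * Re t) (q * Im t)"
        by (simp add: gamma_ratio_def)
      also have "\<dots> \<le> gamma_ratio (1 + q * c) q"
        using c(3) mono[of x] Im[of x] by (intro gamma_ratio_mono) (auto simp: t_def abs_mult mult_left_le)
      finally have "norm (mb_kernel 0 ?w t) * (norm (rGamma (1 + of_real q * t)) * Gamma (1 + q * Re t)) \<le>
          norm (mb_kernel 0 ?w t) * gamma_ratio (1 + q * c) q" by (rule mult_left_mono) simp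
      thus ?thesis unfolding t_def[symmetric] mb_kernel_conv_0[of q] by (simp add: norm_mult mult_ac)
    qed
    moreover have "0 \<le> norm (mb_kernel q ?w (?p x)) * Gamma (1 + q * Re (?p x))" for x
      using pos[of x] by (intro mult_nonneg_nonneg less_imp_le[OF Gamma_real_pos]) auto
    ultimately show "AE x in lborel. norm (norm (mb_kernel q ?w (?p x)) * Gamma (1 + q * Re (?p x))) \<le>
        norm (gamma_ratio (1 + q * c) q * norm (mb_kernel 0 ?w (?p x)))"
      by (intro AE_I2) (simp only: real_norm_def abs_of_nonneg, meson abs_ge_self order_trans)
  qed
  show "set_integrable lborel {0<..} (\<lambda>s. Laplace_term K q A X s)"
    by (rule set_integrable_contour_Laplace[OF K A X pos int])
  show "(LINT s:{0<..}|lborel. Laplace_term K q A X s) =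
       of_real (ln (1 + A * X powr q))"
    by (rule trans[OF LINT_contour_Laplace[OF K A X pos int]])
      (unfold K_def, rule mb_integral_loop_ln(1)[OF w e(1) ew c(1,2)])
qed

lemma norm_exp_minus_1_le: "norm (exp w - 1) \<le> norm w * exp (norm w)" for w :: complex
proof -
  have "norm (exp w - exp 0) \<le> exp (norm w) * norm (w - 0)"
  proof (rule field_differentiable_bound[of "closed_segment 0 w" exp exp])
    fix z assume "z \<in> closed_segment 0 w"
    hence "norm z \<le> norm w" by (metis diff_zero norm_minus_commute segment_bound1)
    moreover have "norm (exp z) \<le> exp (norm z)" by (rule norm_exp)
    ultimately show "norm (exp z) \<le> exp (norm w)" by (meson exp_le_cancel_iff order_trans)
  qed (auto intro: derivative_eq_intros)
  thus ?thesis by (simp add: mult.commute)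
qed

lemma Laplace_has_field_derivative:
  fixes \<phi> :: "'a \<Rightarrow> complex" and Y :: "'a \<Rightarrow> real"
  assumes [measurable]: "\<phi> \<in> borel_measurable N" "Y \<in> borel_measurable N"
    and Y: "\<And>x. x \<in> space N \<Longrightarrow> Y x \<ge> 0"
    and int: "integrable N (\<lambda>x. norm (\<phi> x) * exp (- \<sigma> * Y x))" and z: "Re z > \<sigma>"
  shows "((\<lambda>z. \<integral>x. \<phi> x * exp (- z * of_real (Y x)) \<partial>N) has_field_derivative
      (\<integral>x. \<phi> x * (- of_real (Y x) * exp (- z * of_real (Y x))) \<partial>N)) (at z)"
proof -
  have intz: "integrable N (\<lambda>x. \<phi> x * exp (- z' * of_real (Y x)))" if "Re z' \<ge> \<sigma>" for z'
  proof (rule Bochner_Integration.integrable_bound[OF int])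
    show "AE x in N. norm (\<phi> x * exp (- z' * of_real (Y x))) \<le> norm (norm (\<phi> x) * exp (- \<sigma> * Y x))"
      using that Y by (intro AE_I2) (auto simp: norm_mult norm_exp_eq_Re intro!: mult_left_mono mult_right_mono)
  qed measurable
  define \<delta> where "\<delta> = (Re z - \<sigma>) / 2"
  have \<delta>: "\<delta> > 0" using z by (simp add: \<delta>_def)
  define D where "D = (\<integral>x. \<phi> x * (- of_real (Y x) * exp (- z * of_real (Y x))) \<partial>N)"
  define Q where "Q = (\<lambda>h x. \<phi> x * exp (- z * of_real (Y x)) * ((exp (- h * of_real (Y x)) - 1) / h))"
  have quot: "((\<integral>x. \<phi> x * exp (- (z + h) * of_real (Y x)) \<partial>N) - (\<integral>x. \<phi> x * exp (- z * of_real (Y x)) \<partial>N)) / h = (\<integral>x. Q h x \<partial>N)"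
    if "h \<noteq> 0" "norm h \<le> \<delta>" for h
  proof -
    have "Re (z + h) \<ge> \<sigma>" using that(2) abs_Re_le_cmod[of h] \<delta> by (simp add: \<delta>_def field_simps)
    hence "((\<integral>x. \<phi> x * exp (- (z + h) * of_real (Y x)) \<partial>N) - (\<integral>x. \<phi> x * exp (- z * of_real (Y x)) \<partial>N)) / h =
        (\<integral>x. (\<phi> x * exp (- (z + h) * of_real (Y x)) - \<phi> x * exp (- z * of_real (Y x))) / h \<partial>N)"
      using z intz[of "z + h"] intz[of z]
      by (simp only: Bochner_Integration.integral_diff[symmetric] less_imp_le integral_divide_zero)
    also have "(\<lambda>x. (\<phi> x * exp (- (z + h) * of_real (Y x)) - \<phi> x * exp (- z * of_real (Y x))) / h) = Q h"
    proof
      fix x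
      have "exp (- (z + h) * of_real (Y x)) = exp (- z * of_real (Y x)) * exp (- h * of_real (Y x))"
        unfolding exp_add[symmetric] by (rule arg_cong[where f = exp]) (simp add: algebra_simps)
      thus "(\<phi> x * exp (- (z + h) * of_real (Y x)) - \<phi> x * exp (- z * of_real (Y x))) / h = Q h x"
        by (simp add: Q_def algebra_simps diff_divide_distrib)
    qed
    finally show ?thesis .
  qed
  have bnd: "norm (Q h x) \<le> norm (\<phi> x) * exp (- \<sigma> * Y x) * (1 / \<delta>)"
    if "h \<noteq> 0" "norm h \<le> \<delta>" "x \<in> space N" for h x
  proof -
    have Yx: "Y x \<ge> 0" by (rule Y[OF that(3)])
    have "norm (exp (- h * of_real (Y x)) - 1) \<le> norm (- h * of_real (Y x)) * exp (norm (- h * of_real (Y x)))"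
      by (rule norm_exp_minus_1_le)
    also have "\<dots> \<le> (norm h * Y x) * exp (\<delta> * Y x)"
      using Yx that by (intro mult_mono) (auto simp: norm_mult intro!: mult_right_mono)
    finally have "norm ((exp (- h * of_real (Y x)) - 1) / h) \<le> Y x * exp (\<delta> * Y x)"
      using that(1) by (simp add: norm_divide field_simps)
    hence "norm (Q h x) \<le> norm (\<phi> x) * exp (- Re z * Y x) * (Y x * exp (\<delta> * Y x))"
      unfolding Q_def norm_mult norm_exp_eq_Re by (intro mult_mono) auto
    also have "\<dots> = norm (\<phi> x) * exp (- \<sigma> * Y x) * (Y x * exp (- \<delta> * Y x))"
    proof -
      have "exp (- Re z * Y x) * exp (\<delta> * Y x) = exp (- \<sigma> * Y x) * exp (- \<delta> * Y x)"
        unfolding exp_add[symmetric] by (rule arg_cong[where f = exp]) (simp add: \<delta>_def field_simps)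
      thus ?thesis by (simp add: mult_ac)
    qed
    also have "\<dots> \<le> norm (\<phi> x) * exp (- \<sigma> * Y x) * (1 / \<delta>)"
    proof (intro mult_left_mono)
      have "\<delta> * Y x \<le> exp (\<delta> * Y x)" using exp_ge_add_one_self[of "\<delta> * Y x"] by linarith
      thus "Y x * exp (- \<delta> * Y x) \<le> 1 / \<delta>" using \<delta> by (simp add: exp_minus field_simps)
    qed auto
    finally show ?thesis .
  qed
  have "((\<lambda>h. ((\<integral>x. \<phi> x * exp (- (z + h) * of_real (Y x)) \<partial>N) - (\<integral>x. \<phi> x * exp (- z * of_real (Y x)) \<partial>N)) / h) \<longlongrightarrow> D) (at 0)"
    unfolding tendsto_at_iff_sequentially o_def
  proof (intro allI impI)
    fix h :: "nat \<Rightarrow> complex" assume h0: "\<forall>i. h i \<in> UNIV - {0}" and h: "h \<longlonglongrightarrow> 0"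
    have hn: "h i \<noteq> 0" for i using h0 by auto
    have "eventually (\<lambda>i. norm (h i) < \<delta>) sequentially"
      using tendsto_norm[OF h] \<delta> by (intro order_tendstoD(2)[of _ 0]) auto
    then obtain n0 where n0: "\<And>i. i \<ge> n0 \<Longrightarrow> norm (h i) \<le> \<delta>"
      unfolding eventually_sequentially by (meson less_imp_le)
    have "(\<lambda>i. \<integral>x. Q (h (i + n0)) x \<partial>N) \<longlonglongrightarrow> D" unfolding D_def
    proof (rule integral_dominated_convergence)
      show "integrable N (\<lambda>x. norm (\<phi> x) * exp (- \<sigma> * Y x) * (1 / \<delta>))" using int by simp
      show "AE x in N. norm (Q (h (i + n0)) x) \<le> norm (\<phi> x) * exp (- \<sigma> * Y x) * (1 / \<delta>)" for i
        using bnd hn n0 by (intro AE_I2) auto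
      show "AE x in N. (\<lambda>i. Q (h (i + n0)) x) \<longlonglongrightarrow> \<phi> x * (- of_real (Y x) * exp (- z * of_real (Y x)))"
      proof (rule AE_I2)
        fix x
        have "((\<lambda>h. exp (- h * complex_of_real (Y x))) has_field_derivative - of_real (Y x)) (at 0)"
          by (auto intro!: derivative_eq_intros)
        hence "((\<lambda>h. (exp (- h * complex_of_real (Y x)) - 1) / h) \<longlongrightarrow> - of_real (Y x)) (at 0)"
          by (simp add: DERIV_def)
        hence "(\<lambda>i. (exp (- h (i + n0) * complex_of_real (Y x)) - 1) / h (i + n0)) \<longlonglongrightarrow> - of_real (Y x)"
          by (rule filterlim_compose) (use h hn in \<open>auto simp: filterlim_at intro!: LIMSEQ_ignore_initial_segment\<close>)
        from tendsto_mult[OF tendsto_const[of "\<phi> x * exp (- z * of_real (Y x))"] this]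
        show "(\<lambda>i. Q (h (i + n0)) x) \<longlonglongrightarrow> \<phi> x * (- of_real (Y x) * exp (- z * of_real (Y x)))"
          by (simp add: Q_def mult_ac)
      qed
    qed (unfold Q_def, measurable)
    hence "(\<lambda>i. ((\<integral>x. \<phi> x * exp (- (z + h (i + n0)) * of_real (Y x)) \<partial>N) - (\<integral>x. \<phi> x * exp (- z * of_real (Y x)) \<partial>N)) / h (i + n0)) \<longlonglongrightarrow> D"
      using quot hn n0 by simp
    thus "(\<lambda>i. ((\<integral>x. \<phi> x * exp (- (z + h i) * of_real (Y x)) \<partial>N) - (\<integral>x. \<phi> x * exp (- z * of_real (Y x)) \<partial>N)) / h i) \<longlonglongrightarrow> D"
      by (rule LIMSEQ_offset)
  qed
  thus ?thesis unfolding DERIV_def D_def .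
qed

text \<open>
  On \<open>Re t = c < 0\<close> the integral is of size \<open>z powr (-c) / \<bar>c\<bar>\<close>; the bound comes from \<open>c = -1/8\<close> if \<open>z < 1\<close> and
  from \<open>c = -1 / (8 + ln z)\<close> if \<open>z \<ge> 1\<close>.
\<close>

lemma norm_fox_H_le:
  assumes "\<bar>q\<bar> \<le> 2"
  obtains K where "K \<ge> 0"
    and "\<And>z. z > 0 \<Longrightarrow> norm (cap_H q z) \<le> K * (1 + ln (1 + z))"
proof -
  let ?I = "\<lambda>z c. \<integral>x. mb_kernel q z (contour_path (Line c) x) * contour_deriv (Line c) x \<partial>lborel"
  obtain K where K: "K > 0" and Kb: "\<And>z c y. z > 0 \<Longrightarrow> -1/8 \<le> c \<Longrightarrow> c < 0 \<Longrightarrow>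
      norm (mb_kernel q z (Complex c y)) \<le> K * z powr (- c) * line_majorant c y"
    using norm_mb_kernel_line_le assms by metis
  obtain A where A: "\<And>c. c \<noteq> 0 \<Longrightarrow> integrable lborel (line_majorant c)"
    "\<And>c. c \<noteq> 0 \<Longrightarrow> (LBINT y. line_majorant c y) = pi / \<bar>c\<bar> + A"
    using integrable_line_majorant by metis
  have bnd: "norm (cap_H q z) \<le> K * z powr (- c) * (pi / \<bar>c\<bar> + \<bar>A\<bar>)"
    if z: "z > 0" and c: "-1/8 \<le> c" "c < 0" for z c
  proof -
    have c0: "c \<noteq> 0" using c by simp
    have "norm (?I z c) \<le>
        (LBINT y. K * z powr (- c) * line_majorant c y)"
    proof (rule Bochner_Integration.integral_norm_bound_integral)
      show "integrable lborel (\<lambda>x. mb_kernel q z (contour_path (Line c) x) * contour_deriv (Line c) x)"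
        using mb_integrable_line[OF assms z c] by (simp add: mb_integrable_def)
      show "integrable lborel (\<lambda>y. K * z powr (- c) * line_majorant c y)"
        by (intro integrable_mult_right A(1) c0)
    qed (use Kb[OF z c] in \<open>simp add: norm_mult\<close>)
    also have "\<dots> = K * z powr (- c) * (pi / \<bar>c\<bar> + A)"
      unfolding integral_mult_right_zero A(2)[OF c0] ..
    also have "\<dots> \<le> K * z powr (- c) * (pi / \<bar>c\<bar> + \<bar>A\<bar>)"
      using K by (intro mult_left_mono) auto
    finally have *: "norm (?I z c) \<le>
      K * z powr (- c) * (pi / \<bar>c\<bar> + \<bar>A\<bar>)" .
    have "norm (cap_H q z) = 1 / (2 * pi) *
        norm (?I z c)"
      unfolding fox_H_eq_line[OF assms z c] mb_integral_def contour_lint_def by (simp add: norm_mult norm_divide)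
    also have "\<dots> \<le> 1 * norm (?I z c)"
      using pi_ge_two by (intro mult_right_mono) (auto simp: field_simps)
    finally show ?thesis using * by simp
  qed
  define K' where "K' = K * exp 1 * (8 * pi + \<bar>A\<bar>)"
  have K': "K' \<ge> 0" using K by (simp add: K'_def)
  have "norm (cap_H q z) \<le> K' * (1 + ln (1 + z))" if z: "z > 0" for z
  proof (cases "z \<ge> 1")
    case False
    have "norm (cap_H q z) \<le> K * z powr (1/8) * (pi / \<bar>-1/8\<bar> + \<bar>A\<bar>)"
      using bnd[OF z, of "-1/8"] by simp
    also have "\<dots> \<le> K * exp 1 * (8 * pi + \<bar>A\<bar>)"
    proof (intro mult_mono)
      have "z powr (1/8) \<le> 1" using False z by (intro powr_le1) auto
      also have "1 \<le> exp (1::real)" by simp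
      finally show "z powr (1/8) \<le> exp 1" .
    qed (use K in auto)
    also have "\<dots> = K' * 1" by (simp add: K'_def)
    also have "\<dots> \<le> K' * (1 + ln (1 + z))" using K' z by (intro mult_left_mono) auto
    finally show ?thesis .
  next
    case True
    define l where "l = ln z"
    have l: "l \<ge> 0" using True by (simp add: l_def)
    have "norm (cap_H q z) \<le> K * z powr (1 / (8 + l)) * (pi / \<bar>- 1 / (8 + l)\<bar> + \<bar>A\<bar>)"
      using bnd[OF z, of "- 1 / (8 + l)"] l by (simp add: field_simps)
    also have "pi / \<bar>- 1 / (8 + l)\<bar> = pi * (8 + l)" using l by simp
    also have "K * z powr (1 / (8 + l)) * (pi * (8 + l) + \<bar>A\<bar>) \<le> K * exp 1 * ((8 * pi + \<bar>A\<bar>) * (1 + l))"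
    proof (intro mult_mono)
      have "1 / (8 + l) * l \<le> 1" using l by (simp add: field_simps)
      thus "z powr (1 / (8 + l)) \<le> exp 1" using z by (simp add: powr_def l_def)
      have "pi * l \<le> 8 * pi * l" using l by simp
      moreover have "0 \<le> \<bar>A\<bar> * l" using l by simp
      ultimately show "pi * (8 + l) + \<bar>A\<bar> \<le> (8 * pi + \<bar>A\<bar>) * (1 + l)" by (simp add: algebra_simps)
    qed (use K l in auto)
    also have "\<dots> = K' * (1 + l)" by (simp add: K'_def)
    also have "\<dots> \<le> K' * (1 + ln (1 + z))" using K' z by (intro mult_left_mono) (auto simp: l_def)
    finally show ?thesis .
  qed
  thus ?thesis using that K' by blast
qed

lemma abs_ln_le_powr:
  fixes u :: real
  assumes "u > 0"
  shows "\<bar>ln u\<bar> \<le> 2 * (exp (1/2 * ln u) + exp (- (1/2) * ln u))"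
proof -
  define l a b where "l = ln u" and "a = exp (1/2 * l)" and "b = exp (- (1/2) * l)"
  have "1 + 1/2 * l \<le> a" "1 + - (1/2) * l \<le> b" "0 \<le> a" "0 \<le> b"
    unfolding a_def b_def by (rule exp_ge_add_one_self exp_ge_zero)+
  hence "\<bar>l\<bar> \<le> 2 * (a + b)" by (simp add: abs_le_iff)
  thus ?thesis by (simp only: l_def a_def b_def)
qed

lemma nn_integral_fox_H_Laplace_le:
  assumes q: "\<bar>q\<bar> \<le> 2" and A: "A > 0"
  obtains K where "K \<ge> 0"
    and "\<And>X. X > 0 \<Longrightarrow> (\<integral>\<^sup>+s. ennreal (indicator {0<..} s * norm (cap_H q (A * s powr - q)) * (X * exp (- s * X))) \<partial>lborel) \<le> ennreal (K * (1 + ln (1 + A * X powr q)))"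
proof -
  let ?g = "\<lambda>s. cap_H q (A * s powr - q)"
  obtain K where K: "K \<ge> 0" "\<And>z. z > 0 \<Longrightarrow> norm (cap_H q z) \<le> K * (1 + ln (1 + z))"
    using norm_fox_H_le[OF q] by metis
  define G where "G = Gamma (3/2 :: real) + Gamma (1/2 :: real)"
  have G: "G \<ge> 0" by (simp add: G_def add_nonneg_nonneg less_imp_le[OF Gamma_real_pos])
  have "(\<integral>\<^sup>+s. ennreal (indicator {0<..} s * norm (?g s) * (X * exp (- s * X))) \<partial>lborel) \<le> ennreal (K * (2 + 4 * G) * (1 + ln (1 + A * X powr q)))" if X: "X > 0" for X
  proof -
    define w where "w = A * X powr q"
    have w: "w > 0" using A X by (simp add: w_def)
    define m where "m = (\<lambda>s. K * (2 + ln (1 + w)) * X * (indicator {0<..} s *\<^sub>R (exp ((1 - 1) * ln s) * exp (- s * X))) +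
       K * 4 * exp (3/2 * ln X) * (indicator {0<..} s *\<^sub>R (exp ((3/2 - 1) * ln s) * exp (- s * X))) +
       K * 4 * exp (1/2 * ln X) * (indicator {0<..} s *\<^sub>R (exp ((1/2 - 1) * ln s) * exp (- s * X))))"
    have le: "indicator {0<..} s * norm (?g s) * (X * exp (- s * X)) \<le> m s" for s
    proof (cases "s > 0")
      case True
      define u where "u = s * X"
      have u: "u > 0" "ln u = ln s + ln X" using True X by (simp_all add: u_def ln_mult)
      have z: "A * s powr - q > 0" "A * s powr - q = w * u powr - q"
        using A True X by (simp_all add: w_def u_def powr_mult powr_minus field_simps)
      have "ln (1 + A * s powr - q) \<le> ln ((1 + w) * (1 + u powr - q))"
        unfolding z(2) using w u(1) by (subst ln_le_cancel_iff) (auto simp: algebra_simps add_pos_pos)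
      also have "\<dots> = ln (1 + w) + ln (1 + u powr - q)"
        using w u(1) by (intro ln_mult_pos) (auto simp: add_pos_pos)
      also have "ln (1 + u powr - q) \<le> ln (exp (2 * \<bar>ln u\<bar>) + exp (2 * \<bar>ln u\<bar>))"
      proof -
        have "u powr - q \<le> exp (2 * \<bar>ln u\<bar>)"
        proof -
          have "- q * ln u \<le> \<bar>q\<bar> * \<bar>ln u\<bar>" by (metis abs_ge_self abs_minus_cancel abs_mult)
          also have "\<dots> \<le> 2 * \<bar>ln u\<bar>" using q by (intro mult_right_mono) auto
          finally show ?thesis using u(1) by (simp add: powr_def)
        qed
        moreover have "1 \<le> exp (2 * \<bar>ln u\<bar>)" by simp
        ultimately have "1 + u powr - q \<le> exp (2 * \<bar>ln u\<bar>) + exp (2 * \<bar>ln u\<bar>)" by linarith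
        thus ?thesis by (subst ln_le_cancel_iff) (auto intro: add_pos_nonneg)
      qed
      also have "ln (exp (2 * \<bar>ln u\<bar>) + exp (2 * \<bar>ln u\<bar>)) = ln 2 + 2 * \<bar>ln u\<bar>"
        by (simp add: ln_mult flip: mult_2)
      also have "ln 2 \<le> (1::real)" using ln_add_one_self_le_self[of 1] by simp
      finally have "1 + ln (1 + A * s powr - q) \<le> 2 + ln (1 + w) + 2 * \<bar>ln u\<bar>" by simp
      also have "\<dots> \<le> 2 + ln (1 + w) + 4 * (exp (1/2 * ln u) + exp (- (1/2) * ln u))"
        using abs_ln_le_powr[OF u(1)] by simp
      finally have "K * (1 + ln (1 + A * s powr - q)) \<le> K * (2 + ln (1 + w) + 4 * (exp (1/2 * ln u) + exp (- (1/2) * ln u)))"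
        by (intro mult_left_mono K(1))
      with K(2)[OF z(1)] have "norm (?g s) \<le>
          K * (2 + ln (1 + w) + 4 * (exp (1/2 * ln u) + exp (- (1/2) * ln u)))" by linarith
      hence "norm (?g s) * (X * exp (- s * X)) \<le>
          K * (2 + ln (1 + w) + 4 * (exp (1/2 * ln u) + exp (- (1/2) * ln u))) * (X * exp (- s * X))"
        using X by (intro mult_right_mono) auto
      also have "\<dots> = m s"
      proof -
        have f1: "exp (1/2 * ln u) * X = exp (3/2 * ln X) * exp ((3/2 - 1) * ln s)"
        proof -
          have "exp (1/2 * ln u) * exp (ln X) = exp (3/2 * ln X) * exp ((3/2 - 1) * ln s)"
            unfolding exp_add[symmetric] u(2) by (rule arg_cong[where f = exp]) (simp add: field_simps)
          thus ?thesis using X by simp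
        qed
        have f2: "exp (- (1/2) * ln u) * X = exp (1/2 * ln X) * exp ((1/2 - 1) * ln s)"
        proof -
          have "exp (- (1/2) * ln u) * exp (ln X) = exp (1/2 * ln X) * exp ((1/2 - 1) * ln s)"
            unfolding exp_add[symmetric] u(2) by (rule arg_cong[where f = exp]) (simp add: field_simps)
          thus ?thesis using X by simp
        qed
        have alg: "K * (P + 4 * (a + b)) * (X * E) = K * P * X * E + K * 4 * (a * X) * E + K * 4 * (b * X) * E" for P a b E
          by (simp add: algebra_simps)
        show ?thesis unfolding alg f1 f2 using True by (simp add: m_def mult_ac)
      qed
      finally show ?thesis using True by simp
    qed (simp add: m_def)
    note S = set_integrable_Gamma_Laplace_real[OF _ X, unfolded set_integrable_def]
    note V = LINT_Gamma_Laplace_real[OF _ X, unfolded set_lebesgue_integral_def]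
    define a where "a = (\<lambda>r s. indicator {0<..} s *\<^sub>R (exp ((r - 1) * ln s) * exp (- s * X)))"
    have ai: "integrable lborel (\<lambda>s. C * a r s)" "(LBINT s. C * a r s) = C * (Gamma r * exp (- r * ln X))"
      if "r > 0" for r C :: real
      unfolding a_def integral_mult_right_zero using S[OF that] V[OF that] by simp_all
    have ma: "m = (\<lambda>s. K * (2 + ln (1 + w)) * X * a 1 s + K * 4 * exp (3/2 * ln X) * a (3/2) s +
        K * 4 * exp (1/2 * ln X) * a (1/2) s)" by (simp only: m_def a_def)
    have m_int: "integrable lborel m"
      unfolding ma by (intro Bochner_Integration.integrable_add ai(1)) auto
    have "integral\<^sup>L lborel m = K * (2 + ln (1 + w)) * X * (Gamma 1 * exp (- 1 * ln X)) +
        K * 4 * exp (3/2 * ln X) * (Gamma (3/2) * exp (- (3/2) * ln X)) +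
        K * 4 * exp (1/2 * ln X) * (Gamma (1/2) * exp (- (1/2) * ln X))"
    proof -
      have r: "0 < (1::real)" "0 < (3/2::real)" "0 < (1/2::real)" by auto
      show ?thesis
        unfolding ma Bochner_Integration.integral_add[OF Bochner_Integration.integrable_add[OF ai(1)[OF r(1)] ai(1)[OF r(2)]] ai(1)[OF r(3)]]
          Bochner_Integration.integral_add[OF ai(1)[OF r(1)] ai(1)[OF r(2)]] ai(2)[OF r(1)] ai(2)[OF r(2)] ai(2)[OF r(3)] ..
    qed
    also have "\<dots> = K * (2 + ln (1 + w)) + K * 4 * G"
      using X by (simp add: G_def exp_minus field_simps)
    also have "\<dots> \<le> K * (2 + 4 * G) * (1 + ln (1 + w))"
    proof -
      have "0 \<le> ln (1 + w)" using w by simp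
      hence "0 \<le> (1 + 4 * G) * ln (1 + w)" using G by simp
      hence "2 + ln (1 + w) + 4 * G \<le> (2 + 4 * G) * (1 + ln (1 + w))" by (simp add: algebra_simps)
      hence "K * (2 + ln (1 + w) + 4 * G) \<le> K * ((2 + 4 * G) * (1 + ln (1 + w)))" by (rule mult_left_mono[OF _ K(1)])
      thus ?thesis by (simp add: algebra_simps)
    qed
    finally have mval: "integral\<^sup>L lborel m \<le> K * (2 + 4 * G) * (1 + ln (1 + w))" .
    have m0: "m s \<ge> 0" for s
      unfolding m_def using K(1) X w by (intro add_nonneg_nonneg mult_nonneg_nonneg scaleR_nonneg_nonneg) auto
    have "(\<integral>\<^sup>+s. ennreal (indicator {0<..} s * norm (?g s) * (X * exp (- s * X))) \<partial>lborel) \<le> (\<integral>\<^sup>+s. ennreal (m s) \<partial>lborel)"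
      by (intro nn_integral_mono ennreal_leI le)
    also have "\<dots> = ennreal (integral\<^sup>L lborel m)"
      by (rule nn_integral_eq_integral[OF m_int]) (simp add: m0)
    also have "\<dots> \<le> ennreal (K * (2 + 4 * G) * (1 + ln (1 + w)))" by (rule ennreal_leI[OF mval])
    finally show ?thesis by (simp add: w_def)
  qed
  thus ?thesis using that[of "K * (2 + 4 * G)"] K(1) G by simp
qed

subsection \<open>Analytic continuation and the capacity formula\<close>

lemma set_integrable_imp_measurable_quotient:
  fixes g :: "real \<Rightarrow> complex" and c :: "real \<Rightarrow> real"
  assumes "set_integrable lborel S (\<lambda>s. g s * of_real (c s))" "\<And>s. s \<in> S \<Longrightarrow> c s \<noteq> 0" "c \<in> borel_measurable borel"
  shows "(\<lambda>s. indicator S s *\<^sub>R g s) \<in> borel_measurable borel"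
proof -
  have [measurable]: "(\<lambda>s. indicator S s *\<^sub>R (g s * of_real (c s))) \<in> borel_measurable borel"
    using assms(1) unfolding set_integrable_def by (auto dest: borel_measurable_integrable)
  note [measurable] = assms(3)
  have "(\<lambda>s. indicator S s *\<^sub>R g s) = (\<lambda>s. (indicator S s *\<^sub>R (g s * of_real (c s))) * of_real (1 / c s))"
    using assms(2) by (auto simp: indicator_def)
  thus ?thesis by simp
qed

text \<open>
  Continuing \<open>exp (X \<Lambda>(X)) = 1 + A X\<^sup>q\<close>, where \<open>\<Lambda>\<close> is the Laplace transform of \<open>g\<close>, rather than the identity
  itself avoids the branch points of \<open>ln (1 + A X\<^sup>q)\<close> in the half-plane. The branch is then fixed by
  continuity along the real axis.
\<close>

lemma Laplace_continuation:
  fixes g :: "real \<Rightarrow> complex"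
  assumes A: "A > 0" and X0: "X0 > 0"
    and int: "set_integrable lborel {0<..} (\<lambda>s. g s * of_real (X0 * exp (- s * X0)))"
    and large: "\<And>X. X > Y0 \<Longrightarrow> (LINT s:{0<..}|lborel. g s * of_real (X * exp (- s * X))) = of_real (ln (1 + A * X powr q))"
  shows "(LINT s:{0<..}|lborel. g s * of_real (X0 * exp (- s * X0))) = of_real (ln (1 + A * X0 powr q))"
proof -
  define \<phi> where "\<phi> = (\<lambda>s. indicator {0<..} s *\<^sub>R g s)"
  define Y where "Y = (\<lambda>s::real. max 0 s)"
  have \<phi>_meas [measurable]: "\<phi> \<in> borel_measurable lborel"
    unfolding \<phi>_def using set_integrable_imp_measurable_quotient[OF int] X0 by simp
  have Y_meas [measurable]: "Y \<in> borel_measurable lborel" unfolding Y_def by measurable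
  have int\<phi>: "integrable lborel (\<lambda>s. norm (\<phi> s) * exp (- X0 * Y s))"
  proof -
    have "integrable lborel (\<lambda>s. norm (indicator {0<..} s *\<^sub>R (g s * of_real (X0 * exp (- s * X0)))) * (1 / X0))"
      using int unfolding set_integrable_def by (intro integrable_mult_left integrable_norm)
    also have "(\<lambda>s. norm (indicator {0<..} s *\<^sub>R (g s * of_real (X0 * exp (- s * X0)))) * (1 / X0)) =
        (\<lambda>s. norm (\<phi> s) * exp (- X0 * Y s))"
      using X0 by (auto simp: \<phi>_def Y_def indicator_def norm_mult mult_ac)
    finally show ?thesis .
  qed
  define F where "F = (\<lambda>z. LBINT s. \<phi> s * exp (- z * of_real (Y s)))"
  define S where "S = {z. Re z > X0}"
  have F: "\<exists>F'. (F has_field_derivative F') (at z)" if "z \<in> S" for z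
    unfolding F_def using that Laplace_has_field_derivative[OF \<phi>_meas Y_meas _ int\<phi>, of z]
    by (auto simp: S_def Y_def)
  have F_real: "of_real X * F (of_real X) = (LINT s:{0<..}|lborel. g s * of_real (X * exp (- s * X)))" for X
    unfolding F_def set_lebesgue_integral_def integral_mult_right_zero[symmetric]
    by (intro Bochner_Integration.integral_cong) (auto simp: \<phi>_def Y_def indicator_def mult_ac simp flip: exp_of_real)
  have open_S: "open S" unfolding S_def by (rule open_halfspace_Re_gt)
  have conn_S: "connected S" unfolding S_def by (intro convex_connected convex_halfspace_Re_gt)
  have F_hol: "F holomorphic_on S"
    using F open_S by (auto simp: holomorphic_on_open)
  define E where "E = (\<lambda>z. exp (z * F z) - (1 + of_real A * z powr of_real q))"
  have E_hol: "E holomorphic_on S"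
    unfolding E_def using X0 by (intro holomorphic_intros F_hol) (auto simp: S_def complex_nonpos_Reals_iff)
  define b where "b = max X0 Y0"
  have powr: "1 + of_real A * of_real X powr of_real q = complex_of_real (1 + A * X powr q)" if "X > 0" for X
    using that by (simp add: powr_of_real)
  have pos: "1 + A * X powr q > 0" for X using A by (simp add: add_pos_nonneg)
  have E0: "E (of_real X) = 0" if "X > b" for X
  proof -
    have "exp (of_real X * F (of_real X)) = complex_of_real (1 + A * X powr q)"
      unfolding F_real using large[of X] that pos[of X] by (simp add: b_def exp_of_real)
    moreover have "X > 0" using that X0 by (auto simp: b_def)
    ultimately show ?thesis unfolding E_def powr[OF \<open>X > 0\<close>] by simp
  qed
  have E_S: "E z = 0" if "z \<in> S" for z
  proof (rule analytic_continuation[OF E_hol open_S conn_S _ _ _ _ that])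
    show "of_real ` {b<..} \<subseteq> S" by (auto simp: S_def b_def)
    show "of_real (b + 1) \<in> S" by (auto simp: S_def b_def)
    show "complex_of_real (b + 1) islimpt of_real ` {b<..}"
      unfolding islimpt_approachable
    proof (intro allI impI)
      fix e :: real assume "e > 0"
      hence "complex_of_real (b + 1 + e / 2) \<noteq> of_real (b + 1)" "dist (b + 1 + e / 2) (b + 1) < e"
        "b + 1 + e / 2 \<in> {b<..}"
        unfolding of_real_eq_iff by (auto simp: dist_real_def)
      thus "\<exists>x'\<in>complex_of_real ` {b<..}. x' \<noteq> of_real (b + 1) \<and> dist x' (of_real (b + 1)) < e"
        unfolding dist_of_real[symmetric, where ?'a = complex] by blast
    qed
  qed (use E0 in auto)
  define k where "k = (\<lambda>X. of_real X * F (of_real X) - complex_of_real (ln (1 + A * X powr q)))"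
  have k_cont: "continuous_on {X0<..} k"
  proof -
    have "continuous_on {X0<..} (\<lambda>X. F (complex_of_real X))"
      by (rule continuous_on_compose2[OF holomorphic_on_imp_continuous_on[OF F_hol]]) (auto intro!: continuous_intros simp: S_def)
    moreover have "1 + A * X powr q \<noteq> 0" for X using pos[of X] by simp
    ultimately show ?thesis unfolding k_def using X0 by (intro continuous_intros) auto
  qed
  have k_exp: "exp (k X) = 1" if "X > X0" for X
  proof -
    have "exp (of_real X * F (of_real X)) = complex_of_real (1 + A * X powr q)"
      using E_S[of "of_real X"] that X0 powr[of X] by (simp add: S_def E_def)
    moreover have "exp (complex_of_real (ln (1 + A * X powr q))) = complex_of_real (1 + A * X powr q)"
      using pos[of X] by (simp only: exp_of_real exp_ln)
    moreover have "complex_of_real (1 + A * X powr q) \<noteq> 0" using pos[of X] by (simp only: of_real_eq_0_iff)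
    ultimately show ?thesis unfolding k_def exp_diff by simp
  qed
  have "k constant_on {X0<..}"
  proof (rule continuous_discrete_range_constant[OF _ k_cont])
    fix x assume x: "x \<in> {X0<..}"
    have "2 * pi \<le> norm (k y - k x)" if y: "y \<in> {X0<..}" and ne: "k y \<noteq> k x" for y
    proof -
      have "exp (k y - k x) = 1" using k_exp x y by (simp add: exp_diff)
      then obtain n :: int where n: "Re (k y - k x) = 0" "Im (k y - k x) = of_int (2 * n) * pi"
        by (auto simp: exp_eq_1)
      have "n \<noteq> 0"
      proof
        assume "n = 0"
        hence "k y - k x = 0" using n by (simp only: complex_eq_iff) simp
        thus False using ne by simp
      qed
      hence "1 \<le> \<bar>real_of_int n\<bar>" by linarith
      hence "2 * pi * 1 \<le> 2 * pi * \<bar>real_of_int n\<bar>" by (intro mult_left_mono) auto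
      also have "\<dots> = \<bar>Im (k y - k x)\<bar>" unfolding n by (simp add: abs_mult)
      also have "\<dots> \<le> norm (k y - k x)" by (rule abs_Im_le_cmod)
      finally show ?thesis by simp
    qed
    thus "\<exists>e>0. \<forall>y. y \<in> {X0<..} \<and> k y \<noteq> k x \<longrightarrow> e \<le> norm (k y - k x)"
      by (intro exI[of _ "2 * pi"]) auto
  qed auto
  then obtain k0 where k0: "\<And>X. X > X0 \<Longrightarrow> k X = k0" by (auto simp: constant_on_def)
  have "k (b + 1) = 0" unfolding k_def F_real using large[of "b + 1"] by (simp add: b_def)
  hence "k0 = 0" using k0[of "b + 1"] by (simp add: b_def)
  hence FX: "of_real X * F (of_real X) = of_real (ln (1 + A * X powr q))" if "X > X0" for X
    using k0[OF that] by (simp add: k_def)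
  define Z where "Z = (\<lambda>n. X0 + 1 / real (Suc n))"
  have Z: "Z \<longlonglongrightarrow> X0" "\<And>n. Z n > X0"
    unfolding Z_def using tendsto_add[OF tendsto_const[of X0] LIMSEQ_Suc[OF lim_1_over_n]] by auto
  have "(\<lambda>n. F (of_real (Z n))) \<longlonglongrightarrow> F (of_real X0)" unfolding F_def
  proof (rule integral_dominated_convergence[OF _ _ int\<phi>])
    show "AE s in lborel. (\<lambda>n. \<phi> s * exp (- of_real (Z n) * of_real (Y s))) \<longlonglongrightarrow> \<phi> s * exp (- of_real X0 * of_real (Y s))"
      by (intro AE_I2 tendsto_intros Z)
    show "AE s in lborel. norm (\<phi> s * exp (- of_real (Z n) * of_real (Y s))) \<le> norm (\<phi> s) * exp (- X0 * Y s)" for n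
      using Z(2)[of n] by (intro AE_I2) (auto simp: norm_mult Y_def intro!: mult_left_mono mult_right_mono)
  qed measurable
  hence "(\<lambda>n. of_real (Z n) * F (of_real (Z n))) \<longlonglongrightarrow> of_real X0 * F (of_real X0)"
    by (intro tendsto_intros Z)
  moreover have "(\<lambda>n. complex_of_real (ln (1 + A * Z n powr q))) \<longlonglongrightarrow> of_real (ln (1 + A * X0 powr q))"
    using pos[of X0] X0 by (intro tendsto_intros Z) auto
  ultimately have "of_real X0 * F (of_real X0) = of_real (ln (1 + A * X0 powr q))"
    unfolding FX[OF Z(2)] by (rule LIMSEQ_unique)
  thus ?thesis by (simp only: F_real)
qed

lemma
  assumes A: "A > 0"
  shows LINT_fox_H_Laplace: "\<And>X. X > 0 \<Longrightarrow>
      set_integrable lborel {0<..} (\<lambda>s. cap_H q (A * s powr - q) * of_real (X * exp (- s * X))) \<Longrightarrow>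
      (LINT s:{0<..}|lborel. cap_H q (A * s powr - q) * of_real (X * exp (- s * X))) =
        of_real (ln (1 + A * X powr q))"
    and borel_measurable_fox_H:
      "(\<lambda>s. indicator {0<..} s *\<^sub>R cap_H q (A * s powr - q)) \<in> borel_measurable borel"
proof -
  let ?I = "\<lambda>K X s. Laplace_term K q A X s"
  define g where "g = (\<lambda>s. cap_H q (A * s powr - q))"
  have cong: "set_integrable lborel {0<..} (\<lambda>s. g s * of_real (X * exp (- s * X))) \<and>
      (LINT s:{0<..}|lborel. g s * of_real (X * exp (- s * X))) = v"
    if "\<And>s. s > 0 \<Longrightarrow> g s = mb_integral K (mb_kernel q (A * s powr - q))"
      "set_integrable lborel {0<..} (?I K X)" "(LINT s:{0<..}|lborel. ?I K X s) = v" for K X v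
    using that set_integrable_cong[of lborel lborel "{0<..}" "{0<..}" "?I K X" "\<lambda>s. g s * of_real (X * exp (- s * X))"]
      set_lebesgue_integral_cong[of "{0<..}" lborel "?I K X" "\<lambda>s. g s * of_real (X * exp (- s * X))"] by simp
  have "\<exists>Y0\<ge>0. \<forall>X>Y0. set_integrable lborel {0<..} (\<lambda>s. g s * of_real (X * exp (- s * X))) \<and>
      (LINT s:{0<..}|lborel. g s * of_real (X * exp (- s * X))) = of_real (ln (1 + A * X powr q))"
  proof (cases "\<bar>q\<bar> \<le> 2")
    case True
    have g: "g s = mb_integral (Line (-1/8)) (mb_kernel q (A * s powr - q))" if "s > 0" for s
      unfolding g_def using A that True by (intro fox_H_eq_line) auto
    show ?thesis
      by (intro exI[of _ 0] conjI order.refl allI impI cong[OF g] set_integrable_line_Laplace LINT_line_Laplace True A) auto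
  next
    case False
    define e c where "e = sgn q" and "c = - 1 / (4 * \<bar>q\<bar>)"
    have e: "\<bar>e\<bar> = 1" "q * e = \<bar>q\<bar>" "q = e * \<bar>q\<bar>" using False by (auto simp: e_def sgn_if)
    have c: "-1/8 \<le> c" "c < 0" "0 < 1 + q * c"
      using False by (auto simp: c_def field_simps abs_if split: if_splits)
    have g: "g s = mb_integral (loop_contour e c (-1) 1) (mb_kernel q (A * s powr - q))" if "s > 0" for s
      unfolding g_def e_def using A that False c by (intro fox_H_eq_loop) auto
    show ?thesis
    proof (rule exI[of _ "exp \<bar>ln A\<bar>"], rule conjI[rotated], intro allI impI)
      fix X assume X': "X > exp \<bar>ln A\<bar>"
      have X: "X > 0" using X' by (meson exp_gt_zero less_trans)
      have "\<bar>ln A\<bar> < ln X" using X' X by (metis exp_less_cancel_iff exp_ln)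
      moreover have "1 * ln X \<le> \<bar>q\<bar> * ln X" using calculation False by (intro mult_right_mono) auto
      moreover have "\<bar>e * ln A\<bar> = \<bar>ln A\<bar>" using e(1) by (simp add: abs_mult)
      ultimately have "0 < e * ln A + \<bar>q\<bar> * ln X" by linarith
      also have "\<dots> = e * ln (A * X powr q)"
        using A X e(2) by (simp add: ln_mult ln_powr algebra_simps)
      finally have ew: "e * ln (A * X powr q) > 0" .
      show "set_integrable lborel {0<..} (\<lambda>s. g s * of_real (X * exp (- s * X))) \<and>
          (LINT s:{0<..}|lborel. g s * of_real (X * exp (- s * X))) = of_real (ln (1 + A * X powr q))"
        by (rule cong[OF g set_integrable_loop_Laplace[OF e(1,2) c A X ew] LINT_loop_Laplace[OF e(1,2) c A X ew]])
    qed simp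
  qed
  then obtain Y0 where Y0_nonneg: "Y0 \<ge> 0"
    and *: "\<forall>X>Y0. set_integrable lborel {0<..} (\<lambda>s. g s * of_real (X * exp (- s * X))) \<and>
      (LINT s:{0<..}|lborel. g s * of_real (X * exp (- s * X))) = of_real (ln (1 + A * X powr q))"
    by (elim exE conjE)
  note Y0 = Y0_nonneg *[rule_format, THEN conjunct1] *[rule_format, THEN conjunct2]
  show "(LINT s:{0<..}|lborel. cap_H q (A * s powr - q) * of_real (X * exp (- s * X))) =
        of_real (ln (1 + A * X powr q))"
    if "X > 0" "set_integrable lborel {0<..} (\<lambda>s. cap_H q (A * s powr - q) * of_real (X * exp (- s * X)))" for X
    using Laplace_continuation[OF A that(1) _ Y0(3)] that(2) unfolding g_def by blast
  have "(\<lambda>s. indicator {0<..} s *\<^sub>R g s) \<in> borel_measurable borel"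
    using set_integrable_imp_measurable_quotient[OF Y0(2)[of "Y0 + 1"]] Y0(1) by simp
  thus "(\<lambda>s. indicator {0<..} s *\<^sub>R cap_H q (A * s powr - q)) \<in> borel_measurable borel"
    by (simp add: g_def)
qed

lemma deriv_joint_mgf:
  fixes \<gamma> :: "nat \<Rightarrow> 'a \<Rightarrow> real" and L :: nat and p s :: real
  defines "X \<equiv> \<lambda>\<omega>. \<Sum>l=1..L. \<gamma> l \<omega> powr p"
  assumes "prob_space M" and X: "X \<in> borel_measurable M" and s: "s > 0"
  shows "deriv (joint_mgf M p L \<gamma>) s = - (\<integral>\<omega>. X \<omega> * exp (- s * X \<omega>) \<partial>M)"
proof -
  interpret prob_space M by fact
  have X0: "X \<omega> \<ge> 0" for \<omega> unfolding X_def by (intro sum_nonneg) auto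
  define F where "F = (\<lambda>z. \<integral>\<omega>. 1 * exp (- z * complex_of_real (X \<omega>)) \<partial>M)"
  define F' where "F' = (\<integral>\<omega>. 1 * (- complex_of_real (X \<omega>) * exp (- of_real s * of_real (X \<omega>))) \<partial>M)"
  have "(F has_field_derivative F') (at (of_real s))"
    unfolding F_def F'_def
    using Laplace_has_field_derivative[of "\<lambda>_. 1" M X 0 "of_real s"] X X0 s by simp
  hence "((\<lambda>s. F (of_real s)) has_vector_derivative F') (at s)"
    by (rule has_vector_derivative_real_field)
  moreover have "(\<lambda>s. F (of_real s)) = (\<lambda>s. complex_of_real (joint_mgf M p L \<gamma> s))"
  proof
    fix s
    have "F (of_real s) = (\<integral>\<omega>. complex_of_real (exp (- s * X \<omega>)) \<partial>M)"
      unfolding F_def by (simp flip: exp_of_real)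
    thus "F (of_real s) = complex_of_real (joint_mgf M p L \<gamma> s)"
      unfolding integral_complex_of_real by (simp add: joint_mgf_def X_def)
  qed
  moreover have "F' = complex_of_real (- (\<integral>\<omega>. X \<omega> * exp (- s * X \<omega>) \<partial>M))"
  proof -
    have "F' = (\<integral>\<omega>. complex_of_real (- (X \<omega> * exp (- s * X \<omega>))) \<partial>M)"
      unfolding F'_def by (simp flip: exp_of_real)
    thus ?thesis unfolding integral_complex_of_real by simp
  qed
  ultimately have "((\<lambda>s. complex_of_real (joint_mgf M p L \<gamma> s)) has_vector_derivative
      complex_of_real (- (\<integral>\<omega>. X \<omega> * exp (- s * X \<omega>) \<partial>M))) (at s)" by simp
  hence "((\<lambda>s. Re (complex_of_real (joint_mgf M p L \<gamma> s))) has_vector_derivative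
      Re (complex_of_real (- (\<integral>\<omega>. X \<omega> * exp (- s * X \<omega>) \<partial>M)))) (at s)"
    unfolding has_vector_derivative_complex_iff by (simp add: has_real_derivative_iff_has_vector_derivative)
  hence "(joint_mgf M p L \<gamma> has_real_derivative - (\<integral>\<omega>. X \<omega> * exp (- s * X \<omega>) \<partial>M)) (at s)"
    by (simp add: has_real_derivative_iff_has_vector_derivative)
  thus ?thesis by (rule DERIV_imp_deriv)
qed

theorem theorem1:
  fixes M :: "'a measure" and \<gamma> :: "nat \<Rightarrow> 'a \<Rightarrow> real" and f :: "(nat \<Rightarrow> real) \<Rightarrow> ennreal"
    and L :: nat and W \<eta> p q :: real
  assumes "prob_space M"
    and "L \<ge> 1" and "W > 0" and "\<eta> > 0"
    and "\<And>l \<omega>. l \<in> {1..L} \<Longrightarrow> \<omega> \<in> space M \<Longrightarrow> \<gamma> l \<omega> > 0"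
    and "distributed M (\<Pi>\<^sub>M l\<in>{1..L}. lborel) (\<lambda>\<omega>. \<lambda>l\<in>{1..L}. \<gamma> l \<omega>) f"
    and "\<bar>q\<bar> > 2 \<Longrightarrow> set_integrable lborel {0<..}
           (\<lambda>s. C_aux \<eta> q L s * of_real (deriv (joint_mgf M p L \<gamma>) s))"
  shows "(integrable M (\<lambda>\<omega>. W * log 2 (1 + gamma_end \<eta> p q L \<gamma> \<omega>)) \<longleftrightarrow>
          set_integrable lborel {0<..}
            (\<lambda>s. C_aux \<eta> q L s * of_real (deriv (joint_mgf M p L \<gamma>) s))) \<and>
         complex_of_real (ergodic_capacity M W (gamma_end \<eta> p q L \<gamma>)) =
           of_real (W / ln 2) *
           (LINT s:{0<..}|lborel. C_aux \<eta> q L s * of_real (deriv (joint_mgf M p L \<gamma>) s))"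
proof -
  let ?CM = "\<lambda>s. C_aux \<eta> q L s * of_real (deriv (joint_mgf M p L \<gamma>) s)"
  interpret prob_space M by fact
  interpret pair_sigma_finite M lborel ..
  define X where "X = (\<lambda>\<omega>. \<Sum>l=1..L. \<gamma> l \<omega> powr p)"
  define A where "A = \<eta> / real L powr q"
  have A: "A > 0" using assms(2,4) by (simp add: A_def)
  have \<gamma>_meas: "\<gamma> l \<in> borel_measurable M" if "l \<in> {1..L}" for l
  proof -
    have "(\<lambda>\<omega>. \<lambda>l\<in>{1..L}. \<gamma> l \<omega>) \<in> measurable M (\<Pi>\<^sub>M l\<in>{1..L}. lborel)"
      using assms(6) by (simp add: distributed_def)
    from measurable_compose[OF this measurable_component_singleton[OF that]]
    show ?thesis using that by simp
  qed
  have X_meas [measurable]: "X \<in> borel_measurable M"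
    unfolding X_def
  proof (intro borel_measurable_sum)
    fix l assume "l \<in> {1..L}"
    note [measurable] = \<gamma>_meas[OF this]
    show "(\<lambda>\<omega>. \<gamma> l \<omega> powr p) \<in> borel_measurable M" by measurable
  qed
  have X_pos: "X \<omega> > 0" if "\<omega> \<in> space M" for \<omega>
    unfolding X_def using assms(2,5) that by (intro sum_pos) (auto simp: less_imp_neq[symmetric])
  define V where "V = (\<lambda>\<omega>. ln (1 + A * X \<omega> powr q))"
  have V_meas [measurable]: "V \<in> borel_measurable M" unfolding V_def by measurable
  have V0: "V \<omega> \<ge> 0" for \<omega> using A by (simp add: V_def)
  have gend: "W * log 2 (1 + gamma_end \<eta> p q L \<gamma> \<omega>) = W / ln 2 * V \<omega>" if "\<omega> \<in> space M" for \<omega>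
  proof -
    have "gamma_end \<eta> p q L \<gamma> \<omega> = \<eta> * (X \<omega> / real L) powr q" by (simp add: gamma_end_def X_def)
    also have "\<dots> = A * X \<omega> powr q"
      using X_pos[OF that] assms(2) by (simp add: A_def powr_divide)
    finally show ?thesis by (simp add: V_def log_def)
  qed
  define g where "g = (\<lambda>s. cap_H q (A * s powr - q))"
  define D where "D = (\<lambda>s. \<integral>\<omega>. X \<omega> * exp (- s * X \<omega>) \<partial>M)"
  have C_eq: "?CM s = g s * of_real (D s)" if "s > 0" for s
  proof -
    have "\<eta> / (real L powr q * s powr q) = A * s powr - q"
      by (simp add: A_def powr_minus_divide)
    moreover have "deriv (joint_mgf M p L \<gamma>) s = - D s"
      unfolding D_def X_def using deriv_joint_mgf[OF assms(1) X_meas[unfolded X_def] that] .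
    ultimately show ?thesis by (simp add: C_aux_def g_def)
  qed
  define h where "h = (\<lambda>s. indicator {0<..} s *\<^sub>R (g s * complex_of_real (D s)))"
  define k where "k = (\<lambda>\<omega> s. indicator {0<..} s *\<^sub>R (g s * complex_of_real (X \<omega> * exp (- s * X \<omega>))))"
  have k_meas [measurable]: "case_prod k \<in> borel_measurable (M \<Otimes>\<^sub>M lborel)"
  proof -
    define g' where "g' = (\<lambda>s. indicator {0<..} s *\<^sub>R g s)"
    have [measurable]: "g' \<in> borel_measurable borel"
      unfolding g'_def g_def by (rule borel_measurable_fox_H[OF A])
    have "case_prod k = (\<lambda>(\<omega>, s). g' s * complex_of_real (X \<omega> * exp (- s * X \<omega>)))"
      by (auto simp: k_def g'_def fun_eq_iff)
    thus ?thesis by (simp only:) measurable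
  qed
  have kint: "integrable M (\<lambda>\<omega>. X \<omega> * exp (- s * X \<omega>))" if "s > 0" for s
  proof (rule integrable_const_bound[where B = "1 / s"])
    show "AE \<omega> in M. norm (X \<omega> * exp (- s * X \<omega>)) \<le> 1 / s"
    proof (rule AE_I2)
      fix \<omega> assume "\<omega> \<in> space M"
      have "s * X \<omega> \<le> exp (s * X \<omega>)" using exp_ge_add_one_self[of "s * X \<omega>"] by linarith
      thus "norm (X \<omega> * exp (- s * X \<omega>)) \<le> 1 / s"
        using that X_pos[OF \<open>\<omega> \<in> space M\<close>] by (simp add: exp_minus field_simps)
    qed
  qed measurable
  have kh: "(\<integral>\<omega>. k \<omega> s \<partial>M) = h s" for s
  proof (cases "s > 0")
    case True
    hence "(\<integral>\<omega>. k \<omega> s \<partial>M) = (\<integral>\<omega>. g s * complex_of_real (X \<omega> * exp (- s * X \<omega>)) \<partial>M)" by (simp add: k_def)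
    also have "\<dots> = g s * of_real (D s)" unfolding integral_mult_right_zero integral_complex_of_real D_def ..
    finally show ?thesis using True by (simp add: h_def)
  qed (simp add: k_def h_def)
  have h_meas [measurable]: "h \<in> borel_measurable lborel"
  proof -
    have "case_prod (\<lambda>s \<omega>. k \<omega> s) \<in> borel_measurable (lborel \<Otimes>\<^sub>M M)"
      using measurable_compose[OF measurable_pair_swap' k_meas] by (simp add: case_prod_beta')
    hence "(\<lambda>s. \<integral>\<omega>. k \<omega> s \<partial>M) \<in> borel_measurable lborel"
      by (rule sigma_finite_measure.borel_measurable_lebesgue_integral[rotated]) unfold_locales
    thus ?thesis by (simp only: kh)
  qed
  have nh: "(\<integral>\<^sup>+\<omega>. ennreal (norm (k \<omega> s)) \<partial>M) = ennreal (norm (h s))" for s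
  proof (cases "s > 0")
    case True
    have D0: "D s \<ge> 0" unfolding D_def using X_pos by (intro integral_nonneg_AE AE_I2) (auto simp: less_imp_le)
    have "(\<integral>\<^sup>+\<omega>. ennreal (norm (k \<omega> s)) \<partial>M) = (\<integral>\<^sup>+\<omega>. ennreal (norm (g s) * (X \<omega> * exp (- s * X \<omega>))) \<partial>M)"
      using True X_pos by (intro nn_integral_cong) (simp add: k_def norm_mult less_imp_le)
    also have "\<dots> = ennreal (\<integral>\<omega>. norm (g s) * (X \<omega> * exp (- s * X \<omega>)) \<partial>M)"
      using X_pos kint[OF True] by (intro nn_integral_eq_integral AE_I2) (auto simp: less_imp_le)
    also have "(\<integral>\<omega>. norm (g s) * (X \<omega> * exp (- s * X \<omega>)) \<partial>M) = norm (h s)"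
    proof -
      have "(\<integral>\<omega>. X \<omega> * exp (- s * X \<omega>) \<partial>M) = D s" by (simp only: D_def)
      thus ?thesis using True D0 unfolding integral_mult_right_zero by (simp only:) (simp add: h_def norm_mult)
    qed
    finally show ?thesis .
  qed (simp add: k_def h_def)
  have tonelli: "(\<integral>\<^sup>+\<omega>. \<integral>\<^sup>+s. ennreal (norm (k \<omega> s)) \<partial>lborel \<partial>M) = (\<integral>\<^sup>+s. ennreal (norm (h s)) \<partial>lborel)"
    using Fubini[of "\<lambda>(\<omega>, s). ennreal (norm (k \<omega> s))"] by (simp add: nh)
  have set_h: "set_integrable lborel {0<..} ?CM \<longleftrightarrow> integrable lborel h"
    unfolding set_integrable_def h_def
    by (intro Bochner_Integration.integrable_cong) (auto simp: C_eq indicator_def)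
  have LINT_h: "(LINT s:{0<..}|lborel. ?CM s) = integral\<^sup>L lborel h"
    unfolding set_lebesgue_integral_def h_def
    by (intro Bochner_Integration.integral_cong) (auto simp: C_eq indicator_def)
  have int_V: "integrable M (\<lambda>\<omega>. W * log 2 (1 + gamma_end \<eta> p q L \<gamma> \<omega>)) \<longleftrightarrow> integrable M V"
  proof -
    have "integrable M (\<lambda>\<omega>. W * log 2 (1 + gamma_end \<eta> p q L \<gamma> \<omega>)) \<longleftrightarrow> integrable M (\<lambda>\<omega>. W / ln 2 * V \<omega>)"
      by (rule Bochner_Integration.integrable_cong) (simp_all only: gend)
    also have "\<dots> \<longleftrightarrow> integrable M V"
      unfolding integrable_mult_left_iff using assms(3) by simp
    finally show ?thesis .
  qed
  have cap: "ergodic_capacity M W (gamma_end \<eta> p q L \<gamma>) = W / ln 2 * integral\<^sup>L M V"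
  proof -
    have "ergodic_capacity M W (gamma_end \<eta> p q L \<gamma>) = (\<integral>\<omega>. W / ln 2 * V \<omega> \<partial>M)"
      unfolding ergodic_capacity_def by (rule Bochner_Integration.integral_cong) (simp_all only: gend)
    thus ?thesis by (simp only: integral_mult_right_zero)
  qed
  have fwd: "integrable M V \<and> of_real (integral\<^sup>L M V) = integral\<^sup>L lborel h" if h: "integrable lborel h"
  proof -
    have "(\<integral>\<^sup>+s. ennreal (norm (h s)) \<partial>lborel) < \<infinity>" using h by (simp add: integrable_iff_bounded)
    hence "(\<integral>\<^sup>+\<omega>. \<integral>\<^sup>+s. ennreal (norm (k \<omega> s)) \<partial>lborel \<partial>M) < \<infinity>" by (simp only: tonelli)
    hence "(\<integral>\<^sup>+x. ennreal (norm (case_prod k x)) \<partial>(M \<Otimes>\<^sub>M lborel)) < \<infinity>"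
      by (subst lborel.nn_integral_fst[symmetric]) auto
    hence kk: "integrable (M \<Otimes>\<^sub>M lborel) (case_prod k)"
      by (simp add: integrable_iff_bounded)
    have VAE: "AE \<omega> in M. (LBINT s. k \<omega> s) = of_real (V \<omega>)"
      using AE_integrable_fst'[OF kk] AE_space
    proof eventually_elim
      case (elim \<omega>)
      have "set_integrable lborel {0<..} (\<lambda>s. g s * complex_of_real (X \<omega> * exp (- s * X \<omega>)))"
        using elim(1) unfolding set_integrable_def by (simp only: k_def case_prod_conv)
      from LINT_fox_H_Laplace[OF A X_pos[OF elim(2)] this[unfolded g_def]]
      show ?case by (simp add: k_def g_def V_def set_lebesgue_integral_def)
    qed
    have "integrable M (\<lambda>\<omega>. LBINT s. k \<omega> s)" using integrable_fst'[OF kk] by simp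
    hence "integrable M (\<lambda>\<omega>. complex_of_real (V \<omega>))"
      by (rule integrable_cong_AE_imp[OF _ _ VAE]) measurable
    hence V_int: "integrable M V" by (simp only: complex_of_real_integrable_eq)
    have "complex_of_real (integral\<^sup>L M V) = (\<integral>\<omega>. complex_of_real (V \<omega>) \<partial>M)"
      by (rule integral_complex_of_real[symmetric])
    also have "\<dots> = (\<integral>\<omega>. \<integral>s. k \<omega> s \<partial>lborel \<partial>M)"
      by (rule integral_cong_AE[symmetric, OF _ _ VAE]) (use integrable_fst'[OF kk] in auto)
    also have "\<dots> = (LBINT s. \<integral>\<omega>. k \<omega> s \<partial>M)"
      by (rule Fubini_integral[OF kk, symmetric])
    finally show ?thesis using V_int by (simp only: kh simp_thms)
  qed
  have bwd: "integrable lborel h" if V_int: "integrable M V" and q: "\<bar>q\<bar> \<le> 2"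
  proof -
    obtain K where K: "K \<ge> 0"
      "\<And>X. X > 0 \<Longrightarrow> (\<integral>\<^sup>+s. ennreal (indicator {0<..} s * norm (g s) * (X * exp (- s * X))) \<partial>lborel) \<le> ennreal (K * (1 + ln (1 + A * X powr q)))"
      unfolding g_def by (rule nn_integral_fox_H_Laplace_le[OF q A]) blast
    have KV: "integrable M (\<lambda>\<omega>. K * (1 + V \<omega>))"
      using V_int by (intro integrable_mult_right Bochner_Integration.integrable_add) auto
    have "(\<integral>\<^sup>+\<omega>. \<integral>\<^sup>+s. ennreal (norm (k \<omega> s)) \<partial>lborel \<partial>M) \<le> (\<integral>\<^sup>+\<omega>. ennreal (K * (1 + V \<omega>)) \<partial>M)"
    proof (rule nn_integral_mono)
      fix \<omega> assume \<omega>: "\<omega> \<in> space M"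
      have "norm (k \<omega> s) = indicator {0<..} s * norm (g s) * (X \<omega> * exp (- s * X \<omega>))" for s
        using X_pos[OF \<omega>] by (simp add: k_def norm_mult indicator_def)
      thus "(\<integral>\<^sup>+s. ennreal (norm (k \<omega> s)) \<partial>lborel) \<le> ennreal (K * (1 + V \<omega>))"
        using K(2)[OF X_pos[OF \<omega>]] by (simp only: V_def)
    qed
    also have "\<dots> = ennreal (\<integral>\<omega>. K * (1 + V \<omega>) \<partial>M)"
      by (rule nn_integral_eq_integral[OF KV]) (use K(1) V0 in \<open>simp add: add_nonneg_nonneg\<close>)
    also have "\<dots> < \<infinity>" by simp
    finally show ?thesis unfolding tonelli by (simp add: integrable_iff_bounded)
  qed
  have equiv: "integrable M V \<longleftrightarrow> integrable lborel h"
  proof (cases "\<bar>q\<bar> \<le> 2")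
    case True
    thus ?thesis using fwd bwd by blast
  next
    case False
    hence "integrable lborel h" using assms(7) by (simp add: set_h)
    thus ?thesis using fwd by blast
  qed
  have "complex_of_real (integral\<^sup>L M V) = integral\<^sup>L lborel h"
  proof (cases "integrable lborel h")
    case True
    thus ?thesis using fwd by blast
  next
    case False
    thus ?thesis using equiv by (simp add: not_integrable_integral_eq)
  qed
  thus ?thesis
    unfolding int_V set_h LINT_h cap using equiv by simp
qed

end
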